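(* Let $k\in\mathbb{N}_0$ and suppose $h\in C^{k,k}(\overline\Theta\times\overline\Theta)$ is positive definite. Let $\{(\lambda_{j,k},e_{j,k})\}_j$ denote the eigensystem of the associated kernel operator $T_{h,k}$. Suppose $\Theta$ has the cone property and $k-d/2>s$ for some $s\in\mathbb{N}_0$. Then there is a constant $C=C(\Theta,k,d)>0$, depending only on $\Theta,k,d$, such that $$\max_{|\alpha|\le s}\ \sup_{x\in\Theta}\big|e_{j,k}^{[\alpha]}(x)\big|\le C\quad\text{for all } j,$$ and with any such $C$, for every $m\in\mathbb{N}$, $$\max_{|\alpha|,|\beta|\le s}\ \sup_{x,y\in\overline\Theta}\Big|\partial^{[\alpha,\beta]}h(x,y)-\sum_{j\le m}\lambda_{j,k}\,e_{j,k}^{[\alpha]}(x)\,e_{j,k}^{[\beta]}(y)\Big|\le C^2\sum_{j>m}\lambda_{j,k}.$$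
   Context: $d\in\mathbb{N}$ and $\Theta\subset\mathbb{R}^d$ is a bounded domain, meaning a bounded open subset. All functions are real-valued; $\alpha,\beta\in\mathbb{N}_0^d$ are multi-indices. $f^{(\alpha)}$ is the weak and $f^{[\alpha]}$ the classical derivative. $\partial^{[\alpha,\beta]}h$ is the classical mixed derivative of a kernel $h$ on $\Theta\times\Theta$, of order $\alpha$ in the first variable and $\beta$ in the second. $C^{k,k}(\overline\Theta\times\overline\Theta)$ is the class of uniformly continuous kernels $h\colon\Theta\times\Theta\to\mathbb{R}$ whose mixed partial derivatives $\partial^{[\alpha,\beta]}h$ exist and are uniformly continuous on $\Theta\times\Theta$ for $|\alpha|,|\beta|\le k$. Uniformly continuous functions are identified with their continuous extensions to the closure. A kernel $h$ is positive definite if it is symmetric and $\sum_{i,j\le n}c_i\,h(x_i,x_j)\,c_j\ge0$ for all $n\in\mathbb{N}$, $c_i\in\mathbb{R}$, $x_i\in\Theta$. $H^k(\Theta)$ is the $L^2$-based Sobolev space with inner product $\langle f,g\rangle_{H^k}=\sum_{|\alpha|\le k}\langle f^{(\alpha)},g^{(\alpha)}\rangle_{L^2}$. The kernel operator of order $k$ associated with $h$ is the self-adjoint Hilbert-Schmidt operator $T_{h,k}\colon H^k(\Theta)\to H^k(\Theta)$, $$[T_{h,k}f](y)=\int_\Theta\sum_{|\alpha|\le k}\partial^{[\alpha,0]}h(x,y)\,f^{(\alpha)}(x)\,dx .$$ Its eigensystem consists of the non-zero eigenvalues $\lambda_{j,k}$, counted with multiplicity and in order of decreasing absolute value, with corresponding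 $H^k$-orthonormal eigenfunctions $e_{j,k}$, which have (and are identified with) representatives in $C^k(\overline\Theta)$, the space of $f\in C^k(\Theta)$ with $f^{[\alpha]}$ uniformly continuous for $|\alpha|\le k$. The index $j$ runs over $\mathbb{N}$, or over $\{1,\dots,N\}$ if $N=\mathrm{rank}(T_{h,k})<\infty$; sums over $j$ are over this index set. Cone property: given $x,z\in\mathbb{R}^d$ and open balls $\mathbb{B}_\epsilon(x),\mathbb{B}_\tau(z)$ with $x\notin\mathbb{B}_\tau(z)$, the set $\mathbb{B}_\epsilon(x)\cap\{x+\lambda(y-x)\mid y\in\mathbb{B}_\tau(z),\lambda>0\}$ is a finite cone with vertex $x$. $\Theta$ has the cone property if there is a finite cone $C_0$ such that every $x\in\Theta$ is the vertex of a finite cone contained in $\Theta$ and congruent to $C_0$ (obtained by rigid motion). *)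

theory Defs
  imports "HOL-Analysis.Analysis"
begin

section \<open>Classical derivatives\<close>

text \<open>A domain is a bounded open set in \<open>real ^ 'd\<close>; functions on it are total functions whose
  values off the domain are never used. Since all derivatives are taken at points of an open set,
  they depend only on the values inside that set.\<close>

definition partial_deriv :: "'a::real_normed_vector \<Rightarrow> ('a \<Rightarrow> real) \<Rightarrow> 'a \<Rightarrow> real" where
  "partial_deriv b f x = deriv (\<lambda>t. f (x + t *\<^sub>R b)) 0"

primrec iter_partial :: "'a::real_normed_vector list \<Rightarrow> ('a \<Rightarrow> real) \<Rightarrow> 'a \<Rightarrow> real" where
  "iter_partial [] f = f"
| "iter_partial (b # bs) f = partial_deriv b (iter_partial bs f)"

primrec iter_partial_exists ::
  "'a::real_normed_vector set \<Rightarrow> 'a list \<Rightarrow> ('a \<Rightarrow> real) \<Rightarrow> bool" where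
  "iter_partial_exists S [] f = True"
| "iter_partial_exists S (b # bs) f =
     (iter_partial_exists S bs f \<and>
      (\<forall>x\<in>S. (\<lambda>t. iter_partial bs f (x + t *\<^sub>R b)) field_differentiable at 0))"

definition mi_order :: "nat ^ 'd \<Rightarrow> nat" where
  "mi_order \<alpha> = (\<Sum>i\<in>UNIV. \<alpha> $ i)"

text \<open>A list containing each coordinate \<open>i\<close> exactly \<open>\<alpha> $ i\<close> times. The order of the list is
  immaterial: derivatives of order \<open>\<alpha>\<close> are only formed for functions all of whose iterated
  partial derivatives of that order are continuous, so that partial derivatives commute.\<close>

definition mi_dirs :: "nat ^ 'd \<Rightarrow> 'd list" where
  "mi_dirs \<alpha> = (SOME ds. \<forall>i. count_list ds i = \<alpha> $ i)"

definition coord_dir :: "'d \<Rightarrow> real ^ 'd" where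
  "coord_dir i = axis i 1"

definition classical_deriv :: "nat ^ 'd \<Rightarrow> (real ^ 'd \<Rightarrow> real) \<Rightarrow> real ^ 'd \<Rightarrow> real" where
  "classical_deriv \<alpha> f = iter_partial (map coord_dir (mi_dirs \<alpha>)) f"

definition C_k :: "nat \<Rightarrow> (real ^ 'd) set \<Rightarrow> (real ^ 'd \<Rightarrow> real) set" where
  "C_k k \<Theta> = {f. \<forall>ds. length ds \<le> k \<longrightarrow>
     iter_partial_exists \<Theta> (map coord_dir ds) f \<and>
     continuous_on \<Theta> (iter_partial (map coord_dir ds) f)}"

definition C_k_closure :: "nat \<Rightarrow> (real ^ 'd) set \<Rightarrow> (real ^ 'd \<Rightarrow> real) set" where
  "C_k_closure k \<Theta> = {f \<in> C_k k \<Theta>. \<forall>\<alpha>. mi_order \<alpha> \<le> k \<longrightarrow>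
     uniformly_continuous_on \<Theta> (classical_deriv \<alpha> f)}"

text \<open>Coordinate directions of the product space: \<open>Inl i\<close> is the \<open>i\<close>-th coordinate of the first
  variable, \<open>Inr i\<close> that of the second.\<close>

fun coord_dir2 :: "'d + 'd \<Rightarrow> (real ^ 'd) \<times> (real ^ 'd)" where
  "coord_dir2 (Inl i) = (coord_dir i, 0)"
| "coord_dir2 (Inr i) = (0, coord_dir i)"

definition mixed_deriv ::
  "nat ^ 'd \<Rightarrow> nat ^ 'd \<Rightarrow> ((real ^ 'd) \<times> (real ^ 'd) \<Rightarrow> real) \<Rightarrow> (real ^ 'd) \<times> (real ^ 'd) \<Rightarrow> real" where
  "mixed_deriv \<alpha> \<beta> h =
     iter_partial (map coord_dir2 (map Inl (mi_dirs \<alpha>) @ map Inr (mi_dirs \<beta>))) h"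

text \<open>Existence and uniform continuity are required for every order of differentiation with at
  most \<open>k\<close> derivatives in each variable; \<open>ds = []\<close> gives uniform continuity of the kernel.\<close>

definition C_kk_closure :: "nat \<Rightarrow> (real ^ 'd) set \<Rightarrow> ((real ^ 'd) \<times> (real ^ 'd) \<Rightarrow> real) set" where
  "C_kk_closure k \<Theta> = {h. \<forall>ds. length (filter isl ds) \<le> k \<and> length (filter (\<lambda>d. \<not> isl d) ds) \<le> k \<longrightarrow>
     iter_partial_exists (\<Theta> \<times> \<Theta>) (map coord_dir2 ds) h \<and>
     uniformly_continuous_on (\<Theta> \<times> \<Theta>) (iter_partial (map coord_dir2 ds) h)}"

text \<open>The continuous extension to the closure of a uniformly continuous function on \<open>S\<close>.\<close>

definition closure_ext :: "'a::topological_space set \<Rightarrow> ('a \<Rightarrow> real) \<Rightarrow> 'a \<Rightarrow> real" where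
  "closure_ext S f x = (if x \<in> S then f x else Lim (at x within S) f)"

definition pos_def_kernel :: "'a set \<Rightarrow> ('a \<times> 'a \<Rightarrow> real) \<Rightarrow> bool" where
  "pos_def_kernel \<Theta> h \<longleftrightarrow>
     (\<forall>x\<in>\<Theta>. \<forall>y\<in>\<Theta>. h (x, y) = h (y, x)) \<and>
     (\<forall>(n::nat) (c::nat \<Rightarrow> real) x. (\<forall>i<n. x i \<in> \<Theta>) \<longrightarrow>
        0 \<le> (\<Sum>i<n. \<Sum>j<n. c i * h (x i, x j) * c j))"


section \<open>Weak derivatives and Sobolev spaces\<close>

definition test_function :: "(real ^ 'd) set \<Rightarrow> (real ^ 'd \<Rightarrow> real) \<Rightarrow> bool" where
  "test_function \<Theta> \<phi> \<longleftrightarrow> (\<forall>k. \<phi> \<in> C_k k UNIV) \<and>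
     compact (closure {x. \<phi> x \<noteq> 0}) \<and> closure {x. \<phi> x \<noteq> 0} \<subseteq> \<Theta>"

definition locally_integrable :: "(real ^ 'd) set \<Rightarrow> (real ^ 'd \<Rightarrow> real) \<Rightarrow> bool" where
  "locally_integrable \<Theta> f \<longleftrightarrow> (\<forall>K. compact K \<and> K \<subseteq> \<Theta> \<longrightarrow> integrable (lebesgue_on K) f)"

definition has_weak_deriv ::
  "(real ^ 'd) set \<Rightarrow> nat ^ 'd \<Rightarrow> (real ^ 'd \<Rightarrow> real) \<Rightarrow> (real ^ 'd \<Rightarrow> real) \<Rightarrow> bool" where
  "has_weak_deriv \<Theta> \<alpha> f g \<longleftrightarrow> locally_integrable \<Theta> f \<and> locally_integrable \<Theta> g \<and>
     (\<forall>\<phi>. test_function \<Theta> \<phi> \<longrightarrow>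
        (\<integral>x. f x * classical_deriv \<alpha> \<phi> x \<partial>lebesgue_on \<Theta>) =
        (-1) ^ mi_order \<alpha> * (\<integral>x. g x * \<phi> x \<partial>lebesgue_on \<Theta>))"

text \<open>Determined up to a null set of \<open>\<Theta>\<close>, like every element of \<open>L\<^sup>2\<close> below: elements of the
  Sobolev space are represented by functions, and their equality is equality almost everywhere.\<close>

definition weak_deriv :: "(real ^ 'd) set \<Rightarrow> nat ^ 'd \<Rightarrow> (real ^ 'd \<Rightarrow> real) \<Rightarrow> real ^ 'd \<Rightarrow> real" where
  "weak_deriv \<Theta> \<alpha> f = (SOME g. has_weak_deriv \<Theta> \<alpha> f g)"

definition L2_space :: "(real ^ 'd) set \<Rightarrow> (real ^ 'd \<Rightarrow> real) set" where
  "L2_space \<Theta> = {f. f \<in> borel_measurable (lebesgue_on \<Theta>) \<and> integrable (lebesgue_on \<Theta>) (\<lambda>x. (f x)\<^sup>2)}"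

definition sobolev :: "(real ^ 'd) set \<Rightarrow> nat \<Rightarrow> (real ^ 'd \<Rightarrow> real) set" where
  "sobolev \<Theta> k = {f \<in> L2_space \<Theta>. \<forall>\<alpha>. mi_order \<alpha> \<le> k \<longrightarrow>
     (\<exists>g \<in> L2_space \<Theta>. has_weak_deriv \<Theta> \<alpha> f g)}"

definition sobolev_inner ::
  "(real ^ 'd) set \<Rightarrow> nat \<Rightarrow> (real ^ 'd \<Rightarrow> real) \<Rightarrow> (real ^ 'd \<Rightarrow> real) \<Rightarrow> real" where
  "sobolev_inner \<Theta> k f g =
     (\<Sum>\<alpha> | mi_order \<alpha> \<le> k. \<integral>x. weak_deriv \<Theta> \<alpha> f x * weak_deriv \<Theta> \<alpha> g x \<partial>lebesgue_on \<Theta>)"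


section \<open>The kernel operator and its eigensystem\<close>

definition kernel_op ::
  "(real ^ 'd) set \<Rightarrow> nat \<Rightarrow> ((real ^ 'd) \<times> (real ^ 'd) \<Rightarrow> real) \<Rightarrow> (real ^ 'd \<Rightarrow> real) \<Rightarrow> real ^ 'd \<Rightarrow> real" where
  "kernel_op \<Theta> k h f y =
     (\<integral>x. (\<Sum>\<alpha> | mi_order \<alpha> \<le> k. mixed_deriv \<alpha> 0 h (x, y) * weak_deriv \<Theta> \<alpha> f x) \<partial>lebesgue_on \<Theta>)"

definition eigenfunction ::
  "(real ^ 'd) set \<Rightarrow> nat \<Rightarrow> ((real ^ 'd) \<times> (real ^ 'd) \<Rightarrow> real) \<Rightarrow> real \<Rightarrow> (real ^ 'd \<Rightarrow> real) \<Rightarrow> bool" where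
  "eigenfunction \<Theta> k h \<mu> f \<longleftrightarrow> f \<in> sobolev \<Theta> k \<and>
     (AE y in lebesgue_on \<Theta>. kernel_op \<Theta> k h f y = \<mu> * f y)"

text \<open>\<open>J\<close> is the index set. Counting with multiplicity means that, for every \<open>\<mu> \<noteq> 0\<close>, the
  orthonormal functions \<open>e j\<close> with \<open>lam j = \<mu>\<close> span the whole eigenspace of \<open>\<mu>\<close>; in particular
  every non-zero eigenvalue is listed, and if \<open>J = {1..N}\<close> then \<open>N\<close> is the rank of the
  (compact self-adjoint) kernel operator.\<close>

definition eigensystem ::
  "(real ^ 'd) set \<Rightarrow> nat \<Rightarrow> ((real ^ 'd) \<times> (real ^ 'd) \<Rightarrow> real) \<Rightarrow>
    nat set \<Rightarrow> (nat \<Rightarrow> real) \<Rightarrow> (nat \<Rightarrow> real ^ 'd \<Rightarrow> real) \<Rightarrow> bool" where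
  "eigensystem \<Theta> k h J lam e \<longleftrightarrow>
     (J = {1..} \<or> (\<exists>N. J = {1..N})) \<and>
     (\<forall>j\<in>J. lam j \<noteq> 0) \<and>
     (\<forall>i\<in>J. \<forall>j\<in>J. i \<le> j \<longrightarrow> \<bar>lam j\<bar> \<le> \<bar>lam i\<bar>) \<and>
     (\<forall>j\<in>J. e j \<in> C_k_closure k \<Theta> \<and> eigenfunction \<Theta> k h (lam j) (e j)) \<and>
     (\<forall>i\<in>J. \<forall>j\<in>J. sobolev_inner \<Theta> k (e i) (e j) = (if i = j then 1 else 0)) \<and>
     (\<forall>\<mu>. \<mu> \<noteq> 0 \<longrightarrow> finite {j \<in> J. lam j = \<mu>} \<and>
        (\<forall>f. eigenfunction \<Theta> k h \<mu> f \<longrightarrow>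
           (\<exists>c. AE y in lebesgue_on \<Theta>. f y = (\<Sum>j | j \<in> J \<and> lam j = \<mu>. c j * e j y))))"


section \<open>The cone property\<close>

definition is_finite_cone :: "'a::real_normed_vector \<Rightarrow> 'a set \<Rightarrow> bool" where
  "is_finite_cone x C \<longleftrightarrow> (\<exists>z \<epsilon> \<tau>. \<epsilon> > 0 \<and> \<tau> > 0 \<and> x \<notin> ball z \<tau> \<and>
     C = ball x \<epsilon> \<inter> {x + l *\<^sub>R (y - x) | y l. y \<in> ball z \<tau> \<and> l > 0})"

definition congruent_sets :: "'a::real_inner set \<Rightarrow> 'a set \<Rightarrow> bool" where
  "congruent_sets A B \<longleftrightarrow> (\<exists>a T. orthogonal_transformation T \<and> B = (\<lambda>v. a + T v) ` A)"

definition cone_property :: "'a::real_inner set \<Rightarrow> bool" where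
  "cone_property \<Theta> \<longleftrightarrow> (\<exists>x0 C0. is_finite_cone x0 C0 \<and>
     (\<forall>x\<in>\<Theta>. \<exists>C. is_finite_cone x C \<and> C \<subseteq> \<Theta> \<and> congruent_sets C0 C))"


section \<open>Multi-indices\<close>

lemma finite_mi_order_le: "finite {\<alpha> :: nat ^ 'd. mi_order \<alpha> \<le> k}"
proof -
  have "\<alpha> $ i \<le> k" if "mi_order \<alpha> \<le> k" for \<alpha> :: "nat ^ 'd" and i
    using that member_le_sum[of i UNIV "\<lambda>i. \<alpha> $ i"] by (simp add: mi_order_def)
  then have "{\<alpha> :: nat ^ 'd. mi_order \<alpha> \<le> k} \<subseteq> vec_lambda ` (PiE UNIV (\<lambda>_. {..k}))"
    by (auto intro!: image_eqI[of _ _ "vec_nth _"])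
  moreover have "finite (PiE (UNIV :: 'd set) (\<lambda>_. {..k}))"
    by (intro finite_PiE) auto
  ultimately show ?thesis by (meson finite_imageI finite_subset)
qed

lemma count_list_mi_dirs:
  fixes \<alpha> :: "nat ^ 'd"
  shows "count_list (mi_dirs \<alpha>) i = \<alpha> $ i"
proof -
  obtain M :: "'d multiset" where "\<forall>i. count M i = \<alpha> $ i"
    using count_Abs_multiset[of "vec_nth \<alpha>"] finite[of "{i. 0 < \<alpha> $ i}"] by metis
  moreover obtain ds where "mset ds = M" using ex_mset by blast
  ultimately have "\<exists>ds. \<forall>i. count_list ds i = \<alpha> $ i"
    by (metis count_mset)
  then show ?thesis unfolding mi_dirs_def by (rule someI2_ex) simp
qed

lemma length_mi_dirs: "length (mi_dirs \<alpha>) = mi_order \<alpha>"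
  using sum_count_set[of "mi_dirs \<alpha>" UNIV] by (simp add: mi_order_def count_list_mi_dirs)

end

theory Submission
  imports Defs "HOL-Library.Multiset"
begin

text \<open>Identify \<open>f\<close> with its jet, the family of its derivatives of order at most \<open>k\<close>, regarded as a
  function on multi-indices times \<open>\<Theta>\<close>. The Sobolev inner product becomes the inner product of \<open>L\<^sup>2\<close>, and the
  kernel operator becomes the integral operator of the matrix of mixed derivatives of \<open>h\<close>, which is a
  bounded positive definite kernel because it is a limit of difference quotients of \<open>h\<close>. The
  expansion is therefore a form of Mercer's theorem. Bessel's inequality for the quadratic
  form bounds the diagonal of the partial sums, hence the sum of the eigenvalues; the remainder kernel
  is again positive, and unless it vanishes it has an eigenfunction, which would be an eigenfunction
  of the original operator missing from the eigensystem. The uniform bound on the eigenfunctions is the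
  Sobolev embedding: Taylor's formula along the rays of a cone is averaged over the cone, and
  dilations replace polar coordinates.\<close>

text \<open>The data of an eigensystem are statements almost everywhere about chosen weak
  derivatives, whereas Mercer's argument works with continuous functions. Uniqueness of weak
  derivatives, proved with bump functions, bridges the two. An eigenfunction found only as a bounded
  measurable family on multi-indices times \<Theta> is recognised as a jet because the operator maps
  every such family to a jet. Completeness is part of the notion of eigensystem, so a single
  eigenfunction of a non-zero remainder is already contradictory. For orders up to \<open>k\<close>
  the diagonal bound gives convergence of the series but not continuity of the remainder kernel. The
  uniform bound on derivatives of order up to \<open>s\<close> supplies a summable majorant, hence
  continuity, and this turns vanishing almost everywhere into vanishing at each point. The embedding
  costs \<open>CARD('d) div 2 + 1\<close> derivatives; its constant depends on \<Theta> and this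
  order alone, since it is applied to derivatives of the normalised eigenfunctions.\<close>

lemma iter_partial_append: "iter_partial (bs @ cs) f = iter_partial bs (iter_partial cs f)"
  by (induction bs) auto

lemma iter_partial_exists_append:
  "iter_partial_exists S (bs @ cs) f \<longleftrightarrow>
     iter_partial_exists S cs f \<and> iter_partial_exists S bs (iter_partial cs f)"
  by (induction bs) (auto simp: iter_partial_append)

section \<open>Locality of partial derivatives and mean values along lines\<close>

lemma eventually_line:
  fixes x b :: "'a::real_normed_vector"
  assumes "open S" "x \<in> S"
  shows "\<forall>\<^sub>F t in nhds 0. x + t *\<^sub>R b \<in> S"
proof -
  have "((\<lambda>t. x + t *\<^sub>R b) \<longlongrightarrow> x + 0 *\<^sub>R b) (nhds 0)"
    by (intro tendsto_intros) (simp add: filterlim_ident)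
  then show ?thesis using topological_tendstoD[OF _ assms(1)] assms(2) by fastforce
qed

lemma partial_deriv_cong:
  assumes "open S" "x \<in> S" "\<And>y. y \<in> S \<Longrightarrow> f y = g y"
  shows "partial_deriv b f x = partial_deriv b g x"
  unfolding partial_deriv_def
  by (rule deriv_cong_ev[OF eventually_mono[OF eventually_line[OF assms(1,2)]]]) (auto intro: assms(3))

lemma iter_partial_cong:
  assumes "open S" "\<And>y. y \<in> S \<Longrightarrow> f y = g y" "x \<in> S"
  shows "iter_partial bs f x = iter_partial bs g x"
  using assms(3)
  by (induction bs arbitrary: x) (auto intro!: partial_deriv_cong[OF assms(1)] assms(2))

lemma iter_partial_exists_subset:
  "iter_partial_exists S bs f \<Longrightarrow> T \<subseteq> S \<Longrightarrow> iter_partial_exists T bs f"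
  by (induction bs) auto

lemma iter_partial_has_derivative:
  assumes "iter_partial_exists S (b # bs) f" "x \<in> S"
  shows "((\<lambda>t. iter_partial bs f (x + t *\<^sub>R b)) has_real_derivative iter_partial (b # bs) f x) (at 0)"
  using assms by (auto simp: partial_deriv_def field_differentiable_derivI)

lemma partial_deriv_eqI:
  "((\<lambda>t. f (x + t *\<^sub>R b)) has_real_derivative D) (at 0) \<Longrightarrow> partial_deriv b f x = D"
  by (simp add: partial_deriv_def DERIV_imp_deriv)

lemma has_derivative_along_line:
  fixes x b :: "'a::real_vector"
  assumes "((\<lambda>t. f ((x + s *\<^sub>R b) + t *\<^sub>R b)) has_real_derivative D) (at 0)"
  shows "((\<lambda>t. f (x + t *\<^sub>R b)) has_real_derivative D) (at s)"
proof -
  have "((\<lambda>t. f (x + (t + s) *\<^sub>R b)) has_real_derivative D) (at 0)"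
    using assms by (simp add: scaleR_add_left add_ac)
  then show ?thesis using DERIV_shift[of "\<lambda>t. f (x + t *\<^sub>R b)" D 0 s] by simp
qed

text \<open>The mean value theorem on a segment in direction \<open>b\<close>, for both signs of
  \<open>t\<close>; allowing equality in the bound on \<open>s\<close> covers \<open>t = 0\<close>.
  Differentiability is assumed at parameter 0 of the line through each point, the form in which
  \<open>partial_deriv\<close> delivers it.\<close>

lemma line_mvt:
  fixes x b :: "'a::real_normed_vector"
  assumes "\<And>z. z \<in> S \<Longrightarrow> ((\<lambda>s. f (z + s *\<^sub>R b)) has_real_derivative f' z) (at 0)"
    and "\<And>s. \<bar>s\<bar> \<le> \<bar>t\<bar> \<Longrightarrow> x + s *\<^sub>R b \<in> S"
  shows "\<exists>s. \<bar>s\<bar> \<le> \<bar>t\<bar> \<and> f (x + t *\<^sub>R b) - f x = t * f' (x + s *\<^sub>R b)"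
proof -
  define g where "g t = f (x + t *\<^sub>R b)" for t
  have der: "(g has_real_derivative f' (x + s *\<^sub>R b)) (at s)" if "\<bar>s\<bar> \<le> \<bar>t\<bar>" for s
    unfolding g_def by (rule has_derivative_along_line) (use assms that in auto)
  consider "t = 0" | "t > 0" | "t < 0" by linarith
  then show ?thesis
  proof cases
    case 2
    from MVT2[OF this, of g "\<lambda>s. f' (x + s *\<^sub>R b)"] der
    show ?thesis using 2 by (force simp: g_def)
  next
    case 3
    from MVT2[OF this, of g "\<lambda>s. f' (x + s *\<^sub>R b)"] der
    obtain z where "t < z" "z < 0" "g 0 - g t = (0 - t) * f' (x + z *\<^sub>R b)" using 3 by force
    then show ?thesis by (intro exI[of _ z]) (auto simp: g_def algebra_simps)
  qed auto
qed

section \<open>Iterated difference quotients\<close>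

definition diff_quot :: "real \<Rightarrow> 'a::real_normed_vector \<Rightarrow> ('a \<Rightarrow> real) \<Rightarrow> 'a \<Rightarrow> real" where
  "diff_quot t b f x = (f (x + t *\<^sub>R b) - f x) / t"

text \<open>All steps use the same \<open>t\<close>, so the quotient is a linear combination of
  values of \<open>f\<close> at finitely many translates. It stands in for a mixed derivative both
  in the proof that derivatives commute and in the proof that the derivative kernel is
  positive.\<close>

definition fdiff :: "real \<Rightarrow> 'a::real_normed_vector list \<Rightarrow> ('a \<Rightarrow> real) \<Rightarrow> 'a \<Rightarrow> real" where
  "fdiff t bs f = foldr (diff_quot t) bs f"

lemma fdiff_simps [simp]:
  "fdiff t [] f = f" "fdiff t (b # bs) f = diff_quot t b (fdiff t bs f)"
  by (simp_all add: fdiff_def)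

lemma fdiff_append: "fdiff t (bs @ cs) f = fdiff t bs (fdiff t cs f)"
  by (simp add: fdiff_def)

text \<open>Difference operators are combinations of translations, which commute, so their order is
  immaterial even for functions without any regularity.\<close>

lemma fdiff_perm:
  assumes "mset bs = mset cs"
  shows "fdiff t bs f = fdiff t cs f"
proof -
  have "diff_quot t b \<circ> diff_quot t c = diff_quot t c \<circ> diff_quot t b" for b c :: 'a
    by (auto simp: fun_eq_iff diff_quot_def field_simps)
  then have "fold (diff_quot t) (rev bs) = fold (diff_quot t) (rev cs)"
    by (intro fold_multiset_equiv) (auto simp: assms)
  then show ?thesis by (simp add: fdiff_def foldr_conv_fold)
qed

text \<open>A difference quotient combines translates linearly and hence commutes with
  differentiation; the size condition keeps every translate inside the ball where \<open>f\<close>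
  is differentiable.\<close>

lemma fdiff_has_derivative:
  assumes "\<And>z. z \<in> ball x0 r \<Longrightarrow> ((\<lambda>s. f (z + s *\<^sub>R b)) has_real_derivative f' z) (at 0)"
    and "norm (x - x0) + \<bar>t\<bar> * sum_list (map norm bs) < r"
  shows "((\<lambda>s. fdiff t bs f (x + s *\<^sub>R b)) has_real_derivative fdiff t bs f' x) (at 0)"
  using assms(2)
proof (induction bs arbitrary: x)
  case Nil
  then show ?case using assms(1)[of x] by (simp add: dist_norm norm_minus_commute)
next
  case (Cons c bs)
  have "norm (x + t *\<^sub>R c - x0) \<le> norm (x - x0) + \<bar>t\<bar> * norm c"
    using norm_triangle_ineq[of "x - x0" "t *\<^sub>R c"] by (simp add: algebra_simps)
  then have "norm (x + t *\<^sub>R c - x0) + \<bar>t\<bar> * sum_list (map norm bs) < r"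
    using Cons.prems by (simp add: algebra_simps)
  note * = Cons.IH[OF this]
  have "0 \<le> \<bar>t\<bar> * norm c" by simp
  then have "norm (x - x0) + \<bar>t\<bar> * sum_list (map norm bs) < r"
    using Cons.prems by (simp only: list.map sum_list.Cons distrib_left)
  note ** = Cons.IH[OF this]
  have "((\<lambda>s. (fdiff t bs f ((x + t *\<^sub>R c) + s *\<^sub>R b) - fdiff t bs f (x + s *\<^sub>R b)) / t)
      has_real_derivative (fdiff t bs f' (x + t *\<^sub>R c) - fdiff t bs f' x) / t) (at 0)"
    by (rule DERIV_cdivide[OF DERIV_diff[OF * **]])
  then show ?case by (simp add: diff_quot_def add_ac)
qed

text \<open>The outermost quotient is turned into a derivative first, and that derivative then acts
  on \<open>f\<close> directly, inside the remaining quotients. The derivatives therefore accumulate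
  in the opposite order, whence \<open>rev bs\<close>.\<close>

lemma fdiff_mvt:
  fixes x0 :: "'a::real_normed_vector"
  assumes "iter_partial_exists (ball x0 r) (rev bs) f" "t \<noteq> 0"
    and "norm (x - x0) + \<bar>t\<bar> * sum_list (map norm bs) < r"
  shows "\<exists>\<xi>. norm (\<xi> - x0) \<le> norm (x - x0) + \<bar>t\<bar> * sum_list (map norm bs) \<and>
    fdiff t bs f x = iter_partial (rev bs) f \<xi>"
  using assms(1,3)
proof (induction bs arbitrary: f x)
  case (Cons b bs)
  let ?f' = "partial_deriv b f"
  let ?S = "{z. norm (z - x0) + \<bar>t\<bar> * sum_list (map norm bs) < r}"
  have ex: "iter_partial_exists (ball x0 r) (rev bs) ?f'"
    and d: "\<And>z. z \<in> ball x0 r \<Longrightarrow> ((\<lambda>s. f (z + s *\<^sub>R b)) has_real_derivative ?f' z) (at 0)"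
    using Cons.prems(1) by (auto simp: iter_partial_exists_append partial_deriv_def field_differentiable_derivI)
  have le: "norm (x + s *\<^sub>R b - x0) \<le> norm (x - x0) + \<bar>t\<bar> * norm b" if "\<bar>s\<bar> \<le> \<bar>t\<bar>" for s
    using norm_triangle_ineq[of "x - x0" "s *\<^sub>R b"] mult_right_mono[OF that, of "norm b"]
    by (simp add: algebra_simps)
  have "\<exists>s. \<bar>s\<bar> \<le> \<bar>t\<bar> \<and> fdiff t bs f (x + t *\<^sub>R b) - fdiff t bs f x = t * fdiff t bs ?f' (x + s *\<^sub>R b)"
  proof (rule line_mvt)
    show "((\<lambda>s. fdiff t bs f (z + s *\<^sub>R b)) has_real_derivative fdiff t bs ?f' z) (at 0)"
      if "z \<in> ?S" for z
      using fdiff_has_derivative[OF d, of x0 r z t bs] that by auto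
    show "x + s *\<^sub>R b \<in> ?S" if "\<bar>s\<bar> \<le> \<bar>t\<bar>" for s
      using le[OF that] Cons.prems(2) by (simp add: algebra_simps)
  qed
  then obtain s where s: "\<bar>s\<bar> \<le> \<bar>t\<bar>"
    "fdiff t bs f (x + t *\<^sub>R b) - fdiff t bs f x = t * fdiff t bs ?f' (x + s *\<^sub>R b)" by blast
  have "norm (x + s *\<^sub>R b - x0) + \<bar>t\<bar> * sum_list (map norm bs) < r"
    using le[OF s(1)] Cons.prems(2) by (simp add: algebra_simps)
  from Cons.IH[OF ex this] obtain \<xi> where
    "norm (\<xi> - x0) \<le> norm (x + s *\<^sub>R b - x0) + \<bar>t\<bar> * sum_list (map norm bs)"
    "fdiff t bs ?f' (x + s *\<^sub>R b) = iter_partial (rev bs) ?f' \<xi>" by blast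
  then show ?case using le[OF s(1)] s(2) assms(2)
    by (intro exI[of _ \<xi>]) (auto simp: diff_quot_def iter_partial_append algebra_simps)
qed auto

text \<open>The intermediate points of the mean value form shrink to \<open>x\<close>, so continuity
  of this one derivative gives the limit.\<close>

lemma fdiff_tendsto:
  fixes x :: "'a::real_normed_vector"
  assumes "open S" "x \<in> S" "iter_partial_exists S (rev bs) f"
    and "continuous_on S (iter_partial (rev bs) f)"
  shows "((\<lambda>t. fdiff t bs f x) \<longlongrightarrow> iter_partial (rev bs) f x) (at 0)"
proof (rule tendstoI)
  fix e :: real assume "e > 0"
  let ?D = "iter_partial (rev bs) f" and ?L = "sum_list (map norm bs)"
  have L: "?L \<ge> 0" by (rule sum_list_nonneg) auto
  have "isCont ?D x" using assms continuous_on_eq_continuous_at by blast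
  then obtain d where d: "d > 0" "\<And>y. dist y x < d \<Longrightarrow> dist (?D y) (?D x) < e"
    using \<open>e > 0\<close> unfolding continuous_at_eps_delta by blast
  obtain r where r: "r > 0" "ball x r \<subseteq> S" using assms openE by blast
  define m where "m = min d r"
  have m: "m > 0" using d r by (simp add: m_def)
  show "\<forall>\<^sub>F t in at 0. dist (fdiff t bs f x) (?D x) < e"
    unfolding eventually_at
  \<comment> \<open>The summand 1 keeps the radius meaningful when \<open>?L\<close> is 0, for
    instance for the empty list.\<close>
  proof (intro exI[of _ "m / (?L + 1)"] conjI ballI impI)
    show "m / (?L + 1) > 0" using m L by auto
    fix t :: real assume t: "t \<noteq> 0 \<and> dist t 0 < m / (?L + 1)"
    then have "\<bar>t\<bar> * (?L + 1) < m" using L by (simp add: field_simps)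
    then have lt: "\<bar>t\<bar> * ?L < m" using t L by (smt (verit) mult_left_mono abs_ge_zero)
    have "norm (x - x) + \<bar>t\<bar> * ?L < r" using lt by (simp add: m_def)
    from fdiff_mvt[OF iter_partial_exists_subset[OF assms(3) r(2)] _ this] t obtain \<xi> where
      "norm (\<xi> - x) \<le> norm (x - x) + \<bar>t\<bar> * ?L" "fdiff t bs f x = ?D \<xi>" by blast
    then show "dist (fdiff t bs f x) (?D x) < e" using d(2)[of \<xi>] lt by (auto simp: dist_norm m_def)
  qed
qed

text \<open>Schwarz's theorem: both derivatives are limits of one and the same difference quotient.
  The lists are reversed to undo the reversal in \<open>fdiff_tendsto\<close>.\<close>

lemma iter_partial_perm:
  fixes x :: "'a::real_normed_vector"
  assumes "open S" "x \<in> S" "mset bs = mset cs"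
    and "iter_partial_exists S bs f" "continuous_on S (iter_partial bs f)"
    and "iter_partial_exists S cs f" "continuous_on S (iter_partial cs f)"
  shows "iter_partial bs f x = iter_partial cs f x"
proof -
  have "fdiff t (rev bs) f = fdiff t (rev cs) f" for t by (rule fdiff_perm) (simp add: assms)
  then show ?thesis
    using fdiff_tendsto[OF assms(1,2), of "rev bs" f] fdiff_tendsto[OF assms(1,2), of "rev cs" f] assms
    by (auto intro: tendsto_unique[of "at (0::real)"])
qed

section \<open>Directional derivatives and differentiation under the integral sign\<close>

text \<open>The coordinates of \<open>v\<close> are switched on one after another. The newest one is
  handled by the mean value theorem, where continuity of \<open>G j\<close> tolerates a moving base
  point; the induction hypothesis treats the others.\<close>

lemma directional_derivative:
  fixes g :: "real ^ 'd \<Rightarrow> real"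
  assumes "open S"
    and der: "\<And>i z. z \<in> S \<Longrightarrow> ((\<lambda>s. g (z + s *\<^sub>R axis i 1)) has_real_derivative G i z) (at 0)"
    and cont: "\<And>i. continuous_on S (G i)"
    and "x \<in> S"
  shows "((\<lambda>s. g (x + s *\<^sub>R v)) has_real_derivative (\<Sum>i\<in>UNIV. v $ i * G i x)) (at 0)"
proof -
  have "((\<lambda>s. g (x + s *\<^sub>R (\<Sum>i\<in>I. v $ i *\<^sub>R axis i 1))) has_real_derivative (\<Sum>i\<in>I. v $ i * G i x)) (at 0)"
    if "finite I" for I
    using that
  proof (induction I)
    case (insert j I)
    define w where "w = (\<Sum>i\<in>I. v $ i *\<^sub>R (axis i 1 :: real ^ 'd))"
    obtain r where r: "r > 0" "ball x r \<subseteq> S" using assms(1,4) openE by blast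
    \<comment> \<open>\<open>c\<close> bounds the displacement per unit of the parameter; the
      summand 1 makes it positive.\<close>
    define c where "c = norm w + \<bar>v $ j\<bar> + 1"
    have c: "c > 0" by (simp add: c_def add_nonneg_pos)
    have "\<exists>\<xi>. \<bar>\<xi>\<bar> \<le> \<bar>s * v $ j\<bar> \<and> g (x + s *\<^sub>R w + (s * v $ j) *\<^sub>R axis j 1) - g (x + s *\<^sub>R w) =
        (s * v $ j) * G j (x + s *\<^sub>R w + \<xi> *\<^sub>R axis j 1)" if "\<bar>s\<bar> < r / c" for s
    proof (rule line_mvt[of S, OF der])
      fix u assume u: "\<bar>u\<bar> \<le> \<bar>s * v $ j\<bar>"
      have "norm (s *\<^sub>R w + u *\<^sub>R axis j 1) \<le> \<bar>s\<bar> * norm w + \<bar>u\<bar>"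
        using norm_triangle_ineq[of "s *\<^sub>R w" "u *\<^sub>R axis j 1"] by (simp add: norm_axis_1)
      also have "\<dots> \<le> \<bar>s\<bar> * c" using u by (simp add: c_def abs_mult algebra_simps)
      also have "\<dots> < r" using that c by (simp add: field_simps)
      finally show "x + s *\<^sub>R w + u *\<^sub>R axis j 1 \<in> S"
        using r(2) by (auto simp: subset_iff dist_norm add.assoc norm_minus_commute)
    qed
    then obtain \<xi> where \<xi>: "\<And>s. \<bar>s\<bar> < r / c \<Longrightarrow> \<bar>\<xi> s\<bar> \<le> \<bar>s * v $ j\<bar>"
      "\<And>s. \<bar>s\<bar> < r / c \<Longrightarrow> g (x + s *\<^sub>R w + (s * v $ j) *\<^sub>R axis j 1) - g (x + s *\<^sub>R w) =
        (s * v $ j) * G j (x + s *\<^sub>R w + \<xi> s *\<^sub>R axis j 1)" by metis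
    have ev: "\<forall>\<^sub>F s in at 0. \<bar>s\<bar> < r / c"
      unfolding eventually_at using r c by (intro exI[of _ "r / c"]) auto
    have "(\<xi> \<longlongrightarrow> 0) (at 0)"
    proof (rule Lim_null_comparison)
      show "\<forall>\<^sub>F s in at 0. norm (\<xi> s) \<le> \<bar>s * v $ j\<bar>" using ev by eventually_elim (use \<xi>(1) in auto)
      show "((\<lambda>s. \<bar>s * v $ j\<bar>) \<longlongrightarrow> 0) (at 0)" by (rule tendsto_eq_intros refl | simp)+
    qed
    then have "((\<lambda>s. x + s *\<^sub>R w + \<xi> s *\<^sub>R axis j 1) \<longlongrightarrow> x) (at 0)"
      by (auto intro!: tendsto_eq_intros)
    moreover have "isCont (G j) x" using cont assms(1,4) continuous_on_eq_continuous_at by blast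
    ultimately have "((\<lambda>s. G j (x + s *\<^sub>R w + \<xi> s *\<^sub>R axis j 1)) \<longlongrightarrow> G j x) (at 0)"
      using isCont_tendsto_compose by blast
    moreover have "((\<lambda>s. (g (x + s *\<^sub>R w) - g x) / s) \<longlongrightarrow> (\<Sum>i\<in>I. v $ i * G i x)) (at 0)"
      using insert.IH by (simp add: DERIV_def w_def)
    ultimately have "((\<lambda>s. v $ j * G j (x + s *\<^sub>R w + \<xi> s *\<^sub>R axis j 1) + (g (x + s *\<^sub>R w) - g x) / s)
        \<longlongrightarrow> v $ j * G j x + (\<Sum>i\<in>I. v $ i * G i x)) (at 0)" by (intro tendsto_intros)
    moreover have "\<forall>\<^sub>F s in at 0. v $ j * G j (x + s *\<^sub>R w + \<xi> s *\<^sub>R axis j 1) + (g (x + s *\<^sub>R w) - g x) / s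
        = (g (x + s *\<^sub>R (w + v $ j *\<^sub>R axis j 1)) - g x) / s"
      using ev eventually_neq_at_within[of 0 0 UNIV]
    proof eventually_elim
      case (elim s)
      then show ?case using \<xi>(2)[of s] by (simp add: field_simps scaleR_add_right)
    qed
    ultimately have "((\<lambda>s. (g (x + s *\<^sub>R (w + v $ j *\<^sub>R axis j 1)) - g x) / s)
        \<longlongrightarrow> v $ j * G j x + (\<Sum>i\<in>I. v $ i * G i x)) (at 0)"
      by (rule Lim_transform_eventually)
    then show ?case using insert.hyps by (simp add: DERIV_def w_def add.commute)
  qed simp
  from this[of UNIV] show ?thesis by (simp add: basis_expansion[of v] flip: scalar_mult_eq_scaleR)
qed

text \<open>By the mean value theorem each difference quotient of \<open>u\<close> is a value of
  \<open>u'\<close>, so \<open>B * \<bar>w p\<bar>\<close> dominates all integrands at once.\<close>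

lemma has_derivative_under_integral:
  fixes u u' :: "'p \<Rightarrow> 'a::real_normed_vector \<Rightarrow> real" and M :: "'p measure"
  assumes "open S" "x \<in> S"
    and w: "integrable M w"
    and meas: "\<And>z. z \<in> S \<Longrightarrow> (\<lambda>p. u p z) \<in> borel_measurable M"
    and bnd: "\<And>p z. p \<in> space M \<Longrightarrow> z \<in> S \<Longrightarrow> \<bar>u p z\<bar> \<le> B"
    and meas': "(\<lambda>p. u' p x) \<in> borel_measurable M"
    and bnd': "\<And>p z. p \<in> space M \<Longrightarrow> z \<in> S \<Longrightarrow> \<bar>u' p z\<bar> \<le> B"
    and der: "\<And>p z. p \<in> space M \<Longrightarrow> z \<in> S \<Longrightarrow> ((\<lambda>s. u p (z + s *\<^sub>R b)) has_real_derivative u' p z) (at 0)"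
  shows "((\<lambda>s. \<integral>p. u p (x + s *\<^sub>R b) * w p \<partial>M) has_real_derivative (\<integral>p. u' p x * w p \<partial>M)) (at 0)"
proof -
  let ?F = "\<lambda>s. \<integral>p. u p (x + s *\<^sub>R b) * w p \<partial>M"
  obtain r where r: "r > 0" "ball x r \<subseteq> S" using assms(1,2) openE by blast
  define \<delta> where "\<delta> = r / (norm b + 1)"
  have \<delta>: "\<delta> > 0" using r by (simp add: \<delta>_def add_nonneg_pos)
  have inS: "x + s *\<^sub>R b \<in> S" if "\<bar>s\<bar> < \<delta>" for s
  proof -
    have "\<bar>s\<bar> * norm b \<le> \<bar>s\<bar> * (norm b + 1)" by (simp add: algebra_simps)
    also have "\<dots> < r" using that pos_less_divide_eq[of "norm b + 1"]
      by (simp add: \<delta>_def add_nonneg_pos)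
    finally show ?thesis using r(2) by (auto simp: subset_iff dist_norm)
  qed
  have int: "integrable M (\<lambda>p. u p z * w p)" if "z \<in> S" for z
    using w
  proof (rule Bochner_Integration.integrable_bound[OF integrable_mult_right[of B]])
    show "(\<lambda>p. u p z * w p) \<in> borel_measurable M" using meas[OF that] w by measurable
    show "AE p in M. norm (u p z * w p) \<le> norm (B * w p)"
    proof (intro AE_I2)
      fix p assume "p \<in> space M"
      then have "\<bar>u p z\<bar> \<le> \<bar>B\<bar>" using bnd[OF _ that] by force
      then show "norm (u p z * w p) \<le> norm (B * w p)" by (simp add: abs_mult mult_right_mono)
    qed
  qed
  have "((\<lambda>s. (?F s - ?F 0) / s) \<longlongrightarrow> (\<integral>p. u' p x * w p \<partial>M)) (at 0)"
    unfolding tendsto_at_iff_sequentially comp_def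
  proof (intro allI impI)
    fix X :: "nat \<Rightarrow> real" assume X0: "\<forall>i. X i \<in> UNIV - {0}" and X: "X \<longlonglongrightarrow> 0"
    have "\<forall>\<^sub>F n in sequentially. \<bar>X n\<bar> < \<delta>"
      by (rule order_tendstoD(2)[OF tendsto_rabs[OF X]]) (simp add: \<delta>)
    then obtain N where N: "\<And>n. n \<ge> N \<Longrightarrow> \<bar>X n\<bar> < \<delta>"
      unfolding eventually_sequentially by blast
    \<comment> \<open>Dropping the first \<open>N\<close> terms puts the whole sequence within
      \<open>\<delta>\<close>, since the domination has to hold for every index.\<close>
    define Y where "Y n = X (n + N)" for n
    have Y: "Y n \<noteq> 0" "\<bar>Y n\<bar> < \<delta>" for n using X0 N by (auto simp: Y_def)
    have Ylim: "Y \<longlonglongrightarrow> 0" unfolding Y_def by (rule LIMSEQ_ignore_initial_segment[OF X])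
    have "(\<lambda>n. \<integral>p. (u p (x + Y n *\<^sub>R b) - u p x) / Y n * w p \<partial>M) \<longlonglongrightarrow> (\<integral>p. u' p x * w p \<partial>M)"
    proof (rule integral_dominated_convergence)
      show "(\<lambda>p. u' p x * w p) \<in> borel_measurable M" using meas' w by measurable
      show "(\<lambda>p. (u p (x + Y n *\<^sub>R b) - u p x) / Y n * w p) \<in> borel_measurable M" for n
        using meas[OF inS[OF Y(2)]] meas[OF assms(2)] w by measurable
      show "integrable M (\<lambda>p. B * \<bar>w p\<bar>)" using w by auto
      show "AE p in M. (\<lambda>n. (u p (x + Y n *\<^sub>R b) - u p x) / Y n * w p) \<longlonglongrightarrow> u' p x * w p"
      proof (intro AE_I2 tendsto_intros)
        fix p assume p: "p \<in> space M"
        have "((\<lambda>s. (u p (x + s *\<^sub>R b) - u p x) / s) \<longlongrightarrow> u' p x) (at 0)"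
          using der[OF p assms(2)] by (simp add: DERIV_def)
        then show "(\<lambda>n. (u p (x + Y n *\<^sub>R b) - u p x) / Y n) \<longlonglongrightarrow> u' p x"
          using Y Ylim unfolding tendsto_at_iff_sequentially comp_def by auto
      qed
      fix n
      show "AE p in M. norm ((u p (x + Y n *\<^sub>R b) - u p x) / Y n * w p) \<le> B * \<bar>w p\<bar>"
      proof (intro AE_I2)
        fix p assume p: "p \<in> space M"
        obtain s where s: "\<bar>s\<bar> \<le> \<bar>Y n\<bar>" "u p (x + Y n *\<^sub>R b) - u p x = Y n * u' p (x + s *\<^sub>R b)"
          using line_mvt[of S "u p" b "u' p" "Y n" x, OF der[OF p]] inS Y(2)[of n] by force
        have "\<bar>u' p (x + s *\<^sub>R b)\<bar> \<le> B" using bnd'[OF p inS] s(1) Y(2)[of n] by force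
        then show "norm ((u p (x + Y n *\<^sub>R b) - u p x) / Y n * w p) \<le> B * \<bar>w p\<bar>"
          using s(2) Y(1)[of n] by (simp add: abs_mult mult_right_mono)
      qed
    qed
    moreover have "(\<integral>p. (u p (x + Y n *\<^sub>R b) - u p x) / Y n * w p \<partial>M) = (?F (Y n) - ?F 0) / Y n" for n
    proof -
      have "(\<integral>p. (u p (x + Y n *\<^sub>R b) - u p x) / Y n * w p \<partial>M)
          = (\<integral>p. (u p (x + Y n *\<^sub>R b) * w p - u p x * w p) / Y n \<partial>M)"
        by (intro Bochner_Integration.integral_cong) (auto simp: algebra_simps diff_divide_distrib)
      also have "\<dots> = (?F (Y n) - ?F 0) / Y n"
        using int[OF inS[OF Y(2)]] int[OF assms(2)] by simp
      finally show ?thesis .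
    qed
    ultimately have "(\<lambda>n. (?F (X (n + N)) - ?F 0) / X (n + N)) \<longlonglongrightarrow> (\<integral>p. u' p x * w p \<partial>M)"
      by (simp only: Y_def)
    then show "(\<lambda>n. (?F (X n) - ?F 0) / X n) \<longlonglongrightarrow> (\<integral>p. u' p x * w p \<partial>M)"
      by (rule LIMSEQ_offset)
  qed
  then show ?thesis by (simp add: DERIV_def)
qed

section \<open>Bounded kernels on finite measure spaces\<close>

text \<open>On a finite measure space these functions are integrable, and the class is stable under
  products, measurable substitutions and integration over one variable, so that Fubini and linearity
  apply freely.\<close>

definition bdd_measurable :: "'p measure \<Rightarrow> ('p \<Rightarrow> real) \<Rightarrow> bool" where
  "bdd_measurable M f \<longleftrightarrow> f \<in> borel_measurable M \<and> (\<exists>c. \<forall>x\<in>space M. \<bar>f x\<bar> \<le> c)"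

lemma bdd_measurableI:
  "f \<in> borel_measurable M \<Longrightarrow> (\<And>x. x \<in> space M \<Longrightarrow> \<bar>f x\<bar> \<le> c) \<Longrightarrow> bdd_measurable M f"
  by (auto simp: bdd_measurable_def)

lemma bdd_measurableD: "bdd_measurable M f \<Longrightarrow> f \<in> borel_measurable M"
  by (simp add: bdd_measurable_def)

lemma bdd_measurable_bound:
  assumes "bdd_measurable M f"
  obtains c where "c \<ge> 0" "\<And>x. x \<in> space M \<Longrightarrow> \<bar>f x\<bar> \<le> c"
proof -
  from assms obtain c where "\<forall>x\<in>space M. \<bar>f x\<bar> \<le> c" by (auto simp: bdd_measurable_def)
  then have "\<And>x. x \<in> space M \<Longrightarrow> \<bar>f x\<bar> \<le> max c 0" by force
  then show ?thesis using that[of "max c 0"] by simp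
qed

lemma bdd_measurable_mult:
  assumes "bdd_measurable M f" "bdd_measurable M g"
  shows "bdd_measurable M (\<lambda>x. f x * g x)"
proof -
  obtain c where c: "c \<ge> 0" "\<And>x. x \<in> space M \<Longrightarrow> \<bar>f x\<bar> \<le> c"
    using bdd_measurable_bound[OF assms(1)] by blast
  obtain d where d: "d \<ge> 0" "\<And>x. x \<in> space M \<Longrightarrow> \<bar>g x\<bar> \<le> d"
    using bdd_measurable_bound[OF assms(2)] by blast
  show ?thesis
    by (rule bdd_measurableI[where c = "c * d"])
      (use assms c d in \<open>auto simp: abs_mult intro!: mult_mono borel_measurable_times dest: bdd_measurableD\<close>)
qed

lemma bdd_measurable_add:
  assumes "bdd_measurable M f" "bdd_measurable M g"
  shows "bdd_measurable M (\<lambda>x. f x + g x)"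
proof -
  obtain c where c: "c \<ge> 0" "\<And>x. x \<in> space M \<Longrightarrow> \<bar>f x\<bar> \<le> c"
    using bdd_measurable_bound[OF assms(1)] by blast
  obtain d where d: "d \<ge> 0" "\<And>x. x \<in> space M \<Longrightarrow> \<bar>g x\<bar> \<le> d"
    using bdd_measurable_bound[OF assms(2)] by blast
  show ?thesis
    by (rule bdd_measurableI[where c = "c + d"])
      (use assms c d in \<open>auto intro!: abs_triangle_ineq[THEN order_trans] add_mono
          borel_measurable_add dest: bdd_measurableD\<close>)
qed

lemma bdd_measurable_const: "bdd_measurable M (\<lambda>_. c)"
  by (rule bdd_measurableI[where c = "\<bar>c\<bar>"]) auto

lemma bdd_measurable_cmult: "bdd_measurable M f \<Longrightarrow> bdd_measurable M (\<lambda>x. c * f x)"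
  by (rule bdd_measurable_mult[OF bdd_measurable_const])

lemma bdd_measurable_diff:
  "bdd_measurable M f \<Longrightarrow> bdd_measurable M g \<Longrightarrow> bdd_measurable M (\<lambda>x. f x - g x)"
  using bdd_measurable_add[of M f "\<lambda>x. -1 * g x"] bdd_measurable_cmult[of M g "-1"] by simp

lemma bdd_measurable_sum:
  "(\<And>i. i \<in> I \<Longrightarrow> bdd_measurable M (f i)) \<Longrightarrow> bdd_measurable M (\<lambda>x. \<Sum>i\<in>I. f i x)"
  by (induction I rule: infinite_finite_induct)
     (auto intro!: bdd_measurable_add bdd_measurable_const)

lemma bdd_measurable_compose:
  assumes "bdd_measurable N f" "g \<in> measurable M N"
  shows "bdd_measurable M (\<lambda>x. f (g x))"
proof -
  obtain c where c: "c \<ge> 0" "\<And>x. x \<in> space N \<Longrightarrow> \<bar>f x\<bar> \<le> c"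
    using bdd_measurable_bound[OF assms(1)] by blast
  show ?thesis
    by (rule bdd_measurableI[where c = c])
      (use assms c in \<open>auto intro!: measurable_compose[OF assms(2)] dest: bdd_measurableD measurable_space\<close>)
qed

lemma (in finite_measure) bdd_measurable_integrable:
  assumes "bdd_measurable M f"
  shows "integrable M f"
proof -
  obtain c where "c \<ge> 0" "\<And>x. x \<in> space M \<Longrightarrow> \<bar>f x\<bar> \<le> c"
    using bdd_measurable_bound[OF assms] by blast
  then show ?thesis
    by (intro integrable_const_bound[where B = c]) (use assms in \<open>auto dest: bdd_measurableD\<close>)
qed

lemma (in finite_measure) bdd_measurable_integral:
  assumes "bdd_measurable (N \<Otimes>\<^sub>M M) f"
  shows "bdd_measurable N (\<lambda>x. \<integral>y. f (x, y) \<partial>M)"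
proof -
  obtain c where c: "c \<ge> 0" "\<And>p. p \<in> space (N \<Otimes>\<^sub>M M) \<Longrightarrow> \<bar>f p\<bar> \<le> c"
    using bdd_measurable_bound[OF assms] by blast
  have f [measurable]: "f \<in> borel_measurable (N \<Otimes>\<^sub>M M)" using assms by (rule bdd_measurableD)
  show ?thesis
  proof (rule bdd_measurableI[where c = "c * measure M (space M)"])
    show "(\<lambda>x. \<integral>y. f (x, y) \<partial>M) \<in> borel_measurable N" by measurable
    fix x assume x: "x \<in> space N"
    have "bdd_measurable M (\<lambda>y. f (x, y))"
      by (rule bdd_measurable_compose[OF assms]) (use x in measurable)
    then have i: "integrable M (\<lambda>y. f (x, y))" by (rule bdd_measurable_integrable)
    have "\<bar>\<integral>y. f (x, y) \<partial>M\<bar> \<le> (\<integral>y. \<bar>f (x, y)\<bar> \<partial>M)" by (rule integral_abs_bound)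
    also have "\<dots> \<le> (\<integral>y. c \<partial>M)"
      using i c(2) x by (intro integral_mono) (auto simp: space_pair_measure)
    finally show "\<bar>\<integral>y. f (x, y) \<partial>M\<bar> \<le> c * measure M (space M)" by (simp add: mult.commute)
  qed
qed

lemma (in finite_measure) Cauchy_Schwarz_bdd:
  assumes "bdd_measurable M f" "bdd_measurable M g"
  shows "(\<integral>x. f x * g x \<partial>M)\<^sup>2 \<le> (\<integral>x. f x * f x \<partial>M) * (\<integral>x. g x * g x \<partial>M)"
proof -
  let ?a = "\<integral>x. f x * f x \<partial>M" and ?b = "\<integral>x. f x * g x \<partial>M" and ?c = "\<integral>x. g x * g x \<partial>M"
  have int: "integrable M (\<lambda>x. f x * f x)" "integrable M (\<lambda>x. f x * g x)" "integrable M (\<lambda>x. g x * g x)"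
    using assms by (auto intro: bdd_measurable_integrable bdd_measurable_mult)
  have nonneg: "0 \<le> ?a - 2 * t * ?b + t\<^sup>2 * ?c" for t
  proof -
    have "0 \<le> (\<integral>x. (f x - t * g x)\<^sup>2 \<partial>M)" by simp
    also have "(\<lambda>x. (f x - t * g x)\<^sup>2) = (\<lambda>x. f x * f x - 2 * t * (f x * g x) + t\<^sup>2 * (g x * g x))"
      by (auto simp: power2_eq_square algebra_simps)
    also have "(\<integral>x. f x * f x - 2 * t * (f x * g x) + t\<^sup>2 * (g x * g x) \<partial>M) = ?a - 2 * t * ?b + t\<^sup>2 * ?c"
      using int by simp
    finally show ?thesis .
  qed
  show ?thesis
  proof (cases "?c = 0")
    case True
    have "?b = 0"
    proof (rule ccontr)
      assume b: "?b \<noteq> 0"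
      \<comment> \<open>For \<open>?c = 0\<close> the quadratic polynomial is affine in
        \<open>t\<close>; this \<open>t\<close> gives it the value -1.\<close>
      have "0 \<le> ?a - 2 * ((?a + 1) / (2 * ?b)) * ?b" using nonneg[of "(?a + 1) / (2 * ?b)"] True by simp
      then show False using b by simp
    qed
    then show ?thesis using True by simp
  next
    case False
    have "?c > 0" using False by (simp add: less_le)
    have "?a - 2 * (?b / ?c) * ?b + (?b / ?c)\<^sup>2 * ?c = ?a - ?b\<^sup>2 / ?c"
      using False by (simp add: power2_eq_square)
    then have "?b\<^sup>2 / ?c \<le> ?a" using nonneg[of "?b / ?c"] by linarith
    then show ?thesis using \<open>?c > 0\<close> by (simp add: pos_divide_le_eq)
  qed
qed

section \<open>Composition and powers of kernels\<close>

definition kernel_comp :: "'p measure \<Rightarrow> ('p \<times> 'p \<Rightarrow> real) \<Rightarrow> ('p \<times> 'p \<Rightarrow> real) \<Rightarrow> 'p \<times> 'p \<Rightarrow> real" where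
  "kernel_comp M K L = (\<lambda>(x, y). \<integral>z. K (x, z) * L (z, y) \<partial>M)"

context finite_measure
begin

lemma Fubini_bdd:
  assumes "bdd_measurable (M \<Otimes>\<^sub>M M) f"
  shows "(\<integral>x. \<integral>y. f (x, y) \<partial>M \<partial>M) = integral\<^sup>L (M \<Otimes>\<^sub>M M) f"
    and "(\<integral>y. \<integral>x. f (x, y) \<partial>M \<partial>M) = integral\<^sup>L (M \<Otimes>\<^sub>M M) f"
proof -
  interpret P: pair_sigma_finite M M ..
  interpret Q: finite_measure "M \<Otimes>\<^sub>M M" by (rule finite_measure_pair_measure) unfold_locales
  have i: "integrable (M \<Otimes>\<^sub>M M) f" using assms by (rule Q.bdd_measurable_integrable)
  show "(\<integral>x. \<integral>y. f (x, y) \<partial>M \<partial>M) = integral\<^sup>L (M \<Otimes>\<^sub>M M) f" by (rule P.integral_fst'[OF i])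
  show "(\<integral>y. \<integral>x. f (x, y) \<partial>M \<partial>M) = integral\<^sup>L (M \<Otimes>\<^sub>M M) f" using P.integral_snd[of "curry f"] i by simp
qed

lemma bdd_measurable_sections:
  assumes "bdd_measurable (M \<Otimes>\<^sub>M M) f" "x \<in> space M"
  shows "bdd_measurable M (\<lambda>y. f (x, y))" "bdd_measurable M (\<lambda>y. f (y, x))"
  by (rule bdd_measurable_compose[OF assms(1)]; use assms(2) in measurable)+

lemma bdd_measurable_kernel_comp:
  assumes "bdd_measurable (M \<Otimes>\<^sub>M M) K" "bdd_measurable (M \<Otimes>\<^sub>M M) L"
  shows "bdd_measurable (M \<Otimes>\<^sub>M M) (kernel_comp M K L)"
proof -
  have "bdd_measurable ((M \<Otimes>\<^sub>M M) \<Otimes>\<^sub>M M)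
      (\<lambda>q. K (fst (fst q), snd q) * L (snd q, snd (fst q)))"
    by (intro bdd_measurable_mult bdd_measurable_compose[OF assms(1)] bdd_measurable_compose[OF
        assms(2)]) measurable
  from bdd_measurable_integral[OF this] show ?thesis
    by (simp add: kernel_comp_def case_prod_beta')
qed

lemma kernel_comp_assoc:
  assumes "bdd_measurable (M \<Otimes>\<^sub>M M) A" "bdd_measurable (M \<Otimes>\<^sub>M M) C" "bdd_measurable (M \<Otimes>\<^sub>M M) D"
    and "x \<in> space M" "y \<in> space M"
  shows "kernel_comp M (kernel_comp M A C) D (x, y) = kernel_comp M A (kernel_comp M C D) (x, y)"
proof -
  let ?f = "\<lambda>(z, w). A (x, w) * C (w, z) * D (z, y)"
  have "bdd_measurable (M \<Otimes>\<^sub>M M) (\<lambda>q. A (x, snd q) * C (snd q, fst q) * D (fst q, y))"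
    by (intro bdd_measurable_mult bdd_measurable_compose[OF assms(1)] bdd_measurable_compose[OF assms(2)]
          bdd_measurable_compose[OF assms(3)]) (use assms(4,5) in measurable)
  then have f: "bdd_measurable (M \<Otimes>\<^sub>M M) ?f" by (simp add: case_prod_beta')
  have "(\<integral>z. \<integral>w. ?f (z, w) \<partial>M \<partial>M) = (\<integral>w. \<integral>z. ?f (z, w) \<partial>M \<partial>M)"
    using Fubini_bdd[OF f] by simp
  moreover have "kernel_comp M (kernel_comp M A C) D (x, y) = (\<integral>z. \<integral>w. ?f (z, w) \<partial>M \<partial>M)"
    by (simp add: kernel_comp_def)
  moreover have "kernel_comp M A (kernel_comp M C D) (x, y) = (\<integral>w. \<integral>z. ?f (z, w) \<partial>M \<partial>M)"
    by (simp add: kernel_comp_def mult.assoc)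
  ultimately show ?thesis by simp
qed

end

text \<open>Used twice, for the derivative kernel and for the remainder of its expansion. Positivity
  is meant for the quadratic form on bounded measurable functions, a condition that survives
  pointwise limits of uniformly bounded kernels.\<close>

locale pos_kernel = finite_measure M for M :: "'p measure" +
  fixes K :: "'p \<times> 'p \<Rightarrow> real"
  assumes K: "bdd_measurable (M \<Otimes>\<^sub>M M) K"
    and K_sym: "\<And>x y. x \<in> space M \<Longrightarrow> y \<in> space M \<Longrightarrow> K (x, y) = K (y, x)"
    and K_pos: "\<And>f. bdd_measurable M f \<Longrightarrow> 0 \<le> (\<integral>x. (\<integral>y. K (x, y) * f y \<partial>M) * f x \<partial>M)"
begin

definition op :: "('p \<Rightarrow> real) \<Rightarrow> 'p \<Rightarrow> real" where
  "op f x = (\<integral>y. K (x, y) * f y \<partial>M)"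

text \<open>\<open>pw n\<close> is the kernel of the power n + 1 of the operator, hence the
  successor in \<open>pw_add\<close>.\<close>

primrec pw :: "nat \<Rightarrow> 'p \<times> 'p \<Rightarrow> real" where
  "pw 0 = K"
| "pw (Suc n) = kernel_comp M K (pw n)"

sublocale Q: finite_measure "M \<Otimes>\<^sub>M M"
  by (rule finite_measure_pair_measure) unfold_locales

definition ip :: "('p \<times> 'p \<Rightarrow> real) \<Rightarrow> ('p \<times> 'p \<Rightarrow> real) \<Rightarrow> real" where
  "ip A C = (\<integral>p. A p * C p \<partial>(M \<Otimes>\<^sub>M M))"

lemma pw_bdd: "bdd_measurable (M \<Otimes>\<^sub>M M) (pw n)"
  by (induction n) (auto intro: K bdd_measurable_kernel_comp)

lemma pw_add:
  "x \<in> space M \<Longrightarrow> y \<in> space M \<Longrightarrow> kernel_comp M (pw m) (pw n) (x, y) = pw (Suc (m + n)) (x, y)"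
proof (induction m arbitrary: x)
  case (Suc m)
  have "kernel_comp M (pw (Suc m)) (pw n) (x, y) = kernel_comp M K (kernel_comp M (pw m) (pw n)) (x, y)"
    using kernel_comp_assoc[OF K pw_bdd pw_bdd Suc.prems] by simp
  also have "\<dots> = kernel_comp M K (pw (Suc (m + n))) (x, y)"
    unfolding kernel_comp_def prod.case using Suc.IH Suc.prems
    by (intro Bochner_Integration.integral_cong) (auto simp: kernel_comp_def)
  finally show ?case by simp
qed simp

lemma pw_sym: "x \<in> space M \<Longrightarrow> y \<in> space M \<Longrightarrow> pw n (x, y) = pw n (y, x)"
proof (induction n arbitrary: x y)
  case (Suc n)
  have "pw (Suc n) (y, x) = (\<integral>z. K (y, z) * pw n (z, x) \<partial>M)" by (simp add: kernel_comp_def)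
  also have "\<dots> = (\<integral>z. pw n (x, z) * pw 0 (z, y) \<partial>M)"
    using Suc K_sym by (intro Bochner_Integration.integral_cong) auto
  also have "\<dots> = pw (Suc n) (x, y)" using pw_add[OF Suc.prems, of n 0] by (simp add: kernel_comp_def)
  finally show ?case by simp
qed (simp add: K_sym)

text \<open>By symmetry the Hilbert-Schmidt inner product of two powers is the trace of their
  product, so it depends on \<open>m + n\<close> only.\<close>

lemma ip_pw: "ip (pw m) (pw n) = (\<integral>x. pw (Suc (m + n)) (x, x) \<partial>M)"
proof -
  have "ip (pw m) (pw n) = (\<integral>x. \<integral>y. pw m (x, y) * pw n (x, y) \<partial>M \<partial>M)"
    unfolding ip_def by (rule Fubini_bdd(1)[symmetric]) (intro bdd_measurable_mult pw_bdd)
  also have "\<dots> = (\<integral>x. kernel_comp M (pw m) (pw n) (x, x) \<partial>M)"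
    unfolding kernel_comp_def prod.case using pw_sym
    by (intro Bochner_Integration.integral_cong refl) auto
  also have "\<dots> = (\<integral>x. pw (Suc (m + n)) (x, x) \<partial>M)"
    using pw_add by (intro Bochner_Integration.integral_cong) auto
  finally show ?thesis .
qed

text \<open>The squared Hilbert-Schmidt norm of the power n + 1. In terms of the eigenvalues \<mu>
  this is the sum of all \<mu> ^ (2 n + 2), so quotients of consecutive values should tend to the
  square of the largest eigenvalue.\<close>

definition c :: "nat \<Rightarrow> real" where
  "c n = ip (pw n) (pw n)"

lemma ip_pw_c: "m + n = 2 * l \<Longrightarrow> ip (pw m) (pw n) = c l"
  by (simp add: ip_pw c_def mult_2)

lemma c_nonneg: "c n \<ge> 0"
  unfolding c_def ip_def by (intro integral_nonneg_AE) auto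

text \<open>Cauchy-Schwarz for the powers with indices n and n + 2, whose inner product is also the
  square norm of the power with index n + 1.\<close>

lemma c_log_convex: "(c (Suc n))\<^sup>2 \<le> c n * c (Suc (Suc n))"
proof -
  have "c (Suc n) = ip (pw n) (pw (Suc (Suc n)))" by (rule ip_pw_c[symmetric]) simp
  then show ?thesis unfolding c_def ip_def
    using Q.Cauchy_Schwarz_bdd[OF pw_bdd pw_bdd, of n "Suc (Suc n)"] by simp
qed

text \<open>Submultiplicativity of the Hilbert-Schmidt norm: Cauchy-Schwarz in the inner variable
  bounds the squared composition by a function of \<open>x\<close> times a function of
  \<open>y\<close>, and the double integral factorises.\<close>

lemma c_submult: "c (Suc (m + n)) \<le> c m * c n"
proof -
  let ?F = "\<lambda>x. \<integral>z. pw m (x, z) * pw m (x, z) \<partial>M" and ?G = "\<lambda>y. \<integral>z. pw n (z, y) * pw n (z, y) \<partial>M"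
  have mm: "bdd_measurable (M \<Otimes>\<^sub>M M) (\<lambda>p. pw l p * pw l p)" for l by (intro bdd_measurable_mult pw_bdd)
  have F: "bdd_measurable M ?F" by (rule bdd_measurable_integral[OF mm])
  have "bdd_measurable (M \<Otimes>\<^sub>M M) (\<lambda>(y, z). pw n (z, y) * pw n (z, y))"
    using bdd_measurable_compose[OF mm measurable_pair_swap', of n] by (simp add: case_prod_beta')
  from bdd_measurable_integral[OF this] have G: "bdd_measurable M ?G" by simp
  have FG: "bdd_measurable (M \<Otimes>\<^sub>M M) (\<lambda>p. ?F (fst p) * ?G (snd p))"
    using bdd_measurable_compose[OF F measurable_fst] bdd_measurable_compose[OF G measurable_snd]
    by (rule bdd_measurable_mult)
  have "c (Suc (m + n)) \<le> (\<integral>p. ?F (fst p) * ?G (snd p) \<partial>(M \<Otimes>\<^sub>M M))"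
    unfolding c_def ip_def
  proof (rule integral_mono)
    show "integrable (M \<Otimes>\<^sub>M M) (\<lambda>p. pw (Suc (m + n)) p * pw (Suc (m + n)) p)"
      by (rule Q.bdd_measurable_integrable[OF mm])
    show "integrable (M \<Otimes>\<^sub>M M) (\<lambda>p. ?F (fst p) * ?G (snd p))"
      by (rule Q.bdd_measurable_integrable[OF FG])
    fix p assume "p \<in> space (M \<Otimes>\<^sub>M M)"
    then obtain x y where p: "p = (x, y)" "x \<in> space M" "y \<in> space M" by (auto simp: space_pair_measure)
    show "pw (Suc (m + n)) p * pw (Suc (m + n)) p \<le> ?F (fst p) * ?G (snd p)"
      using Cauchy_Schwarz_bdd[OF bdd_measurable_sections(1)[OF pw_bdd[of m] p(2)]
          bdd_measurable_sections(2)[OF pw_bdd[of n] p(3)]]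
        pw_add[OF p(2,3), of m n, symmetric] p
      by (simp add: kernel_comp_def power2_eq_square del: pw.simps)
  qed
  also have "\<dots> = (\<integral>x. \<integral>y. ?F x * ?G y \<partial>M \<partial>M)" using Fubini_bdd(1)[OF FG] by simp
  also have "\<dots> = (\<integral>x. ?F x \<partial>M) * (\<integral>y. ?G y \<partial>M)" by simp
  also have "(\<integral>x. ?F x \<partial>M) = c m" unfolding c_def ip_def by (rule Fubini_bdd(1)[OF mm])
  also have "(\<integral>y. ?G y \<partial>M) = c n" unfolding c_def ip_def by (rule Fubini_bdd(2)[OF mm])
  finally show ?thesis .
qed

lemma op_bdd:
  assumes "bdd_measurable M f"
  shows "bdd_measurable M (op f)"
proof -
  have "bdd_measurable (M \<Otimes>\<^sub>M M) (\<lambda>p. K p * f (snd p))"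
    by (intro bdd_measurable_mult K bdd_measurable_compose[OF assms]) measurable
  from bdd_measurable_integral[OF this] show ?thesis by (simp add: op_def[abs_def])
qed

lemma op_self_adjoint:
  assumes "bdd_measurable M f" "bdd_measurable M g"
  shows "(\<integral>x. op f x * g x \<partial>M) = (\<integral>x. f x * op g x \<partial>M)"
proof -
  let ?h = "\<lambda>(x, y). K (x, y) * f y * g x"
  have "bdd_measurable (M \<Otimes>\<^sub>M M) (\<lambda>p. K p * f (snd p) * g (fst p))"
    by (intro bdd_measurable_mult K bdd_measurable_compose[OF assms(1)] bdd_measurable_compose[OF
        assms(2)]) measurable
  then have h: "bdd_measurable (M \<Otimes>\<^sub>M M) ?h" by (simp add: case_prod_beta')
  have "(\<integral>x. op f x * g x \<partial>M) = (\<integral>x. \<integral>y. ?h (x, y) \<partial>M \<partial>M)"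
    by (simp add: op_def)
  also have "\<dots> = (\<integral>y. \<integral>x. ?h (x, y) \<partial>M \<partial>M)" using Fubini_bdd[OF h] by simp
  also have "\<dots> = (\<integral>y. f y * op g y \<partial>M)"
  proof (intro Bochner_Integration.integral_cong refl)
    fix y assume y: "y \<in> space M"
    have "(\<integral>x. ?h (x, y) \<partial>M) = (\<integral>x. f y * (K (y, x) * g x) \<partial>M)"
      using K_sym y by (intro Bochner_Integration.integral_cong refl) auto
    then show "(\<integral>x. ?h (x, y) \<partial>M) = f y * op g y" by (simp add: op_def)
  qed
  finally show ?thesis .
qed

lemma op_add_cmult:
  assumes "bdd_measurable M f" "bdd_measurable M g" "x \<in> space M"
  shows "op (\<lambda>y. f y + r * g y) x = op f x + r * op g x"
proof -
  have "integrable M (\<lambda>y. K (x, y) * f y)" "integrable M (\<lambda>y. K (x, y) * g y)"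
    using assms by (auto intro!: bdd_measurable_integrable bdd_measurable_mult bdd_measurable_sections(1)[OF K])
  moreover have "(\<lambda>y. K (x, y) * (f y + r * g y)) = (\<lambda>y. K (x, y) * f y + r * (K (x, y) * g y))"
    by (auto simp: algebra_simps)
  ultimately show ?thesis by (simp add: op_def)
qed

lemma op_op: "bdd_measurable M f \<Longrightarrow> x \<in> space M \<Longrightarrow> op (op f) x = (\<integral>y. pw 1 (x, y) * f y \<partial>M)"
proof -
  assume f: "bdd_measurable M f" and x: "x \<in> space M"
  let ?h = "\<lambda>(z, y). K (x, z) * K (z, y) * f y"
  have "bdd_measurable (M \<Otimes>\<^sub>M M) (\<lambda>p. K (x, fst p) * K p * f (snd p))"
    by (intro bdd_measurable_mult K bdd_measurable_compose[OF K] bdd_measurable_compose[OF f]) (use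
        x in measurable)
  then have h: "bdd_measurable (M \<Otimes>\<^sub>M M) ?h" by (simp add: case_prod_beta')
  have "op (op f) x = (\<integral>z. \<integral>y. ?h (z, y) \<partial>M \<partial>M)"
    by (simp add: op_def mult.assoc)
  also have "\<dots> = (\<integral>y. \<integral>z. ?h (z, y) \<partial>M \<partial>M)" using Fubini_bdd[OF h] by simp
  also have "\<dots> = (\<integral>y. pw 1 (x, y) * f y \<partial>M)" by (simp add: kernel_comp_def)
  finally show ?thesis .
qed

text \<open>The square norm of \<open>op f\<close> is the pairing of the kernel of the squared
  operator with f(x) f(y), which Cauchy-Schwarz bounds through \<open>c 1\<close>.\<close>

lemma op_zero_if_square_zero:
  assumes "c 1 = 0" "bdd_measurable M f"
  shows "AE x in M. op f x = 0"
proof -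
  have 1: "bdd_measurable (M \<Otimes>\<^sub>M M) (\<lambda>p. pw 1 p * (f (fst p) * f (snd p)))"
    by (intro bdd_measurable_mult pw_bdd bdd_measurable_compose[OF assms(2)]) measurable
  have 2: "bdd_measurable (M \<Otimes>\<^sub>M M) (\<lambda>p. f (fst p) * f (snd p))"
    by (intro bdd_measurable_mult bdd_measurable_compose[OF assms(2)]) measurable
  have "(\<integral>p. pw 1 p * (f (fst p) * f (snd p)) \<partial>(M \<Otimes>\<^sub>M M))\<^sup>2 \<le> 0"
    using Q.Cauchy_Schwarz_bdd[OF pw_bdd 2, of 1] assms(1) by (simp add: c_def ip_def del: pw.simps)
  then have z: "(\<integral>p. pw 1 p * (f (fst p) * f (snd p)) \<partial>(M \<Otimes>\<^sub>M M)) = 0" by simp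
  have "(\<integral>x. op f x * op f x \<partial>M) = (\<integral>x. f x * op (op f) x \<partial>M)"
    by (rule op_self_adjoint[OF assms(2) op_bdd[OF assms(2)]])
  also have "\<dots> = (\<integral>x. \<integral>y. pw 1 (x, y) * (f x * f y) \<partial>M \<partial>M)"
  proof (intro Bochner_Integration.integral_cong refl)
    fix x assume "x \<in> space M"
    then have "f x * op (op f) x = (\<integral>y. f x * (pw 1 (x, y) * f y) \<partial>M)"
      using op_op[OF assms(2)] by simp
    then show "f x * op (op f) x = (\<integral>y. pw 1 (x, y) * (f x * f y) \<partial>M)" by (simp only: mult_ac)
  qed
  also have "\<dots> = 0" using Fubini_bdd(1)[OF 1] z by simp
  finally have "(\<integral>x. op f x * op f x \<partial>M) = 0" .
  moreover have "integrable M (\<lambda>x. op f x * op f x)"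
    by (intro bdd_measurable_integrable bdd_measurable_mult op_bdd assms)
  ultimately show ?thesis by (subst (asm) integral_nonneg_eq_0_iff_AE) auto
qed

text \<open>Composition with \<open>K\<close> on both sides turns the value at a single point into a
  pairing of \<open>G\<close> with a bounded function. Convergence in Hilbert-Schmidt norm thereby
  improves to uniform convergence.\<close>

lemma bilinear_iterate_bound:
  assumes "bdd_measurable (M \<Otimes>\<^sub>M M) G" "x \<in> space M" "y \<in> space M"
    and "\<And>p. p \<in> space (M \<Otimes>\<^sub>M M) \<Longrightarrow> \<bar>K p\<bar> \<le> B" "B \<ge> 0"
  shows "(kernel_comp M K (kernel_comp M G K) (x, y))\<^sup>2 \<le> B ^ 4 * measure (M \<Otimes>\<^sub>M M) (space (M \<Otimes>\<^sub>M M)) * ip G G"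
proof -
  let ?w = "\<lambda>p. K (x, fst p) * K (snd p, y)"
  have w: "bdd_measurable (M \<Otimes>\<^sub>M M) ?w"
    by (intro bdd_measurable_mult bdd_measurable_compose[OF K]) (use assms in measurable)
  have Gw: "bdd_measurable (M \<Otimes>\<^sub>M M) (\<lambda>p. G p * ?w p)" by (intro bdd_measurable_mult w assms)
  have "kernel_comp M K (kernel_comp M G K) (x, y) = (\<integral>z. \<integral>v. K (x, z) * (G (z, v) * K (v, y)) \<partial>M \<partial>M)"
    by (simp add: kernel_comp_def)
  also have "\<dots> = (\<integral>z. \<integral>v. G (z, v) * ?w (z, v) \<partial>M \<partial>M)"
    by (simp only: fst_conv snd_conv mult_ac)
  also have "\<dots> = (\<integral>p. G p * ?w p \<partial>(M \<Otimes>\<^sub>M M))" by (rule Fubini_bdd(1)[OF Gw])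
  finally have "(kernel_comp M K (kernel_comp M G K) (x, y))\<^sup>2 \<le> ip G G * ip ?w ?w"
    using Q.Cauchy_Schwarz_bdd[OF assms(1) w] by (simp add: ip_def)
  moreover have "ip ?w ?w \<le> (\<integral>p. B ^ 4 \<partial>(M \<Otimes>\<^sub>M M))"
    unfolding ip_def
  proof (rule integral_mono)
    show "integrable (M \<Otimes>\<^sub>M M) (\<lambda>p. ?w p * ?w p)"
      by (intro Q.bdd_measurable_integrable bdd_measurable_mult w)
    fix p assume p: "p \<in> space (M \<Otimes>\<^sub>M M)"
    have "\<bar>K (x, fst p)\<bar> \<le> B" "\<bar>K (snd p, y)\<bar> \<le> B"
      using assms(2-4) p by (auto simp: space_pair_measure)
    then have "\<bar>?w p\<bar> \<le> B * B" unfolding abs_mult by (intro mult_mono) (use assms(5) in auto)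
    then have "\<bar>?w p\<bar> * \<bar>?w p\<bar> \<le> (B * B) * (B * B)" by (intro mult_mono) auto
    then show "?w p * ?w p \<le> B ^ 4" by (simp add: power4_eq_xxxx mult.assoc)
  qed simp
  moreover have "ip G G \<ge> 0" unfolding ip_def by (intro integral_nonneg_AE) auto
  ultimately have "(kernel_comp M K (kernel_comp M G K) (x, y))\<^sup>2 \<le> ip G G * (\<integral>p. B ^ 4 \<partial>(M \<Otimes>\<^sub>M M))"
    using mult_left_mono order_trans by blast
  then show ?thesis by (simp add: mult_ac)
qed

lemma kernel_comp_diff_left:
  assumes "bdd_measurable (M \<Otimes>\<^sub>M M) A" "bdd_measurable (M \<Otimes>\<^sub>M M) C" "bdd_measurable (M \<Otimes>\<^sub>M M) D"
    and "x \<in> space M" "y \<in> space M"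
  shows "kernel_comp M (\<lambda>p. A p - C p) D (x, y) = kernel_comp M A D (x, y) - kernel_comp M C D (x, y)"
proof -
  have "integrable M (\<lambda>z. A (x, z) * D (z, y))" "integrable M (\<lambda>z. C (x, z) * D (z, y))"
    using assms by (auto intro!: bdd_measurable_integrable bdd_measurable_mult bdd_measurable_sections)
  then show ?thesis by (simp add: kernel_comp_def left_diff_distrib)
qed

lemma kernel_comp_diff_right:
  assumes "bdd_measurable (M \<Otimes>\<^sub>M M) A" "bdd_measurable (M \<Otimes>\<^sub>M M) C" "bdd_measurable (M \<Otimes>\<^sub>M M) D"
    and "x \<in> space M" "y \<in> space M"
  shows "kernel_comp M D (\<lambda>p. A p - C p) (x, y) = kernel_comp M D A (x, y) - kernel_comp M D C (x, y)"
proof -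
  have "integrable M (\<lambda>z. D (x, z) * A (z, y))" "integrable M (\<lambda>z. D (x, z) * C (z, y))"
    using assms by (auto intro!: bdd_measurable_integrable bdd_measurable_mult bdd_measurable_sections)
  then show ?thesis by (simp add: kernel_comp_def right_diff_distrib)
qed

lemma kernel_comp_cong:
  assumes "\<And>z. z \<in> space M \<Longrightarrow> A (x, z) = A' (x, z)" "\<And>z. z \<in> space M \<Longrightarrow> C (z, y) = C' (z, y)"
  shows "kernel_comp M A C (x, y) = kernel_comp M A' C' (x, y)"
  unfolding kernel_comp_def prod.case
  by (intro Bochner_Integration.integral_cong refl) (simp add: assms)

text \<open>The even powers of the kernel, normalised by the growth rate \<open>q\<close> of their squared
  Hilbert-Schmidt norms \<open>c n\<close>, form a Cauchy sequence, and their limit consists of eigenfunctions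
  of the squared operator. This avoids weak compactness and the spectral theorem.\<close>

theorem eigenvector_exists:
  assumes "bdd_measurable M f0" "\<not> (AE x in M. op f0 x = 0)"
  obtains \<rho> f where "\<rho> > 0" "bdd_measurable M f" "0 < (\<integral>x. f x * f x \<partial>M)"
    "\<And>x. x \<in> space M \<Longrightarrow> op f x = \<rho> * f x"
proof -
  have c1: "c 1 > 0"
    using op_zero_if_square_zero[OF _ assms(1)] assms(2) c_nonneg[of 1] by (auto simp: less_le)
  have cpos2: "c n > 0 \<and> c (Suc n) > 0" for n
  proof (induction n)
    case 0
    have "0 < (c 1)\<^sup>2" using c1 by simp
    also have "\<dots> \<le> c 0 * c (Suc (Suc 0))" using c_log_convex[of 0] by simp
    finally show ?case using c1 c_nonneg[of 0] by (auto simp: zero_less_mult_iff)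
  next
    case (Suc n)
    have "0 < (c (Suc n))\<^sup>2" using Suc by simp
    also have "\<dots> \<le> c n * c (Suc (Suc n))" by (rule c_log_convex)
    finally show ?case using Suc by (auto simp: zero_less_mult_iff)
  qed
  then have cpos: "c n > 0" for n by blast
  \<comment> \<open>The quotients increase by log-convexity; their limit \<open>q\<close> will be
    the square of an eigenvalue.\<close>
  define r where "r n = c (Suc n) / c n" for n
  have rpos: "r n > 0" for n by (simp add: r_def cpos)
  have r_inc: "incseq r"
  proof (rule incseq_SucI)
    show "r n \<le> r (Suc n)" for n
      using c_log_convex[of n] cpos[of n] cpos[of "Suc n"]
      by (simp add: r_def field_simps power2_eq_square)
  qed
  have "r n \<le> c 0" for n using c_submult[of n 0] cpos[of n] by (simp add: r_def field_simps)
  then obtain q where q: "r \<longlonglongrightarrow> q" "\<And>n. r n \<le> q"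
    using incseq_convergent[OF r_inc] by blast
  have qpos: "q > 0" using rpos[of 0] q(2)[of 0] by linarith
  define u where "u n = c n / q ^ Suc n" for n
  have u_dec: "decseq u"
  proof (rule decseq_SucI)
    fix n
    have "u (Suc n) = u n * (r n / q)" using cpos[of n] by (simp add: u_def r_def field_simps)
    also have "\<dots> \<le> u n * 1"
      using q(2)[of n] qpos cpos[of n] by (intro mult_left_mono) (auto simp: u_def field_simps)
    finally show "u (Suc n) \<le> u n" by simp
  qed
  \<comment> \<open>Submultiplicativity bounds each product of n + 1 consecutive quotients by
    \<open>c n\<close>; as the quotients tend to \<open>q\<close>, this gives
    \<open>q ^ Suc n \<le> c n\<close>. It keeps the limit of the normalised powers away from
    0.\<close>
  have u_ge: "1 \<le> u n" for n
  proof -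
    have c_prod: "c (Suc (m + n)) = c m * (\<Prod>i\<le>n. r (m + i))" for m
    proof (induction n)
      case (Suc n)
      have "c (Suc (m + Suc n)) = c (Suc (m + n)) * r (m + Suc n)"
        using cpos[of "Suc (m + n)"] by (simp add: r_def)
      then show ?case using Suc by simp
    qed (use cpos[of m] in \<open>simp add: r_def\<close>)
    have "(\<Prod>i\<le>n. r (m + i)) \<le> c n" for m
      using c_submult[of m n] cpos[of m] by (simp add: c_prod)
    moreover have "(\<lambda>m. \<Prod>i\<le>n. r (m + i)) \<longlonglongrightarrow> (\<Prod>i\<le>n. q)"
      by (intro tendsto_prod LIMSEQ_ignore_initial_segment q(1))
    ultimately have "(\<Prod>i\<le>n. q) \<le> c n" by (intro LIMSEQ_le_const2) auto
    then show ?thesis using qpos by (simp add: u_def field_simps)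
  qed
  obtain L where L: "u \<longlonglongrightarrow> L" "\<And>n. L \<le> u n"
    using decseq_convergent[OF u_dec, of 1] u_ge by blast
  have "1 \<le> L" using L(1) u_ge by (intro LIMSEQ_le_const) auto

  \<comment> \<open>The power i + 1 of the squared operator scaled by 1 / q; even powers are the
    ones that an integral power of \<open>q\<close> normalises.\<close>
  define G where "G i p = pw (2 * i + 1) p / q ^ Suc i" for i p
  have Gb: "bdd_measurable (M \<Otimes>\<^sub>M M) (G i)" for i
    using bdd_measurable_cmult[OF pw_bdd, of "1 / q ^ Suc i" "2 * i + 1"] by (simp add: G_def[abs_def])
  have ipG: "ip (G i) (G j) = u (i + j + 1)" for i j
  proof -
    have "ip (G i) (G j) = ip (pw (2 * i + 1)) (pw (2 * j + 1)) / (q ^ Suc i * q ^ Suc j)"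
      by (simp add: ip_def G_def del: pw.simps power_Suc)
    also have "ip (pw (2 * i + 1)) (pw (2 * j + 1)) = c (i + j + 1)" by (rule ip_pw_c) simp
    finally show ?thesis by (simp add: u_def power_add mult_ac)
  qed
  \<comment> \<open>All three terms approach the same limit \<open>L\<close>, so the combination
    tends to 0.\<close>
  have ip_diff: "ip (\<lambda>p. G i p - G j p) (\<lambda>p. G i p - G j p) = u (2 * i + 1) + u (2 * j + 1) - 2 * u
      (i + j + 1)" for i j
  proof -
    have int: "integrable (M \<Otimes>\<^sub>M M) (\<lambda>p. G i p * G j p)" for i j
      by (intro Q.bdd_measurable_integrable bdd_measurable_mult Gb)
    have "ip (\<lambda>p. G i p - G j p) (\<lambda>p. G i p - G j p) =
        (\<integral>p. G i p * G i p + G j p * G j p - 2 * (G i p * G j p) \<partial>(M \<Otimes>\<^sub>M M))"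
      unfolding ip_def by (intro Bochner_Integration.integral_cong) (auto simp: algebra_simps)
    also have "\<dots> = ip (G i) (G i) + ip (G j) (G j) - 2 * ip (G i) (G j)"
      using int by (simp add: ip_def)
    finally show ?thesis by (simp only: ipG mult_2)
  qed
  \<comment> \<open>Each step sandwiches the kernel between two factors \<open>K\<close>, so that
    \<open>bilinear_iterate_bound\<close> applies to differences.\<close>
  have G_Suc: "G (Suc i) (x, y) = kernel_comp M K (kernel_comp M (G i) K) (x, y) / q"
    if "x \<in> space M" "y \<in> space M" for i x y
  proof -
    have "kernel_comp M (G i) K (z, y) = pw (2 * i + 2) (z, y) / q ^ Suc i" if "z \<in> space M" for z
      using pw_add[OF that \<open>y \<in> space M\<close>, of "2 * i + 1" 0]
      by (simp add: kernel_comp_def G_def del: pw.simps(2) power_Suc)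
    then have "kernel_comp M K (kernel_comp M (G i) K) (x, y) = pw (2 * i + 3) (x, y) / q ^ Suc i"
      by (subst kernel_comp_cong[of K x K _ y "\<lambda>p. pw (2 * i + 2) p / q ^ Suc i"])
         (simp_all add: kernel_comp_def numeral_3_eq_3)
    then show ?thesis by (simp add: G_def numeral_3_eq_3 del: pw.simps)
  qed
  obtain B where B: "B \<ge> 0" "\<And>p. p \<in> space (M \<Otimes>\<^sub>M M) \<Longrightarrow> \<bar>K p\<bar> \<le> B"
    using bdd_measurable_bound[OF K] by blast
  define C where "C = B ^ 4 * measure (M \<Otimes>\<^sub>M M) (space (M \<Otimes>\<^sub>M M)) / q\<^sup>2"
  have C: "C \<ge> 0" by (simp add: C_def B)
  have bound: "(kernel_comp M K (kernel_comp M A K) (x, y) / q)\<^sup>2 \<le> C * ip A A"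
    if "bdd_measurable (M \<Otimes>\<^sub>M M) A" "x \<in> space M" "y \<in> space M" for A x y
    using bilinear_iterate_bound[OF that B(2,1)] qpos
    by (simp add: C_def power_divide divide_right_mono)
  have G_diff: "(G (Suc i) (x, y) - G (Suc j) (x, y))\<^sup>2 \<le> C * (u (2 * i + 1) + u (2 * j + 1) - 2 * L)"
    if "x \<in> space M" "y \<in> space M" for i j x y
  proof -
    have "kernel_comp M K (kernel_comp M (\<lambda>p. G i p - G j p) K) (x, y) =
        kernel_comp M K (\<lambda>p. kernel_comp M (G i) K p - kernel_comp M (G j) K p) (x, y)"
      using kernel_comp_diff_left[OF Gb Gb K _ that(2)] by (intro kernel_comp_cong) auto
    also have "\<dots> = kernel_comp M K (kernel_comp M (G i) K) (x, y) - kernel_comp M K (kernel_comp M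
        (G j) K) (x, y)"
      by (intro kernel_comp_diff_right bdd_measurable_kernel_comp Gb K that)
    finally have "G (Suc i) (x, y) - G (Suc j) (x, y) =
        kernel_comp M K (kernel_comp M (\<lambda>p. G i p - G j p) K) (x, y) / q"
      by (simp add: G_Suc that diff_divide_distrib)
    then have "(G (Suc i) (x, y) - G (Suc j) (x, y))\<^sup>2 \<le> C * (u (2 * i + 1) + u (2 * j + 1) - 2 * u
        (i + j + 1))"
      using bound[OF bdd_measurable_diff[OF Gb Gb] that] ip_diff by simp
    also have "\<dots> \<le> C * (u (2 * i + 1) + u (2 * j + 1) - 2 * L)"
      by (intro mult_left_mono C) (use L(2)[of "i + j + 1"] in linarith)
    finally show ?thesis .
  qed
  define E where "E p = lim (\<lambda>i. G (Suc i) p)" for p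
  have "(\<lambda>i. C * (u (2 * i + 1) - L)) \<longlonglongrightarrow> C * (L - L)"
    by (intro tendsto_intros LIMSEQ_subseq_LIMSEQ[OF L(1), unfolded comp_def])
       (auto simp: strict_mono_def)
  then have v: "(\<lambda>i. C * (u (2 * i + 1) - L)) \<longlonglongrightarrow> 0" by simp
  have lim: "(\<lambda>i. G (Suc i) (x, y)) \<longlonglongrightarrow> E (x, y)" if "x \<in> space M" "y \<in> space M" for x y
  proof -
    have "Cauchy (\<lambda>i. G (Suc i) (x, y))"
    proof (rule metric_CauchyI)
      fix e :: real assume e: "e > 0"
      then have "\<forall>\<^sub>F i in sequentially. C * (u (2 * i + 1) - L) < e\<^sup>2 / 2"
        by (intro order_tendstoD(2)[OF v]) simp
      then obtain N where N: "\<And>i. i \<ge> N \<Longrightarrow> C * (u (2 * i + 1) - L) < e\<^sup>2 / 2"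
        unfolding eventually_sequentially by blast
      have "dist (G (Suc i) (x, y)) (G (Suc j) (x, y)) < e" if "i \<ge> N" "j \<ge> N" for i j
      proof -
        have "(G (Suc i) (x, y) - G (Suc j) (x, y))\<^sup>2 < e\<^sup>2"
          using G_diff[OF \<open>x \<in> space M\<close> \<open>y \<in> space M\<close>, of i j] N[OF that(1)] N[OF that(2)]
          by (simp add: algebra_simps)
        then show ?thesis
          using e power_less_imp_less_base[of "\<bar>G (Suc i) (x, y) - G (Suc j) (x, y)\<bar>" 2 e]
          by (simp add: dist_real_def)
      qed
      then show "\<exists>N. \<forall>i\<ge>N. \<forall>j\<ge>N. dist (G (Suc i) (x, y)) (G (Suc j) (x, y)) < e" by blast
    qed
    then show ?thesis unfolding E_def by (simp add: Cauchy_convergent_iff convergent_LIMSEQ_iff)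
  qed
  define b where "b = sqrt (C * u 1)"
  have G_le: "\<bar>G (Suc i) (x, y)\<bar> \<le> b" if "x \<in> space M" "y \<in> space M" for i x y
  proof -
    have "(G (Suc i) (x, y))\<^sup>2 \<le> C * ip (G i) (G i)" using bound[OF Gb that] by (simp add: G_Suc that)
    also have "\<dots> \<le> C * u 1" using decseqD[OF u_dec, of 1 "i + i + 1"] by (intro mult_left_mono C)
        (simp add: ipG)
    finally show ?thesis unfolding b_def using real_le_rsqrt[of "\<bar>G (Suc i) (x, y)\<bar>"] by simp
  qed
  have E_le: "\<bar>E (x, y)\<bar> \<le> b" if "x \<in> space M" "y \<in> space M" for x y
    using G_le[OF that] by (intro LIMSEQ_le_const2[OF tendsto_rabs[OF lim[OF that]]]) auto
  have E_meas: "E \<in> borel_measurable (M \<Otimes>\<^sub>M M)"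
    by (rule borel_measurable_LIMSEQ_real[of "M \<Otimes>\<^sub>M M" "\<lambda>i. G (Suc i)"])
       (use lim Gb in \<open>auto simp: space_pair_measure dest: bdd_measurableD\<close>)
  have Eb: "bdd_measurable (M \<Otimes>\<^sub>M M) E"
    by (rule bdd_measurableI[OF E_meas, of b]) (use E_le in \<open>auto simp: space_pair_measure\<close>)
  have "(\<lambda>i. ip (G (Suc i)) (G (Suc i))) \<longlonglongrightarrow> ip E E"
    unfolding ip_def
  proof (rule integral_dominated_convergence)
    show "integrable (M \<Otimes>\<^sub>M M) (\<lambda>_. b * b)" by simp
    show "AE p in M \<Otimes>\<^sub>M M. (\<lambda>i. G (Suc i) p * G (Suc i) p) \<longlonglongrightarrow> E p * E p"
      using lim by (intro AE_I2) (auto simp: space_pair_measure intro!: tendsto_mult)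
    show "AE p in M \<Otimes>\<^sub>M M. norm (G (Suc i) p * G (Suc i) p) \<le> b * b" for i
    proof (intro AE_I2)
      fix p assume "p \<in> space (M \<Otimes>\<^sub>M M)"
      then have "\<bar>G (Suc i) p\<bar> \<le> b" using G_le by (auto simp: space_pair_measure)
      then have "\<bar>G (Suc i) p\<bar> * \<bar>G (Suc i) p\<bar> \<le> b * b" by (intro mult_mono) auto
      then show "norm (G (Suc i) p * G (Suc i) p) \<le> b * b" by (simp add: abs_mult)
    qed
  qed (use bdd_measurable_mult[OF Eb Eb] bdd_measurable_mult[OF Gb Gb] in \<open>auto dest: bdd_measurableD\<close>)
  moreover have "(\<lambda>i. ip (G (Suc i)) (G (Suc i))) \<longlonglongrightarrow> L"
    unfolding ipG by (intro LIMSEQ_subseq_LIMSEQ[OF L(1), unfolded comp_def]) (auto simp: strict_mono_def)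
  ultimately have "ip E E = L" using LIMSEQ_unique by blast
  then have "(\<integral>y. \<integral>x. E (x, y) * E (x, y) \<partial>M \<partial>M) = L"
    using Fubini_bdd(2)[OF bdd_measurable_mult[OF Eb Eb]] by (simp add: ip_def)
  \<comment> \<open>The limit kernel has square norm \<open>L \<ge> 1\<close>, so some column of it
    is non-zero; that column serves as the eigenfunction of the squared operator.\<close>
  then have "\<exists>y\<in>space M. (\<integral>x. E (x, y) * E (x, y) \<partial>M) \<noteq> 0"
    using \<open>1 \<le> L\<close> Bochner_Integration.integral_cong[of M M "\<lambda>y. \<integral>x. E (x, y) * E (x, y) \<partial>M" "\<lambda>_. 0"] by auto
  then obtain y where y: "y \<in> space M" "(\<integral>x. E (x, y) * E (x, y) \<partial>M) \<noteq> 0" by blast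
  define f where "f x = E (x, y)" for x
  have f: "bdd_measurable M f" unfolding f_def by (rule bdd_measurable_sections(2)[OF Eb y(1)])
  have f_pos: "(\<integral>x. f x * f x \<partial>M) > 0"
    using y(2) integral_nonneg_AE[of "\<lambda>x. f x * f x" M] by (simp add: f_def less_le)
  have opf: "op (op f) x = q * f x" if x: "x \<in> space M" for x
  proof -
    obtain B1 where B1: "B1 \<ge> 0" "\<And>p. p \<in> space (M \<Otimes>\<^sub>M M) \<Longrightarrow> \<bar>pw 1 p\<bar> \<le> B1"
      using bdd_measurable_bound[OF pw_bdd] by blast
    have "(\<lambda>i. \<integral>z. pw 1 (x, z) * G (Suc i) (z, y) \<partial>M) \<longlonglongrightarrow> (\<integral>z. pw 1 (x, z) * f z \<partial>M)"
    proof (rule integral_dominated_convergence)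
      show "(\<lambda>z. pw 1 (x, z) * f z) \<in> borel_measurable M"
        by (intro bdd_measurableD bdd_measurable_mult f bdd_measurable_sections(1)[OF pw_bdd x])
      show "(\<lambda>z. pw 1 (x, z) * G (Suc i) (z, y)) \<in> borel_measurable M" for i
        by (intro bdd_measurableD bdd_measurable_mult bdd_measurable_sections(2)[OF Gb y(1)]
              bdd_measurable_sections(1)[OF pw_bdd x])
      show "integrable M (\<lambda>_. B1 * b)" by simp
      show "AE z in M. (\<lambda>i. pw 1 (x, z) * G (Suc i) (z, y)) \<longlonglongrightarrow> pw 1 (x, z) * f z"
        using lim y(1) by (intro AE_I2 tendsto_mult_left) (auto simp: f_def)
      show "AE z in M. norm (pw 1 (x, z) * G (Suc i) (z, y)) \<le> B1 * b" for i
        using B1 G_le x y(1) by (intro AE_I2) (auto simp: abs_mult space_pair_measure intro!: mult_mono)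
    qed
    moreover have "(\<integral>z. pw 1 (x, z) * G (Suc i) (z, y) \<partial>M) = q * G (Suc (Suc i)) (x, y)" for i
    proof -
      have "(\<integral>z. pw 1 (x, z) * G (Suc i) (z, y) \<partial>M) = kernel_comp M (pw 1) (pw (2 * Suc i + 1)) (x,
          y) / q ^ Suc (Suc i)"
        by (simp add: G_def kernel_comp_def del: pw.simps power_Suc)
      also have "\<dots> = pw (2 * Suc (Suc i) + 1) (x, y) / q ^ Suc (Suc i)"
        using pw_add[OF x y(1), of 1 "2 * Suc i + 1"] by (simp del: pw.simps)
      finally show ?thesis using qpos by (simp add: G_def del: pw.simps)
    qed
    ultimately have "(\<lambda>i. q * G (Suc (Suc i)) (x, y)) \<longlonglongrightarrow> op (op f) x"
      using op_op[OF f x] by simp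
    moreover have "(\<lambda>i. q * G (Suc (Suc i)) (x, y)) \<longlonglongrightarrow> q * f x"
      unfolding f_def by (intro tendsto_mult_left LIMSEQ_Suc[OF lim[OF x y(1)]])
    ultimately show ?thesis using LIMSEQ_unique by blast
  qed
  define \<rho> where "\<rho> = sqrt q"
  have \<rho>: "\<rho> > 0" "\<rho> * \<rho> = q" using qpos by (auto simp: \<rho>_def)
  \<comment> \<open>The squared operator minus q factors as (op - \<rho>) (op + \<rho>), so the
    first factor annihilates \<open>g\<close>. It cannot vanish almost everywhere, for then
    \<open>f\<close> would belong to the eigenvalue -\<rho>, against positivity.\<close>
  define g where "g x = op f x + \<rho> * f x" for x
  have g: "bdd_measurable M g"
    unfolding g_def by (intro bdd_measurable_add bdd_measurable_cmult op_bdd f)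
  have opg: "op g x = \<rho> * g x" if "x \<in> space M" for x
    using op_add_cmult[OF op_bdd[OF f] f that, of \<rho>] opf[OF that] \<rho>(2)
    by (simp add: g_def[abs_def] algebra_simps)
  have int: "integrable M (\<lambda>x. g x * g x)" by (intro bdd_measurable_integrable bdd_measurable_mult g)
  show ?thesis
  proof (rule that[OF \<rho>(1) g _ opg])
    show "0 < (\<integral>x. g x * g x \<partial>M)"
    proof (rule ccontr)
      assume "\<not> 0 < (\<integral>x. g x * g x \<partial>M)"
      moreover have "0 \<le> (\<integral>x. g x * g x \<partial>M)" by (intro integral_nonneg_AE) auto
      ultimately have "(\<integral>x. g x * g x \<partial>M) = 0" by simp
      then have "AE x in M. g x = 0" using int by (subst (asm) integral_nonneg_eq_0_iff_AE) auto
      then have "AE x in M. op f x * f x = - \<rho> * (f x * f x)"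
        by eventually_elim (simp add: g_def add_eq_0_iff2)
      then have "(\<integral>x. op f x * f x \<partial>M) = (\<integral>x. - \<rho> * (f x * f x) \<partial>M)"
        by (intro integral_cong_AE bdd_measurableD bdd_measurable_mult bdd_measurable_cmult op_bdd f)
      also have "\<dots> < 0" using f_pos \<rho>(1) by (simp add: mult_pos_pos)
      finally show False using K_pos[OF f] by (simp add: op_def)
    qed
  qed
qed

end

section \<open>Bump functions\<close>

text \<open>The witness \<open>F\<close> carries all derivatives as explicit functions, so that
  closure under affine substitution and products amounts to writing down the new family.\<close>

definition smooth1 :: "(real \<Rightarrow> real) \<Rightarrow> bool" where
  "smooth1 f \<longleftrightarrow> (\<exists>F. F 0 = f \<and> (\<forall>n t. (F n has_real_derivative F (Suc n) t) (at t)))"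

text \<open>For \<open>P = 1\<close> this is the classical function exp (- 1 / t), flat at 0;
  polynomial factors in 1 / t make the class closed under differentiation.\<close>

definition flat :: "real poly \<Rightarrow> real \<Rightarrow> real" where
  "flat P t = (if t > 0 then poly P (1 / t) * exp (- (1 / t)) else 0)"

lemma poly_mult_exp_minus_tendsto_0:
  "((\<lambda>u::real. u ^ k * poly P u * exp (- u)) \<longlongrightarrow> 0) at_top"
proof (induction P arbitrary: k)
  case (pCons a P)
  have "((\<lambda>u. a * (u ^ k / exp u) + u ^ Suc k * poly P u * exp (- u)) \<longlongrightarrow> a * 0 + 0) at_top"
    by (intro tendsto_intros tendsto_power_div_exp_0 pCons.IH)
  then show ?case by (simp add: algebra_simps exp_minus divide_inverse)
qed simp

lemma flat_has_derivative:
  "(flat P has_real_derivative flat ([:0, 0, 1:] * (P - pderiv P)) t) (at t)"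
proof -
  consider "t > 0" | "t < 0" | "t = 0" by linarith
  then show ?thesis
  proof cases
    case 1
    have "((\<lambda>t. poly P (1 / t) * exp (- (1 / t))) has_real_derivative
        flat ([:0, 0, 1:] * (P - pderiv P)) t) (at t)"
      using 1 by (auto intro!: derivative_eq_intros poly_DERIV[THEN DERIV_chain2]
          simp: flat_def field_simps power2_eq_square)
    then show ?thesis
      by (rule has_field_derivative_transform_within_open[of _ _ _ "{0<..}"]) (use 1 in \<open>auto simp: flat_def\<close>)
  next
    case 2
    have "((\<lambda>t. 0) has_real_derivative flat ([:0, 0, 1:] * (P - pderiv P)) t) (at t)"
      using 2 by (simp add: flat_def)
    then show ?thesis
      by (rule has_field_derivative_transform_within_open[of _ _ _ "{..<0}"]) (use 2 in \<open>auto simp: flat_def\<close>)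
  next
    case 3
    have l: "((\<lambda>h. flat P h / h) \<longlongrightarrow> 0) (at_left 0)"
      by (rule tendsto_eventually) (auto simp: flat_def eventually_at_filter)
    \<comment> \<open>With u = 1 / h the difference quotient at 0 becomes a polynomial in u times
      exp (- u).\<close>
    have "((\<lambda>h. (inverse h) ^ 1 * poly P (inverse h) * exp (- inverse h)) \<longlongrightarrow> 0) (at_right 0)"
      by (rule filterlim_compose[OF poly_mult_exp_minus_tendsto_0 filterlim_inverse_at_top_right])
    then have r: "((\<lambda>h. flat P h / h) \<longlongrightarrow> 0) (at_right 0)"
      by (rule Lim_transform_eventually) (auto simp: flat_def eventually_at_filter field_simps)
    show ?thesis using filterlim_split_at[OF l r] 3 by (simp add: DERIV_def flat_def)
  qed
qed

lemma smooth1_flat: "smooth1 (flat P)"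
  unfolding smooth1_def
  by (rule exI[of _ "\<lambda>n. flat (((\<lambda>P. [:0, 0, 1:] * (P - pderiv P)) ^^ n) P)"])
     (use flat_has_derivative in auto)

lemma smooth1_affine:
  assumes "smooth1 f"
  shows "smooth1 (\<lambda>t. f (a * t + b))"
proof -
  obtain F where F: "F 0 = f" "\<And>n t. (F n has_real_derivative F (Suc n) t) (at t)"
    using assms by (auto simp: smooth1_def)
  have "((\<lambda>t. a ^ n * F n (a * t + b)) has_real_derivative a ^ Suc n * F (Suc n) (a * t + b)) (at t)" for n t
    by (rule derivative_eq_intros DERIV_chain2[OF F(2)] refl | simp)+
  then show ?thesis unfolding smooth1_def
    by (intro exI[of _ "\<lambda>n t. a ^ n * F n (a * t + b)"]) (simp add: F(1))
qed

text \<open>Leibniz' rule as bookkeeping: a list of index pairs stands for the sum of the products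
  \<open>F u t * H v t\<close>, and \<open>step\<close> replaces each pair by the two pairs that its
  derivative produces.\<close>

lemma smooth1_mult:
  assumes "smooth1 f" "smooth1 g"
  shows "smooth1 (\<lambda>t. f t * g t)"
proof -
  obtain F where F: "F 0 = f" "\<And>n t. (F n has_real_derivative F (Suc n) t) (at t)"
    using assms by (auto simp: smooth1_def)
  obtain H where H: "H 0 = g" "\<And>n t. (H n has_real_derivative H (Suc n) t) (at t)"
    using assms by (auto simp: smooth1_def)
  define G where "G l t = (\<Sum>(u, v)\<leftarrow>l. F u t * H v t)" for l t
  define step where "step l = concat (map (\<lambda>(u, v). [(Suc u, v), (u, Suc v)]) l)" for l :: "(nat \<times> nat) list"
  have "(G l has_real_derivative G (step l) t) (at t)" for l t
  proof (induction l)
    case (Cons p l)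
    obtain u v where p: "p = (u, v)" by force
    have "((\<lambda>t. F u t * H v t + G l t) has_real_derivative
        (F (Suc u) t * H v t + H (Suc v) t * F u t) + G (step l) t) (at t)"
      by (intro DERIV_add DERIV_mult F(2) H(2) Cons)
    then show ?case by (simp add: G_def[abs_def] step_def p algebra_simps)
  qed (simp add: G_def[abs_def] step_def)
  then show ?thesis unfolding smooth1_def
    by (intro exI[of _ "\<lambda>n. G ((step ^^ n) [(0, 0)])"]) (auto simp: G_def[abs_def] F(1) H(1))
qed

text \<open>Differentiating in direction \<open>j\<close> raises the order of the factor
  \<open>j\<close> and leaves the others alone, so all iterated partial derivatives keep the product
  form \<open>pr\<close>.\<close>

lemma smooth_prod_C_k:
  fixes f :: "'d::finite \<Rightarrow> real \<Rightarrow> real"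
  assumes "\<And>i. smooth1 (f i)"
  shows "(\<lambda>x. \<Prod>i\<in>UNIV. f i (x $ i)) \<in> C_k k UNIV"
proof -
  obtain F where F: "\<And>i. F i 0 = f i" "\<And>i n t. (F i n has_real_derivative F i (Suc n) t) (at t)"
    using assms unfolding smooth1_def by metis
  define pr where "pr n x = (\<Prod>i\<in>UNIV. F i (n i) (x $ i))" for n and x :: "real ^ 'd"
  have der: "((\<lambda>t. pr n (x + t *\<^sub>R coord_dir j)) has_real_derivative pr (n(j := Suc (n j))) x) (at 0)" for n x j
  proof -
    have *: "pr m y = F j (m j) (y $ j) * (\<Prod>i\<in>UNIV - {j}. F i (m i) (y $ i))" for m y
      unfolding pr_def by (rule prod.remove) auto
    have "(\<Prod>i\<in>UNIV - {j}. F i (n i) ((x + t *\<^sub>R coord_dir j) $ i)) = (\<Prod>i\<in>UNIV - {j}. F i (n i) (x $ i))" for t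
      by (rule prod.cong) (auto simp: coord_dir_def axis_def)
    then have "(\<lambda>t. pr n (x + t *\<^sub>R coord_dir j)) =
        (\<lambda>t. F j (n j) (x $ j + t) * (\<Prod>i\<in>UNIV - {j}. F i (n i) (x $ i)))"
      by (subst *) (simp add: coord_dir_def)
    moreover have "((\<lambda>t. F j (n j) (x $ j + t)) has_real_derivative F j (Suc (n j)) (x $ j)) (at 0)"
      using F(2)[of j "n j" "x $ j + 0"] DERIV_shift[of "F j (n j)" _ 0 "x $ j"] by (simp add: add.commute)
    then have "((\<lambda>t. F j (n j) (x $ j + t) * (\<Prod>i\<in>UNIV - {j}. F i (n i) (x $ i))) has_real_derivative
        F j (Suc (n j)) (x $ j) * (\<Prod>i\<in>UNIV - {j}. F i (n i) (x $ i))) (at 0)"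
      by (rule DERIV_cmult_right)
    moreover have "pr (n(j := Suc (n j))) x = F j (Suc (n j)) (x $ j) * (\<Prod>i\<in>UNIV - {j}. F i (n i) (x $ i))"
      by (subst *) (auto intro!: prod.cong)
    ultimately show ?thesis by simp
  qed
  have cF: "continuous_on UNIV (F i m)" for i m
    using F(2)[of i m] DERIV_isCont continuous_at_imp_continuous_on by blast
  have "continuous_on UNIV (\<lambda>x :: real ^ 'd. F i m (x $ i))" for i m
    by (rule continuous_on_compose2[OF cF]) (auto intro!: continuous_intros)
  then have cont: "continuous_on UNIV (pr n)" for n
    unfolding pr_def[abs_def] by (intro continuous_on_prod)
  have "iter_partial_exists UNIV (map coord_dir ds) (pr n) \<and>
      (\<exists>m. iter_partial (map coord_dir ds) (pr n) = pr m)" for ds n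
  proof (induction ds)
    case (Cons j ds)
    then obtain m where m: "iter_partial (map coord_dir ds) (pr n) = pr m" by blast
    have "iter_partial (map coord_dir (j # ds)) (pr n) = pr (m(j := Suc (m j)))"
      using partial_deriv_eqI[OF der] by (auto simp: m)
    moreover have "(\<lambda>t. pr m (x + t *\<^sub>R coord_dir j)) field_differentiable at 0" for x
      using der by (auto simp: field_differentiable_def)
    ultimately show ?case using Cons m by auto
  qed auto
  from this[of _ "\<lambda>_. 0"] cont have "pr (\<lambda>_. 0) \<in> C_k k UNIV"
    unfolding C_k_def by (auto, metis)
  then show ?thesis by (simp add: pr_def[abs_def] F(1))
qed

text \<open>Positive exactly on the open box, with transition layers that shrink as \<open>n\<close>
  grows, so that the limit is the indicator of the box. These test functions separate weak
  derivatives.\<close>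

definition bump :: "nat \<Rightarrow> real ^ 'd::finite \<Rightarrow> real ^ 'd \<Rightarrow> real ^ 'd \<Rightarrow> real" where
  "bump n a b x = (\<Prod>i\<in>UNIV. flat 1 (real (Suc n) * (x $ i - a $ i)) * flat 1 (real (Suc n) * (b $ i - x $ i)))"

lemma bump_smooth: "bump n a b \<in> C_k k UNIV"
proof -
  have "smooth1 (\<lambda>t. flat 1 (real (Suc n) * t + - real (Suc n) * a $ i) * flat 1 (- real (Suc n) * t
      + real (Suc n) * b $ i))" for i
    by (intro smooth1_mult smooth1_affine smooth1_flat)
  from smooth_prod_C_k[OF this] show ?thesis
    by (simp add: bump_def[abs_def] algebra_simps)
qed

lemma flat_bounds: "0 \<le> flat 1 t" "flat 1 t \<le> 1" "flat 1 t \<noteq> 0 \<longleftrightarrow> t > 0"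
  by (auto simp: flat_def)

lemma bump_bounds: "0 \<le> bump n a b x" "bump n a b x \<le> 1"
  unfolding bump_def by (auto intro!: prod_nonneg prod_le_1 mult_nonneg_nonneg mult_le_one simp: flat_bounds)

lemma bump_nonzero_iff: "bump n a b x \<noteq> 0 \<longleftrightarrow> x \<in> box a b"
  unfolding bump_def by (auto simp: mem_box_cart flat_bounds zero_less_mult_iff)

lemma bump_test_function:
  assumes "cbox a b \<subseteq> \<Theta>"
  shows "test_function \<Theta> (bump n a b)"
proof -
  have "closure {x. bump n a b x \<noteq> 0} \<subseteq> cbox a b"
    by (rule closure_minimal) (use box_subset_cbox in \<open>auto simp: bump_nonzero_iff\<close>)
  moreover have "compact (closure {x. bump n a b x \<noteq> 0})"
    using calculation bounded_cbox bounded_subset compact_eq_bounded_closed by blast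
  ultimately show ?thesis using assms bump_smooth by (auto simp: test_function_def)
qed

lemma bump_tendsto: "(\<lambda>n. bump n a b x) \<longlonglongrightarrow> indicator (box a b) x"
proof (cases "x \<in> box a b")
  case True
  have 1: "(\<lambda>n. flat 1 (real (Suc n) * t)) \<longlonglongrightarrow> 1" if "t > 0" for t
  proof -
    have "(\<lambda>n. 1 / real (Suc n)) \<longlonglongrightarrow> 0"
      using LIMSEQ_inverse_real_of_nat by (simp add: inverse_eq_divide)
    then have "(\<lambda>n. exp (- ((1 / real (Suc n)) * (1 / t)))) \<longlonglongrightarrow> exp (- (0 * (1 / t)))"
      by (intro tendsto_intros)
    then show ?thesis using that by (simp add: flat_def del: of_nat_Suc)
  qed
  have "(\<lambda>n. bump n a b x) \<longlonglongrightarrow> (\<Prod>i\<in>(UNIV :: 'a set). 1 * 1)"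
    unfolding bump_def by (intro tendsto_intros 1) (use True in \<open>auto simp: mem_box_cart\<close>)
  then show ?thesis using True by simp
next
  case False
  then have "bump n a b x = 0" for n using bump_nonzero_iff by blast
  then show ?thesis using False by simp
qed

section \<open>Integrals over open sets\<close>

text \<open>The definitions integrate over completed Lebesgue measure, whereas product measures and
  Fubini are used with Borel measure; for Borel functions the two agree.\<close>

lemma integral_lebesgue_on_open:
  fixes f :: "'a::euclidean_space \<Rightarrow> real"
  assumes "open \<Theta>" "f \<in> borel_measurable (restrict_space borel \<Theta>)"
  shows "integral\<^sup>L (lebesgue_on \<Theta>) f = (\<integral>x. f x \<partial>restrict_space lborel \<Theta>)"
    and "integrable (lebesgue_on \<Theta>) f \<longleftrightarrow> integrable (restrict_space lborel \<Theta>) f"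
    and "f \<in> borel_measurable (lebesgue_on \<Theta>)"
proof -
  have \<Theta>: "\<Theta> \<in> sets borel" using assms by simp
  have m: "(\<lambda>x. indicator \<Theta> x *\<^sub>R f x) \<in> borel_measurable lborel"
    using assms(2) \<Theta> by (simp add: borel_measurable_restrict_space_iff)
  show "integral\<^sup>L (lebesgue_on \<Theta>) f = (\<integral>x. f x \<partial>restrict_space lborel \<Theta>)"
    using \<Theta> integral_completion[OF m] by (simp add: integral_restrict_space)
  show "integrable (lebesgue_on \<Theta>) f \<longleftrightarrow> integrable (restrict_space lborel \<Theta>) f"
    using \<Theta> integrable_completion[OF m] by (simp add: integrable_restrict_space)
  show "f \<in> borel_measurable (lebesgue_on \<Theta>)"
    using \<Theta> measurable_completion[OF m] by (subst borel_measurable_restrict_space_iff) auto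
qed

lemma continuous_on_zero_extension:
  fixes g :: "'a::topological_space \<Rightarrow> real"
  assumes "open \<Theta>" "closed S" "S \<subseteq> \<Theta>" "continuous_on \<Theta> g" "\<And>x. x \<notin> S \<Longrightarrow> g x = 0"
  shows "continuous_on UNIV g"
proof -
  have "continuous_on (\<Theta> \<union> - S) g"
    by (rule continuous_on_open_Un) (use assms in \<open>auto intro: continuous_on_eq[OF
        continuous_on_const[of _ 0]]\<close>)
  moreover have "\<Theta> \<union> - S = UNIV" using assms by auto
  ultimately show ?thesis by simp
qed

text \<open>Translation invariance makes the integral of every difference quotient vanish. The
  quotients converge to \<open>W'\<close> and, by the mean value theorem, are bounded and supported
  in one compact set.\<close>

lemma integral_directional_derivative_eq_0:
  fixes W W' :: "'a::euclidean_space \<Rightarrow> real"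
  assumes der: "\<And>x. ((\<lambda>s. W (x + s *\<^sub>R b)) has_real_derivative W' x) (at 0)"
    and cont: "continuous_on UNIV W" "continuous_on UNIV W'"
    and S: "compact S" "\<And>x. x \<notin> S \<Longrightarrow> W x = 0" "\<And>x. x \<notin> S \<Longrightarrow> W' x = 0"
  shows "(\<integral>x. W' x \<partial>lborel) = 0"
proof -
  have int: "integrable lborel W"
  proof -
    have "integrable lborel (\<lambda>x. indicator S x *\<^sub>R W x)"
      by (rule borel_integrable_compact) (use S cont continuous_on_subset in blast)+
    moreover have "(\<lambda>x. indicator S x *\<^sub>R W x) = W" using S by (intro ext) (auto simp: indicator_def)
    ultimately show ?thesis by simp
  qed
  have [measurable]: "W \<in> borel_measurable borel" "W' \<in> borel_measurable borel"
    using cont by (auto intro: borel_measurable_continuous_onI)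
  have shift: "integrable lborel (\<lambda>x. W (x + c))" "(\<integral>x. W (x + c) \<partial>lborel) = (\<integral>x. W x \<partial>lborel)" for c
    using int lborel_distr_plus[of c] integrable_distr_eq[of "(+) c" lborel borel W]
      integral_distr[of "(+) c" lborel borel W] by (auto simp: add.commute)
  obtain R where R: "R > 0" "S \<subseteq> cball 0 R"
    using compact_imp_bounded[OF S(1)] by (force simp: bounded_pos)
  obtain B where B: "B > 0" "\<And>x. \<bar>W' x\<bar> \<le> B"
  proof -
    have "bounded (W' ` S)"
      using compact_continuous_image[OF continuous_on_subset[OF cont(2)] S(1)] compact_imp_bounded by blast
    then obtain B where "B > 0" "\<And>y. y \<in> W' ` S \<Longrightarrow> norm y \<le> B" unfolding bounded_pos by blast
    then show ?thesis using S(3) by (intro that[of B]) (metis abs_zero imageI less_imp_le real_norm_def)+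
  qed
  define h where "h n = 1 / real (Suc n)" for n
  have h: "h n > 0" "h n \<le> 1" for n by (auto simp: h_def)
  have hlim: "h \<longlonglongrightarrow> 0" using LIMSEQ_inverse_real_of_nat by (simp add: h_def[abs_def] inverse_eq_divide)
  \<comment> \<open>Enlarging the radius by \<open>norm b\<close> covers the supports of all
    quotients, since the steps \<open>h n\<close> are at most 1.\<close>
  define T where "T = cball (0::'a) (R + norm b)"
  have "(\<lambda>n. \<integral>x. (W (x + h n *\<^sub>R b) - W x) / h n \<partial>lborel) \<longlonglongrightarrow> (\<integral>x. W' x \<partial>lborel)"
  proof (rule integral_dominated_convergence)
    show "integrable lborel (\<lambda>x. indicator T x *\<^sub>R B)"
      by (rule borel_integrable_compact) (auto simp: T_def)
    show "AE x in lborel. (\<lambda>n. (W (x + h n *\<^sub>R b) - W x) / h n) \<longlonglongrightarrow> W' x"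
    proof (rule AE_I2)
      fix x
      have "((\<lambda>s. (W (x + s *\<^sub>R b) - W x) / s) \<longlongrightarrow> W' x) (at 0)" using der[of x] by (simp add: DERIV_def)
      then show "(\<lambda>n. (W (x + h n *\<^sub>R b) - W x) / h n) \<longlonglongrightarrow> W' x"
        using hlim h(1) unfolding tendsto_at_iff_sequentially comp_def by (auto simp: less_imp_neq[symmetric])
    qed
    fix n
    show "AE x in lborel. norm ((W (x + h n *\<^sub>R b) - W x) / h n) \<le> indicator T x *\<^sub>R B"
    proof (rule AE_I2)
      fix x
      obtain s where s: "\<bar>s\<bar> \<le> \<bar>h n\<bar>" "W (x + h n *\<^sub>R b) - W x = h n * W' (x + s *\<^sub>R b)"
        using line_mvt[of UNIV W b W' "h n" x] der by auto
      have eq: "(W (x + h n *\<^sub>R b) - W x) / h n = W' (x + s *\<^sub>R b)" using s(2) h(1)[of n] by simp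
      show "norm ((W (x + h n *\<^sub>R b) - W x) / h n) \<le> indicator T x *\<^sub>R B"
      proof (cases "W' (x + s *\<^sub>R b) = 0")
        case False
        then have "norm (x + s *\<^sub>R b) \<le> R" using S(3) R(2) by force
        moreover have "norm (s *\<^sub>R b) \<le> norm b" using s(1) h[of n] by (simp add: mult_left_le_one_le)
        moreover have "norm x \<le> norm (x + s *\<^sub>R b) + norm (s *\<^sub>R b)"
          by (metis add_diff_cancel_right' norm_triangle_ineq4)
        ultimately have "x \<in> T" by (simp add: T_def)
        then show ?thesis using B eq by simp
      next
        case True
        show ?thesis unfolding eq using B(1) by (simp add: True)
      qed
    qed
  qed measurable
  moreover have "(\<integral>x. (W (x + h n *\<^sub>R b) - W x) / h n \<partial>lborel) = 0" for n
    using shift int by simp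
  ultimately have "(\<lambda>n :: nat. 0) \<longlonglongrightarrow> (\<integral>x. W' x \<partial>lborel)" by (simp only:)
  then show ?thesis by (simp add: LIMSEQ_const_iff)
qed

section \<open>Weak derivatives\<close>

lemma DERIV_transform_ev:
  "(f has_real_derivative D) (at a) \<Longrightarrow> \<forall>\<^sub>F t in nhds a. f t = g t \<Longrightarrow> (g has_real_derivative D) (at a)"
  using DERIV_cong_ev[OF refl _ refl, of f g a D] by blast

lemma C_k_perm:
  assumes "open \<Theta>" "f \<in> C_k k \<Theta>" "mset ds = mset es" "length ds \<le> k" "x \<in> \<Theta>"
  shows "iter_partial (map coord_dir ds) f x = iter_partial (map coord_dir es) f x"
proof -
  have "length es \<le> k" using assms(3,4) by (metis size_mset)
  then show ?thesis using assms
    by (intro iter_partial_perm[OF assms(1,5)]) (auto simp: C_k_def)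
qed

lemma C_k_partial_deriv:
  assumes "f \<in> C_k (Suc n) \<Theta>"
  shows "partial_deriv (coord_dir d) f \<in> C_k n \<Theta>"
proof -
  have "iter_partial_exists \<Theta> (map coord_dir (ds @ [d])) f \<and>
      continuous_on \<Theta> (iter_partial (map coord_dir (ds @ [d])) f)" if "length ds \<le> n" for ds
    using assms that unfolding C_k_def mem_Collect_eq by (elim allE[of _ "ds @ [d]"]) auto
  then show ?thesis by (auto simp: C_k_def iter_partial_append iter_partial_exists_append)
qed

lemma C_k_mono: "f \<in> C_k k \<Theta> \<Longrightarrow> l \<le> k \<Longrightarrow> f \<in> C_k l \<Theta>"
  by (auto simp: C_k_def)

lemma C_k_continuous: "f \<in> C_k k \<Theta> \<Longrightarrow> continuous_on \<Theta> f"
  unfolding C_k_def mem_Collect_eq by (elim allE[of _ "[]"]) auto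

lemma C_k_has_derivative:
  assumes "f \<in> C_k (Suc n) \<Theta>" "x \<in> \<Theta>"
  shows "((\<lambda>t. f (x + t *\<^sub>R coord_dir d)) has_real_derivative partial_deriv (coord_dir d) f x) (at 0)"
proof -
  have "iter_partial_exists \<Theta> (map coord_dir [d]) f"
    using assms(1) unfolding C_k_def mem_Collect_eq by (elim allE[of _ "[d]"]) auto
  then show ?thesis using iter_partial_has_derivative[of \<Theta> "coord_dir d" "[]" f x] assms(2) by simp
qed

text \<open>The derivative of the product of \<open>u\<close> and \<open>\<phi>\<close>, extended by
  zero outside \<Theta>, integrates to 0. The extension is differentiable along lines everywhere
  because \<open>\<phi>\<close> vanishes off the compact set \<open>S\<close> inside
  \<Theta>.\<close>

lemma integration_by_parts_step:
  fixes u \<phi> :: "real ^ 'd \<Rightarrow> real"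
  assumes \<Theta>: "open \<Theta>" and u: "u \<in> C_k (Suc 0) \<Theta>" and \<phi>: "\<phi> \<in> C_k (Suc 0) UNIV"
    and S: "compact S" "S \<subseteq> \<Theta>" "\<And>x. x \<notin> S \<Longrightarrow> \<phi> x = 0"
  shows "(\<integral>x. u x * partial_deriv (coord_dir d) \<phi> x \<partial>lebesgue_on \<Theta>) =
      - (\<integral>x. partial_deriv (coord_dir d) u x * \<phi> x \<partial>lebesgue_on \<Theta>)"
proof -
  let ?u' = "partial_deriv (coord_dir d) u" and ?\<phi>' = "partial_deriv (coord_dir d) \<phi>"
  have cu: "continuous_on \<Theta> u" "continuous_on \<Theta> ?u'"
    using C_k_continuous[OF u] C_k_continuous[OF C_k_partial_deriv[OF u]] by blast+
  have c\<phi>: "continuous_on UNIV \<phi>" "continuous_on UNIV ?\<phi>'"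
    using C_k_continuous[OF \<phi>] C_k_continuous[OF C_k_partial_deriv[OF \<phi>]] by blast+
  have cl: "closed S" using S(1) compact_imp_closed by blast
  have \<phi>'0: "?\<phi>' x = 0" if "x \<notin> S" for x
    using partial_deriv_cong[of "- S" x \<phi> "\<lambda>_. 0" "coord_dir d"] cl that S(3)
    by (simp add: partial_deriv_def open_Compl)
  define W where "W x = (if x \<in> \<Theta> then u x * \<phi> x else 0)" for x
  define A where "A x = (if x \<in> \<Theta> then u x * ?\<phi>' x else 0)" for x
  define C where "C x = (if x \<in> \<Theta> then ?u' x * \<phi> x else 0)" for x
  have cont: "continuous_on UNIV (\<lambda>x. if x \<in> \<Theta> then v x * \<psi> x else 0)"
    if "continuous_on \<Theta> v" "continuous_on UNIV \<psi>" "\<And>x. x \<notin> S \<Longrightarrow> \<psi> x = 0" for v \<psi> :: "real ^ 'd \<Rightarrow> real"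
  proof (rule continuous_on_zero_extension[OF \<Theta> cl S(2)])
    have "continuous_on \<Theta> (\<lambda>x. v x * \<psi> x)"
      by (intro continuous_on_mult that continuous_on_subset[OF that(2)]) auto
    then show "continuous_on \<Theta> (\<lambda>x. if x \<in> \<Theta> then v x * \<psi> x else 0)"
      by (rule continuous_on_eq) auto
  qed (use that in auto)
  have cW: "continuous_on UNIV W" and cA: "continuous_on UNIV A" and cC: "continuous_on UNIV C"
    unfolding W_def A_def C_def by (intro cont cu c\<phi> S(3) \<phi>'0; assumption)+
  have der: "((\<lambda>s. W (x + s *\<^sub>R coord_dir d)) has_real_derivative A x + C x) (at 0)" for x
  proof (cases "x \<in> \<Theta>")
    case True
    have "((\<lambda>s. u (x + s *\<^sub>R coord_dir d) * \<phi> (x + s *\<^sub>R coord_dir d)) has_real_derivative A x + C x) (at 0)"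
      using DERIV_mult[OF C_k_has_derivative[OF u True] C_k_has_derivative[OF \<phi>, of x]] True
      by (simp add: A_def C_def algebra_simps)
    moreover have "\<forall>\<^sub>F s in nhds 0. u (x + s *\<^sub>R coord_dir d) * \<phi> (x + s *\<^sub>R coord_dir d) = W (x + s
        *\<^sub>R coord_dir d)"
      using eventually_line[OF \<Theta> True, of "coord_dir d"] by eventually_elim (simp add: W_def)
    ultimately show ?thesis by (rule DERIV_transform_ev)
  next
    case False
    then have x: "x \<in> - S" using S(2) by blast
    have "((\<lambda>s. 0) has_real_derivative A x + C x) (at 0)" using False by (simp add: A_def C_def)
    moreover have "\<forall>\<^sub>F s in nhds 0. 0 = W (x + s *\<^sub>R coord_dir d)"
      using eventually_line[OF open_Compl[OF cl] x, of "coord_dir d"] by eventually_elim (simp add: W_def S(3))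
    ultimately show ?thesis by (rule DERIV_transform_ev)
  qed
  have int: "integrable lborel f" if "continuous_on UNIV f" "\<And>x. x \<notin> S \<Longrightarrow> f x = 0" for f :: "real ^ 'd \<Rightarrow> real"
  proof -
    have "integrable lborel (\<lambda>x. indicator S x *\<^sub>R f x)"
      by (rule borel_integrable_compact) (use S that continuous_on_subset in blast)+
    moreover have "(\<lambda>x. indicator S x *\<^sub>R f x) = f" using that by (intro ext) (auto simp: indicator_def)
    ultimately show ?thesis by simp
  qed
  have "(\<integral>x. A x + C x \<partial>lborel) = 0"
    by (rule integral_directional_derivative_eq_0[OF der cW continuous_on_add[OF cA cC] S(1)])
       (auto simp: W_def A_def C_def S(3) \<phi>'0)
  moreover have "integrable lborel A" by (rule int[OF cA]) (simp add: A_def \<phi>'0)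
  moreover have "integrable lborel C" by (rule int[OF cC]) (simp add: C_def S(3))
  ultimately have "(\<integral>x. A x \<partial>lborel) = - (\<integral>x. C x \<partial>lborel)" by simp
  moreover have eq: "(\<integral>x. f x \<partial>lebesgue_on \<Theta>) = (\<integral>x. (if x \<in> \<Theta> then f x else 0) \<partial>lborel)"
    if "continuous_on \<Theta> f" for f :: "real ^ 'd \<Rightarrow> real"
  proof -
    have "(\<integral>x. f x \<partial>lebesgue_on \<Theta>) = (\<integral>x. f x \<partial>restrict_space lborel \<Theta>)"
      by (rule integral_lebesgue_on_open(1)[OF \<Theta> borel_measurable_continuous_on_restrict[OF that]])
    also have "\<dots> = (\<integral>x. indicator \<Theta> x *\<^sub>R f x \<partial>lborel)"
      using \<Theta> by (subst integral_restrict_space) auto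
    also have "\<dots> = (\<integral>x. (if x \<in> \<Theta> then f x else 0) \<partial>lborel)"
      by (intro Bochner_Integration.integral_cong) auto
    finally show ?thesis .
  qed
  ultimately show ?thesis
    using eq[of "\<lambda>x. u x * ?\<phi>' x"] eq[of "\<lambda>x. ?u' x * \<phi> x"] cu c\<phi>
    by (simp add: A_def C_def continuous_on_mult continuous_on_subset[OF _ subset_UNIV])
qed

lemma iter_partial_zero_outside:
  assumes "closed S" "\<And>x. x \<notin> S \<Longrightarrow> \<phi> x = 0" "x \<notin> S"
  shows "iter_partial bs \<phi> x = 0"
proof -
  have "iter_partial bs \<phi> x = iter_partial bs (\<lambda>_. 0) x"
    by (rule iter_partial_cong[of "- S"]) (use assms in auto)
  also have "iter_partial bs (\<lambda>_. 0) = (\<lambda>_. 0)"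
    by (induction bs) (auto simp: partial_deriv_def)
  finally show ?thesis by simp
qed

text \<open>Each step moves the outermost derivative of \<open>\<phi>\<close> over to
  \<open>f\<close>, where it becomes the innermost one; this reverses the list.\<close>

lemma integration_by_parts:
  fixes f \<phi> :: "real ^ 'd \<Rightarrow> real"
  assumes \<Theta>: "open \<Theta>" and f: "f \<in> C_k (length ds) \<Theta>" and \<phi>: "\<phi> \<in> C_k (length ds) UNIV"
    and S: "compact S" "S \<subseteq> \<Theta>" "\<And>x. x \<notin> S \<Longrightarrow> \<phi> x = 0"
  shows "(\<integral>x. f x * iter_partial (map coord_dir ds) \<phi> x \<partial>lebesgue_on \<Theta>) =
      (-1) ^ length ds * (\<integral>x. iter_partial (map coord_dir (rev ds)) f x * \<phi> x \<partial>lebesgue_on \<Theta>)"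
  using f \<phi>
proof (induction ds arbitrary: f)
  case (Cons d ds)
  let ?\<psi> = "iter_partial (map coord_dir ds) \<phi>"
  have \<psi>: "?\<psi> \<in> C_k (Suc 0) UNIV"
  proof -
    have "iter_partial_exists UNIV (map coord_dir (es @ ds)) \<phi> \<and>
        continuous_on UNIV (iter_partial (map coord_dir (es @ ds)) \<phi>)" if "length es \<le> Suc 0" for es
      using Cons.prems(2) that unfolding C_k_def mem_Collect_eq by (elim allE[of _ "es @ ds"]) auto
    then show ?thesis by (auto simp: C_k_def iter_partial_append iter_partial_exists_append)
  qed
  have "(\<integral>x. f x * partial_deriv (coord_dir d) ?\<psi> x \<partial>lebesgue_on \<Theta>) =
      - (\<integral>x. partial_deriv (coord_dir d) f x * ?\<psi> x \<partial>lebesgue_on \<Theta>)"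
    by (rule integration_by_parts_step[OF \<Theta> _ \<psi> S(1,2)])
       (use Cons.prems in \<open>auto intro: C_k_mono iter_partial_zero_outside[OF compact_imp_closed[OF S(1)]] S(3)\<close>)
  also have "(\<integral>x. partial_deriv (coord_dir d) f x * ?\<psi> x \<partial>lebesgue_on \<Theta>) =
      (-1) ^ length ds * (\<integral>x. iter_partial (map coord_dir (rev ds)) (partial_deriv (coord_dir d) f)
          x * \<phi> x \<partial>lebesgue_on \<Theta>)"
    using Cons.prems by (intro Cons.IH C_k_partial_deriv) (auto intro: C_k_mono)
  finally show ?case by (simp add: iter_partial_append)
qed simp

lemma continuous_integrable_lebesgue_on_compact:
  fixes f :: "'a::euclidean_space \<Rightarrow> real"
  assumes "compact K" "continuous_on K f"
  shows "integrable (lebesgue_on K) f"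
proof -
  have "integrable lborel (\<lambda>x. indicator K x *\<^sub>R f x)" by (rule borel_integrable_compact[OF assms])
  then have "integrable lebesgue (\<lambda>x. indicator K x *\<^sub>R f x)"
    using integrable_completion[OF borel_measurable_integrable] by blast
  then show ?thesis using fmeasurableD[OF lmeasurable_compact[OF assms(1)]] by (subst
      integrable_restrict_space) auto
qed

lemma has_weak_deriv_classical:
  fixes f :: "real ^ 'd \<Rightarrow> real"
  assumes "open \<Theta>" "f \<in> C_k k \<Theta>" "mi_order \<alpha> \<le> k"
  shows "has_weak_deriv \<Theta> \<alpha> f (classical_deriv \<alpha> f)"
proof -
  have len: "length (mi_dirs \<alpha>) \<le> k" using assms(3) by (simp add: length_mi_dirs)
  have "locally_integrable \<Theta> f"
    using C_k_continuous[OF assms(2)] by (auto simp: locally_integrable_def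
        intro: continuous_integrable_lebesgue_on_compact continuous_on_subset)
  moreover have "continuous_on \<Theta> (classical_deriv \<alpha> f)"
    using assms(2) len by (simp add: C_k_def classical_deriv_def)
  then have "locally_integrable \<Theta> (classical_deriv \<alpha> f)"
    by (auto simp: locally_integrable_def
        intro: continuous_integrable_lebesgue_on_compact continuous_on_subset)
  moreover have "(\<integral>x. f x * classical_deriv \<alpha> \<phi> x \<partial>lebesgue_on \<Theta>) =
      (-1) ^ mi_order \<alpha> * (\<integral>x. classical_deriv \<alpha> f x * \<phi> x \<partial>lebesgue_on \<Theta>)"
    if \<phi>: "test_function \<Theta> \<phi>" for \<phi>
  proof -
    have "(\<integral>x. f x * classical_deriv \<alpha> \<phi> x \<partial>lebesgue_on \<Theta>) =
      (-1) ^ length (mi_dirs \<alpha>) * (\<integral>x. iter_partial (map coord_dir (rev (mi_dirs \<alpha>))) f x * \<phi> x \<partial>lebesgue_on \<Theta>)"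
      unfolding classical_deriv_def
      by (rule integration_by_parts[OF assms(1) C_k_mono[OF assms(2) len], of _ "closure {x. \<phi> x \<noteq> 0}"])
         (use \<phi> closure_subset[of "{x. \<phi> x \<noteq> 0}"] in \<open>auto simp: test_function_def\<close>)
    also have "(\<integral>x. iter_partial (map coord_dir (rev (mi_dirs \<alpha>))) f x * \<phi> x \<partial>lebesgue_on \<Theta>) =
        (\<integral>x. classical_deriv \<alpha> f x * \<phi> x \<partial>lebesgue_on \<Theta>)"
      unfolding classical_deriv_def
      by (intro Bochner_Integration.integral_cong refl)
         (use C_k_perm[OF assms(1,2), of "rev (mi_dirs \<alpha>)" "mi_dirs \<alpha>"] len in auto)
    finally show ?thesis by (simp add: length_mi_dirs)
  qed
  ultimately show ?thesis by (auto simp: has_weak_deriv_def)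
qed

text \<open>Boxes are stable under intersection and generate the Borel sets, so \<open>D\<close> has
  integral 0 over every Borel set; the sets where it is positive or negative are then tested. The
  support condition yields integral 0 over the whole space, on which the step to complements
  rests.\<close>

lemma AE_eq_0_if_box_integrals_eq_0:
  fixes D :: "real ^ 'd \<Rightarrow> real"
  assumes D: "integrable lebesgue D"
    and box: "\<And>a b. (\<integral>x. indicator (box a b) x * D x \<partial>lebesgue) = 0"
    and supp: "\<And>x. x \<notin> box p q \<Longrightarrow> D x = 0"
  shows "AE x in lebesgue. D x = 0"
proof -
  have int: "integrable lebesgue (\<lambda>x. indicator A x * D x)" if "A \<in> sets borel" for A
    using integrable_mult_indicator[of A lebesgue D] D that by auto
  have "(\<lambda>x. indicator (box p q) x * D x) = D" using supp by (intro ext) (auto simp: indicator_def)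
  then have tot: "(\<integral>x. D x \<partial>lebesgue) = 0" using box[of p q] by simp
  have zero: "(\<integral>x. indicator A x * D x \<partial>lebesgue) = 0" if "A \<in> sets borel" for A
  proof -
    have "Int_stable (range (\<lambda>(a, b). box a b :: (real ^ 'd) set))"
    proof (rule Int_stableI)
      fix X Y assume "X \<in> range (\<lambda>(a, b). box a b :: (real ^ 'd) set)" "Y \<in> range (\<lambda>(a, b). box a b
          :: (real ^ 'd) set)"
      then obtain a b c d where XY: "X = box a b" "Y = box c d" by auto
      obtain a' b' where "X \<inter> Y = box a' b'" unfolding XY box_Int_box by blast
      then show "X \<inter> Y \<in> range (\<lambda>(a, b). box a b :: (real ^ 'd) set)" by (intro image_eqI[of _ _
          "(a', b')"]) auto
    qed
    moreover have "range (\<lambda>(a, b). box a b :: (real ^ 'd) set) \<subseteq> Pow UNIV" by auto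
    moreover have "A \<in> sigma_sets UNIV (range (\<lambda>(a, b). box a b :: (real ^ 'd) set))"
      using that unfolding borel_eq_box by simp
    ultimately show ?thesis
    proof (induction rule: sigma_sets_induct_disjoint)
      case (basic A)
      then show ?case using box by auto
    next
      case empty
      show ?case by simp
    next
      case (compl A)
      then have A: "A \<in> sets borel" unfolding borel_eq_box by simp
      have "(\<integral>x. indicator (UNIV - A) x * D x \<partial>lebesgue) = (\<integral>x. D x - indicator A x * D x \<partial>lebesgue)"
        by (intro Bochner_Integration.integral_cong) (auto simp: indicator_def)
      then show ?case using compl D int[OF A] tot by simp
    next
      case (union F)
      then have F: "F i \<in> sets borel" for i unfolding borel_eq_box by auto
      have "(LINT x:(\<Union>i. F i)|lebesgue. D x) = (\<Sum>i. (LINT x:(F i)|lebesgue. D x))"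
        by (rule lebesgue_integral_countable_add)
           (use F union(1) int[of "\<Union>i. F i"] in \<open>auto simp: disjoint_family_on_def set_integrable_def\<close>)
      then show ?case using union by (simp add: set_lebesgue_integral_def)
    qed
  qed
  \<comment> \<open>Passing to a Borel version of \<open>D\<close> makes its sign sets
    Borel.\<close>
  have "D \<in> borel_measurable (completion lborel)" using D by (rule borel_measurable_integrable)
  from completion_ex_borel_measurable_real[OF this] obtain D' where
    D' [measurable]: "D' \<in> borel_measurable borel" and eq: "AE x in lborel. D x = D' x" by auto
  have eq': "AE x in lebesgue. D x = D' x" by (rule AE_completion[OF eq])
  have int': "integrable lebesgue D'"
  proof (rule integrable_cong_AE_imp[OF D])
    show "D' \<in> borel_measurable lebesgue" using measurable_completion[of D' lborel borel] D' by simp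
    show "AE x in lebesgue. D x = D' x" by (rule eq')
  qed
  have half: "AE x in lebesgue. indicator {x. s * D' x > 0} x * (s * D' x) = 0" for s
  proof -
    have A: "{x. s * D' x > 0} \<in> sets borel" by measurable
    have "(\<integral>x. indicator {x. s * D' x > 0} x * (s * D' x) \<partial>lebesgue) =
        (\<integral>x. s * (indicator {x. s * D' x > 0} x * D x) \<partial>lebesgue)"
    proof (intro integral_cong_AE borel_measurable_times)
      show "(indicator {x. s * D' x > 0} :: _ \<Rightarrow> real) \<in> borel_measurable lebesgue"
        using A by (intro borel_measurable_indicator) auto
      then show "(indicator {x. s * D' x > 0} :: _ \<Rightarrow> real) \<in> borel_measurable lebesgue" .
      show "AE x in lebesgue. indicator {x. s * D' x > 0} x * (s * D' x) = s * (indicator {x. s * D'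
          x > 0} x * D x)"
        using eq' by eventually_elim simp
    qed (use D int' in \<open>auto dest: borel_measurable_integrable\<close>)
    also have "\<dots> = 0" using zero[OF A] by simp
    finally have "(\<integral>x. indicator {x. s * D' x > 0} x * (s * D' x) \<partial>lebesgue) = 0" .
    moreover have "integrable lebesgue (\<lambda>x. indicator {x. s * D' x > 0} x * (s * D' x))"
      using integrable_mult_indicator[of "{x. s * D' x > 0}" lebesgue "\<lambda>x. s * D' x"] int' A by auto
    ultimately show ?thesis
      by (subst (asm) integral_nonneg_eq_0_iff_AE) (auto simp: indicator_def)
  qed
  show ?thesis using half[of 1] half[of "-1"] eq'
    by eventually_elim (auto simp: indicator_def split: if_splits)
qed

lemma has_weak_derivD:
  "has_weak_deriv \<Theta> \<alpha> f g \<Longrightarrow> test_function \<Theta> \<phi> \<Longrightarrow>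
    (\<integral>x. f x * classical_deriv \<alpha> \<phi> x \<partial>lebesgue_on \<Theta>) = (-1) ^ mi_order \<alpha> * (\<integral>x. g x * \<phi> x \<partial>lebesgue_on \<Theta>)"
  by (simp add: has_weak_deriv_def)

text \<open>The fundamental lemma of the calculus of variations: testing with \<open>bump\<close>
  and letting its parameter grow gives equal integrals over every box whose closure lies in
  \<Theta>. Countably many boxes cover \<Theta>.\<close>

lemma weak_deriv_unique:
  fixes f :: "real ^ 'd \<Rightarrow> real"
  assumes \<Theta>: "open \<Theta>" and g1: "has_weak_deriv \<Theta> \<alpha> f g1" and g2: "has_weak_deriv \<Theta> \<alpha> f g2"
  shows "AE x in lebesgue_on \<Theta>. g1 x = g2 x"
proof -
  have loc: "integrable lebesgue (\<lambda>x. indicator K x * g x)" if "compact K" "K \<subseteq> \<Theta>"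
      "locally_integrable \<Theta> g" for K g
    using that integrable_restrict_space[of K lebesgue g] fmeasurableD[OF lmeasurable_compact[of K]]
        by (auto simp: locally_integrable_def)
  have box0: "(\<integral>x. indicator (box a b) x * (g1 x - g2 x) \<partial>lebesgue) = 0" if ab: "cbox a b \<subseteq> \<Theta>" for a b
  proof -
    have lim: "(\<lambda>n. \<integral>x. g x * bump n a b x \<partial>lebesgue_on \<Theta>) \<longlonglongrightarrow> (\<integral>x. indicator (box a b) x * g x \<partial>lebesgue)"
      if g: "locally_integrable \<Theta> g" for g
    proof -
      let ?G = "\<lambda>x. indicator (cbox a b) x * g x"
      have G: "integrable lebesgue ?G" by (rule loc[OF compact_cbox ab g])
      have bm: "bump n a b \<in> borel_measurable lebesgue" for n
        using measurable_completion[of "bump n a b" lborel borel]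
          borel_measurable_continuous_onI[OF C_k_continuous[OF bump_smooth[of n a b]]] by simp
      have "(\<lambda>n. \<integral>x. ?G x * bump n a b x \<partial>lebesgue) \<longlonglongrightarrow> (\<integral>x. ?G x * indicator (box a b) x \<partial>lebesgue)"
      proof (rule integral_dominated_convergence)
        show "integrable lebesgue (\<lambda>x. norm (?G x))" using G by (rule integrable_norm)
        show "AE x in lebesgue. (\<lambda>n. ?G x * bump n a b x) \<longlonglongrightarrow> ?G x * indicator (box a b) x"
          by (intro AE_I2 tendsto_mult_left bump_tendsto)
        show "AE x in lebesgue. norm (?G x * bump n a b x) \<le> norm (?G x)" for n
          using bump_bounds[of n a b] by (intro AE_I2) (auto simp: abs_mult intro!: mult_left_le)
        show "(\<lambda>x. ?G x * bump n a b x) \<in> borel_measurable lebesgue" for n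
          by (rule borel_measurable_times[OF borel_measurable_integrable[OF G] bm])
        show "(\<lambda>x. ?G x * indicator (box a b) x) \<in> borel_measurable lebesgue"
          by (rule borel_measurable_times[OF borel_measurable_integrable[OF G]]) (simp add:
              borel_measurable_indicator)
      qed
      moreover have "(\<integral>x. ?G x * bump n a b x \<partial>lebesgue) = (\<integral>x. g x * bump n a b x \<partial>lebesgue_on \<Theta>)" for n
      proof -
        have "(\<integral>x. g x * bump n a b x \<partial>lebesgue_on \<Theta>) = (\<integral>x. indicator \<Theta> x *\<^sub>R (g x * bump n a b x) \<partial>lebesgue)"
          using \<Theta> by (subst integral_restrict_space) auto
        also have "\<dots> = (\<integral>x. ?G x * bump n a b x \<partial>lebesgue)"
          using ab bump_nonzero_iff[of n a b] box_subset_cbox[of a b]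
          by (intro Bochner_Integration.integral_cong) (auto simp: indicator_def)
        finally show ?thesis by simp
      qed
      moreover have "(\<integral>x. ?G x * indicator (box a b) x \<partial>lebesgue) = (\<integral>x. indicator (box a b) x * g x \<partial>lebesgue)"
        using box_subset_cbox[of a b] by (intro Bochner_Integration.integral_cong) (auto simp: indicator_def)
      ultimately show ?thesis by simp
    qed
    have "(\<integral>x. g1 x * bump n a b x \<partial>lebesgue_on \<Theta>) = (\<integral>x. g2 x * bump n a b x \<partial>lebesgue_on \<Theta>)" for n
    proof -
      have "(-1) ^ mi_order \<alpha> * (\<integral>x. g1 x * bump n a b x \<partial>lebesgue_on \<Theta>) =
          (-1) ^ mi_order \<alpha> * (\<integral>x. g2 x * bump n a b x \<partial>lebesgue_on \<Theta>)"
        using has_weak_derivD[OF g1 bump_test_function[OF ab]] has_weak_derivD[OF g2 bump_test_function[OF ab]]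
        by (rule trans[OF sym])
      then show ?thesis by simp
    qed
    then have "(\<lambda>n. \<integral>x. g2 x * bump n a b x \<partial>lebesgue_on \<Theta>) \<longlonglongrightarrow> (\<integral>x. indicator (box a b) x * g1 x \<partial>lebesgue)"
      using lim[of g1] g1 by (simp add: has_weak_deriv_def)
    moreover have "(\<lambda>n. \<integral>x. g2 x * bump n a b x \<partial>lebesgue_on \<Theta>) \<longlonglongrightarrow> (\<integral>x. indicator (box a b) x * g2 x \<partial>lebesgue)"
      using lim[of g2] g2 by (simp add: has_weak_deriv_def)
    ultimately have "(\<integral>x. indicator (box a b) x * g1 x \<partial>lebesgue) = (\<integral>x. indicator (box a b) x * g2
        x \<partial>lebesgue)"
      by (rule LIMSEQ_unique)
    moreover have "integrable lebesgue (\<lambda>x. indicator (box a b) x * g x)" if "locally_integrable \<Theta> g" for g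
    proof -
      have "integrable lebesgue (\<lambda>x. indicator (box a b) x *\<^sub>R (indicator (cbox a b) x * g x))"
        by (rule integrable_mult_indicator[OF _ loc[OF compact_cbox ab that]]) auto
      moreover have "(\<lambda>x. indicator (box a b) x *\<^sub>R (indicator (cbox a b) x * g x)) = (\<lambda>x. indicator
          (box a b) x * g x)"
        using box_subset_cbox[of a b] by (intro ext) (auto simp: indicator_def)
      ultimately show ?thesis by simp
    qed
    ultimately show ?thesis using g1 g2 by (simp add: has_weak_deriv_def right_diff_distrib)
  qed
  have AE_box: "AE x in lebesgue. indicator (box p q) x * (g1 x - g2 x) = 0" if pq: "cbox p q \<subseteq> \<Theta>" for p q
  proof (rule AE_eq_0_if_box_integrals_eq_0[of _ p q])
    have "integrable lebesgue (\<lambda>x. indicator (box p q) x *\<^sub>R (indicator (cbox p q) x * g1 x -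
        indicator (cbox p q) x * g2 x))"
      by (intro integrable_mult_indicator Bochner_Integration.integrable_diff loc pq compact_cbox)
         (use g1 g2 in \<open>auto simp: has_weak_deriv_def\<close>)
    moreover have "(\<lambda>x. indicator (box p q) x *\<^sub>R (indicator (cbox p q) x * g1 x - indicator (cbox p
        q) x * g2 x)) =
        (\<lambda>x. indicator (box p q) x * (g1 x - g2 x))"
      using box_subset_cbox[of p q] by (intro ext) (auto simp: indicator_def)
    ultimately show "integrable lebesgue (\<lambda>x. indicator (box p q) x * (g1 x - g2 x))" by simp
    fix a b :: "real ^ 'd"
    \<comment> \<open>Integrals over arbitrary boxes reduce to boxes inside \<Theta>, since the
      intersection with \<open>box p q\<close> is again a box.\<close>
    obtain a' b' where ab': "box a b \<inter> box p q = box a' b'" unfolding box_Int_box by blast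
    have "(\<integral>x. indicator (box a b) x * (indicator (box p q) x * (g1 x - g2 x)) \<partial>lebesgue) =
        (\<integral>x. indicator (box a' b') x * (g1 x - g2 x) \<partial>lebesgue)"
      by (simp add: mult.assoc[symmetric] indicator_inter_arith[symmetric] ab')
    also have "\<dots> = 0"
    proof (cases "box a' b' = {}")
      case False
      then have "box p q \<noteq> {}" using ab' by auto
      then have "cbox a' b' \<subseteq> cbox p q"
        using closure_mono[of "box a' b'" "box p q"] ab' False by (simp add: closure_box) blast
      then show ?thesis using box0 pq by blast
    qed simp
    finally show "(\<integral>x. indicator (box a b) x * (indicator (box p q) x * (g1 x - g2 x)) \<partial>lebesgue) = 0" .
  qed (auto simp: indicator_def)
  obtain \<D> where \<D>: "countable \<D>" "\<D> \<subseteq> Pow \<Theta>" "\<And>X. X \<in> \<D> \<Longrightarrow> \<exists>a b. X = cbox a b" "\<Union>\<D> = \<Theta>"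
    using open_countable_Union_open_cbox[OF \<Theta>] by metis
  have "AE x in lebesgue. x \<in> X \<longrightarrow> g1 x = g2 x" if X: "X \<in> \<D>" for X
  proof -
    obtain a b where ab: "X = cbox a b" using \<D>(3)[OF X] by blast
    \<comment> \<open>The covering consists of closed boxes, while equality is known on open ones;
      their frontiers are null sets.\<close>
    have "cbox a b - box a b \<in> null_sets lebesgue"
      using negligible_frontier_interval negligible_iff_null_sets by blast
    from AE_not_in[OF this] have "AE x in lebesgue. x \<notin> cbox a b - box a b" .
    moreover have "AE x in lebesgue. indicator (box a b) x * (g1 x - g2 x) = 0"
      by (rule AE_box) (use \<D>(2) X ab in auto)
    ultimately show ?thesis unfolding ab by eventually_elim auto
  qed
  then have "AE x in lebesgue. \<forall>X\<in>\<D>. x \<in> X \<longrightarrow> g1 x = g2 x"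
    by (subst AE_ball_countable[OF \<D>(1)]) blast
  then have "AE x in lebesgue. x \<in> \<Theta> \<longrightarrow> g1 x = g2 x"
    by eventually_elim (use \<D>(4) in blast)
  then show ?thesis using \<Theta> by (subst AE_restrict_space_iff) auto
qed

text \<open>\<open>weak_deriv\<close> is an arbitrary choice among the weak derivatives; existence
  and uniqueness almost everywhere tie it to the classical derivative.\<close>

lemma weak_deriv_eq_classical:
  fixes f :: "real ^ 'd \<Rightarrow> real"
  assumes "open \<Theta>" "f \<in> C_k k \<Theta>" "mi_order \<alpha> \<le> k"
  shows "AE x in lebesgue_on \<Theta>. weak_deriv \<Theta> \<alpha> f x = classical_deriv \<alpha> f x"
    and "has_weak_deriv \<Theta> \<alpha> f (weak_deriv \<Theta> \<alpha> f)"
proof -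
  show *: "has_weak_deriv \<Theta> \<alpha> f (weak_deriv \<Theta> \<alpha> f)"
    unfolding weak_deriv_def using has_weak_deriv_classical[OF assms] by (rule someI[of "has_weak_deriv \<Theta> \<alpha> f"])
  show "AE x in lebesgue_on \<Theta>. weak_deriv \<Theta> \<alpha> f x = classical_deriv \<alpha> f x"
    by (rule weak_deriv_unique[OF assms(1) * has_weak_deriv_classical[OF assms]])
qed

section \<open>The Sobolev embedding\<close>

text \<open>What averaging uses of a cone: positive volume, through openness and non-emptiness, and
  the segments towards the vertex. The vertex itself lies outside the cone, hence
  \<open>0 < t\<close>.\<close>

lemma finite_cone_properties:
  fixes x :: "'a::real_normed_vector"
  assumes "is_finite_cone x C"
  shows "open C" "C \<noteq> {}" "\<And>y t. y \<in> C \<Longrightarrow> 0 < t \<Longrightarrow> t \<le> 1 \<Longrightarrow> x + t *\<^sub>R (y - x) \<in> C"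
proof -
  obtain z \<epsilon> \<tau> where e: "\<epsilon> > 0" "\<tau> > 0" "x \<notin> ball z \<tau>"
    and C: "C = ball x \<epsilon> \<inter> {x + l *\<^sub>R (y - x) | y l. y \<in> ball z \<tau> \<and> l > 0}"
    using assms unfolding is_finite_cone_def by blast
  have eq: "x + l *\<^sub>R (y - x) = (x - l *\<^sub>R x) + l *\<^sub>R y" for y and l :: real
    by (simp add: algebra_simps)
  have "{x + l *\<^sub>R (y - x) | y l. y \<in> ball z \<tau> \<and> l > 0} = (\<Union>l\<in>{0<..}. (\<lambda>y. (x - l *\<^sub>R x) + l *\<^sub>R y) ` ball z \<tau>)"
    unfolding eq by blast
  moreover have "open (\<Union>l\<in>{0<..}. (\<lambda>y. (x - l *\<^sub>R x) + l *\<^sub>R y) ` ball z \<tau>)"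
    by (intro open_UN ballI open_affinity) auto
  ultimately show "open C" unfolding C by (simp add: open_Int)
  have zx: "z \<noteq> x" using e by auto
  define l where "l = \<epsilon> / (2 * norm (z - x))"
  have "l > 0" using zx e by (simp add: l_def)
  moreover have "norm (l *\<^sub>R (z - x)) < \<epsilon>" using zx e by (simp add: l_def)
  ultimately have "x + l *\<^sub>R (z - x) \<in> C" unfolding C using e by (force simp: dist_norm)
  then show "C \<noteq> {}" by blast
  fix y t assume y: "y \<in> C" and t: "0 < t" "(t::real) \<le> 1"
  from y obtain w l where wl: "y = x + l *\<^sub>R (w - x)" "w \<in> ball z \<tau>" "l > 0" and d: "dist x y < \<epsilon>"
    unfolding C by auto
  have "x + t *\<^sub>R (y - x) = x + (t * l) *\<^sub>R (w - x)" using wl by simp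
  moreover have "t * l > 0" using t wl by simp
  moreover have "t * norm (y - x) \<le> norm (y - x)" using t by (simp add: mult_left_le_one_le)
  then have "dist x (x + t *\<^sub>R (y - x)) < \<epsilon>" using d t by (simp add: dist_norm norm_minus_commute)
  ultimately show "x + t *\<^sub>R (y - x) \<in> C" unfolding C using wl(2) by auto
qed

text \<open>Words of directions replace multi-indices in Taylor's formula: every ordering of the
  directions is a summand of its own, so that no multinomial coefficients appear.\<close>

definition words :: "nat \<Rightarrow> 'd list set" where
  "words n = {ds. length ds = n}"

section \<open>Taylor's formula along a segment\<close>

lemma sum_words_Suc:
  fixes F :: "'d::finite list \<Rightarrow> real"
  shows "(\<Sum>w\<in>words (Suc n). F w) = (\<Sum>w\<in>words n. \<Sum>d\<in>UNIV. F (d # w))"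
proof -
  have "(\<Sum>w\<in>words n. \<Sum>d\<in>UNIV. F (d # w)) = (\<Sum>(w, d)\<in>words n \<times> UNIV. F (d # w))"
    by (rule sum.cartesian_product)
  also have "\<dots> = (\<Sum>w\<in>words (Suc n). F w)"
    by (rule sum.reindex_bij_witness[of _ "\<lambda>w. (tl w, hd w)" "\<lambda>(w, d). d # w"])
       (auto simp: words_def length_Suc_conv)
  finally show ?thesis by simp
qed

lemma norm_prod_list_le:
  fixes f :: "'b \<Rightarrow> real"
  assumes "\<And>d. \<bar>f d\<bar> \<le> D"
  shows "\<bar>prod_list (map f ds)\<bar> \<le> D ^ length ds"
proof (induction ds)
  case (Cons d ds)
  have "0 \<le> D" using assms[of d] by linarith
  then show ?case using Cons assms[of d] by (simp add: abs_mult mult_mono)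
qed simp

text \<open>Taylor's formula is centred at \<open>x + v\<close> and evaluated at \<open>x\<close>,
  so the lower-order terms sit at a point that can be averaged over a cone. The remainder carries
  \<open>s ^ (m - 1)\<close>, which is to compensate the concentration near the vertex. Values in
  \<open>ennreal\<close> prepare for Tonelli's theorem.\<close>

lemma Taylor_ray_bound:
  fixes g :: "real ^ 'd \<Rightarrow> real" and v :: "real ^ 'd"
  assumes S: "open S" and g: "g \<in> C_k m S" and m: "m > 0"
    and seg: "\<And>t. 0 \<le> t \<Longrightarrow> t \<le> 1 \<Longrightarrow> x + t *\<^sub>R v \<in> S"
    and D: "\<And>i. \<bar>v $ i\<bar> \<le> D"
  shows "ennreal \<bar>g x\<bar> \<le>
    (\<Sum>i<m. \<Sum>w\<in>words i. ennreal (D ^ i / fact i) * ennreal \<bar>iter_partial (map coord_dir w) g (x + v)\<bar>) +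
    (\<Sum>w\<in>words m. ennreal (D ^ m / fact (m - 1)) *
       (\<integral>\<^sup>+ s. indicator {0<..1} s * ennreal (s ^ (m - 1)) * ennreal \<bar>iter_partial (map coord_dir w)
           g (x + s *\<^sub>R v)\<bar> \<partial>lborel))"
proof -
  let ?P = "\<lambda>w. iter_partial (map coord_dir w) g"
  define \<Phi> where "\<Phi> i t = (\<Sum>w\<in>words i. prod_list (map (($) v) w) * ?P w (x + t *\<^sub>R v))" for i t
  have D0: "D \<ge> 0" using D[of undefined] by linarith
  have cont: "continuous_on S (?P w)" if "length w \<le> m" for w
    using g that by (auto simp: C_k_def)
  have der\<Phi>: "(\<Phi> i has_real_derivative \<Phi> (Suc i) t) (at t)" if i: "i < m" and t: "0 \<le> t" "t \<le> 1" for i t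
  proof -
    have "((\<lambda>t. ?P w (x + t *\<^sub>R v)) has_real_derivative (\<Sum>d\<in>UNIV. v $ d * ?P (d # w) (x + t *\<^sub>R v))) (at t)"
      if w: "w \<in> words i" for w
    proof (rule has_derivative_along_line, rule directional_derivative[OF S])
      fix d z assume z: "z \<in> S"
      have "iter_partial_exists S (map coord_dir (d # w)) g"
        using g w i unfolding C_k_def words_def mem_Collect_eq by (elim allE[of _ "d # w"]) auto
      then show "((\<lambda>s. ?P w (z + s *\<^sub>R axis d 1)) has_real_derivative ?P (d # w) z) (at 0)"
        using iter_partial_has_derivative[of S "coord_dir d" "map coord_dir w" g z] z by (simp add:
            coord_dir_def)
    next
      show "continuous_on S (?P (d # w))" for d by (rule cont) (use w i in \<open>auto simp: words_def\<close>)
    qed (use seg t in auto)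
    then have "(\<Phi> i has_real_derivative
        (\<Sum>w\<in>words i. prod_list (map (($) v) w) * (\<Sum>d\<in>UNIV. v $ d * ?P (d # w) (x + t *\<^sub>R v)))) (at t)"
      unfolding \<Phi>_def by (intro DERIV_sum DERIV_cmult)
    also have "(\<Sum>w\<in>words i. prod_list (map (($) v) w) * (\<Sum>d\<in>UNIV. v $ d * ?P (d # w) (x + t *\<^sub>R v)))
        = \<Phi> (Suc i) t"
      unfolding \<Phi>_def sum_words_Suc by (simp add: sum_distrib_left mult_ac del: iter_partial.simps)
    finally show ?thesis .
  qed
  have \<Phi>_le: "ennreal \<bar>\<Phi> i t\<bar> \<le> (\<Sum>w\<in>words i. ennreal (D ^ i) * ennreal \<bar>?P w (x + t *\<^sub>R v)\<bar>)" for i t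
  proof -
    have "\<bar>\<Phi> i t\<bar> \<le> (\<Sum>w\<in>words i. \<bar>prod_list (map (($) v) w) * ?P w (x + t *\<^sub>R v)\<bar>)"
      unfolding \<Phi>_def by (rule sum_abs)
    also have "\<dots> \<le> (\<Sum>w\<in>words i. D ^ i * \<bar>?P w (x + t *\<^sub>R v)\<bar>)"
      using norm_prod_list_le[of "($) v", OF D] by (intro sum_mono) (auto simp: abs_mult words_def
          intro!: mult_right_mono)
    finally have "ennreal \<bar>\<Phi> i t\<bar> \<le> ennreal (\<Sum>w\<in>words i. D ^ i * \<bar>?P w (x + t *\<^sub>R v)\<bar>)"
      by (rule ennreal_leI)
    also have "\<dots> = (\<Sum>w\<in>words i. ennreal (D ^ i) * ennreal \<bar>?P w (x + t *\<^sub>R v)\<bar>)"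
      using D0 by (subst sum_ennreal[symmetric]) (auto simp: ennreal_mult intro!: sum.cong)
    finally show ?thesis .
  qed
  \<comment> \<open>The parameter runs from \<open>x + v\<close> at 0 to \<open>x\<close> at 1; the
    sign in \<open>Df\<close> comes from this reversal.\<close>
  define f where "f \<tau> = \<Phi> 0 (1 - \<tau>)" for \<tau>
  define Df where "Df i \<tau> = (-1) ^ i * \<Phi> i (1 - \<tau>)" for i \<tau>
  define I where "I \<tau> = ((1 - \<tau>) ^ (m - 1) / fact (m - 1)) *\<^sub>R Df m \<tau>" for \<tau>
  have Df: "(Df i has_vector_derivative Df (Suc i) t) (at t within {0..1})" if "i < m" "0 \<le> t" "t \<le> 1" for i t
  proof -
    have "((\<lambda>\<tau>. \<Phi> i (1 - \<tau>)) has_real_derivative \<Phi> (Suc i) (1 - t) * - 1) (at t)"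
      by (rule DERIV_chain2[OF der\<Phi>]) (use that in \<open>auto intro!: derivative_eq_intros\<close>)
    from DERIV_cmult[OF this, of "(-1) ^ i"]
    have "(Df i has_real_derivative Df (Suc i) t) (at t)" by (simp add: Df_def[abs_def])
    then show ?thesis
      by (simp add: has_real_derivative_iff_has_vector_derivative has_vector_derivative_at_within)
  qed
  have f0: "Df 0 = f" by (auto simp: Df_def f_def)
  have "f 1 = (\<Sum>i<m. ((1 - 0) ^ i / fact i) *\<^sub>R Df i 0) + integral {0..1} I"
    unfolding I_def by (rule Taylor_integral[OF m f0 Df]) auto
  moreover have "f 1 = g x" by (simp add: f_def \<Phi>_def words_def)
  ultimately have gx: "g x = (\<Sum>i<m. Df i 0 / fact i) + integral {0..1} I" by simp
  have contI: "continuous_on {0..1} I"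
  proof -
    have "continuous_on {0..1} (\<lambda>\<tau>. ?P w (x + (1 - \<tau>) *\<^sub>R v))" if "w \<in> words m" for w
      by (rule continuous_on_compose2[OF cont]) (use that seg in \<open>auto simp: words_def intro!:
          continuous_intros\<close>)
    then show ?thesis unfolding I_def Df_def \<Phi>_def by (intro continuous_intros) auto
  qed
  have int: "I integrable_on {0..1}" "(\<lambda>\<tau>. \<bar>I \<tau>\<bar>) integrable_on {0..1}"
    by (intro integrable_continuous_interval continuous_intros contI)+
  have "ennreal \<bar>integral {0..1} I\<bar> \<le> ennreal (integral {0..1} (\<lambda>\<tau>. \<bar>I \<tau>\<bar>))"
    using integral_norm_bound_integral[OF int] by (intro ennreal_leI) auto
  also have "\<dots> = (\<integral>\<^sup>+ \<tau>. ennreal (indicator {0..1} \<tau> * \<bar>I \<tau>\<bar>) \<partial>lborel)"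
    using nn_integral_has_integral_lebesgue[OF _ integrable_integral[OF int(2)]] by simp
  \<comment> \<open>Substituting 1 - s makes the parameter measure the position along the ray from
    the vertex \<open>x\<close>.\<close>
  also have "\<dots> = (\<integral>\<^sup>+ s. ennreal (indicator {0..1} (1 - s) * \<bar>I (1 - s)\<bar>) \<partial>lborel)"
  proof -
    have "(\<lambda>\<tau>. indicator {0..1} \<tau> *\<^sub>R \<bar>I \<tau>\<bar>) \<in> borel_measurable borel"
      using borel_measurable_continuous_on_indicator[OF _ continuous_on_rabs[OF contI]] by simp
    then show ?thesis
      using nn_integral_real_affine[of "\<lambda>\<tau>. ennreal (indicator {0..1} \<tau> * \<bar>I \<tau>\<bar>)" "-1" 1] by simp
  qed
  also have "\<dots> \<le> (\<integral>\<^sup>+ s. (\<Sum>w\<in>words m. ennreal (D ^ m / fact (m - 1)) *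
       (indicator {0<..1} s * ennreal (s ^ (m - 1)) * ennreal \<bar>?P w (x + s *\<^sub>R v)\<bar>)) \<partial>lborel)"
  proof (rule nn_integral_mono_AE)
    \<comment> \<open>The end point s = 0 counts on the left but not on the right; it is a null
      set.\<close>
    have "AE s in lborel. s \<noteq> (0::real)" by (rule AE_lborel_singleton)
    then show "AE s in lborel. ennreal (indicator {0..1} (1 - s) * \<bar>I (1 - s)\<bar>) \<le>
      (\<Sum>w\<in>words m. ennreal (D ^ m / fact (m - 1)) *
       (indicator {0<..1} s * ennreal (s ^ (m - 1)) * ennreal \<bar>?P w (x + s *\<^sub>R v)\<bar>))"
    proof eventually_elim
      case (elim s)
      show ?case
      proof (cases "s \<in> {0<..1}")
        case True
        have "ennreal (indicator {0..1} (1 - s) * \<bar>I (1 - s)\<bar>) = ennreal (s ^ (m - 1) / fact (m -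
            1)) * ennreal \<bar>\<Phi> m s\<bar>"
          using True by (simp add: I_def Df_def abs_mult power_abs flip: ennreal_mult)
        also have "\<dots> \<le> ennreal (s ^ (m - 1) / fact (m - 1)) * (\<Sum>w\<in>words m. ennreal (D ^ m) * ennreal
            \<bar>?P w (x + s *\<^sub>R v)\<bar>)"
          by (intro mult_left_mono \<Phi>_le) auto
        also have "\<dots> = (\<Sum>w\<in>words m. ennreal (D ^ m / fact (m - 1)) *
           (indicator {0<..1} s * ennreal (s ^ (m - 1)) * ennreal \<bar>?P w (x + s *\<^sub>R v)\<bar>))"
          unfolding sum_distrib_left using True D0
          by (intro sum.cong refl) (simp add: mult_ac flip: ennreal_mult)
        finally show ?thesis .
      qed (use elim in \<open>auto simp: indicator_def\<close>)
    qed
  qed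
  also have "\<dots> = (\<Sum>w\<in>words m. ennreal (D ^ m / fact (m - 1)) *
       (\<integral>\<^sup>+ s. indicator {0<..1} s * ennreal (s ^ (m - 1)) * ennreal \<bar>?P w (x + s *\<^sub>R v)\<bar> \<partial>lborel))"
  proof -
    have "(\<lambda>s. indicator {0<..1} s * ennreal (s ^ (m - 1)) * ennreal \<bar>?P w (x + s *\<^sub>R v)\<bar>) \<in>
        borel_measurable borel"
      if w: "w \<in> words m" for w
    proof -
      have "continuous_on {0<..1} (\<lambda>s. \<bar>?P w (x + s *\<^sub>R v)\<bar>)"
        by (intro continuous_intros continuous_on_compose2[OF cont]) (use w seg in \<open>auto simp: words_def\<close>)
      from borel_measurable_continuous_on_indicator[OF _ this]
      have [measurable]: "(\<lambda>s. indicator {0<..1} s *\<^sub>R \<bar>?P w (x + s *\<^sub>R v)\<bar>) \<in> borel_measurable borel" by simp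
      have "(\<lambda>s. indicator {0<..1} s * ennreal (s ^ (m - 1)) * ennreal \<bar>?P w (x + s *\<^sub>R v)\<bar>) =
          (\<lambda>s. ennreal (s ^ (m - 1)) * ennreal (indicator {0<..1} s *\<^sub>R \<bar>?P w (x + s *\<^sub>R v)\<bar>))"
        by (intro ext) (auto simp: indicator_def)
      then show ?thesis by (simp only:) measurable
    qed
    then show ?thesis by (subst nn_integral_sum) (auto simp: nn_integral_cmult)
  qed
  finally have rem: "ennreal \<bar>integral {0..1} I\<bar> \<le> (\<Sum>w\<in>words m. ennreal (D ^ m / fact (m - 1)) *
       (\<integral>\<^sup>+ s. indicator {0<..1} s * ennreal (s ^ (m - 1)) * ennreal \<bar>?P w (x + s *\<^sub>R v)\<bar> \<partial>lborel))" .
  have "ennreal \<bar>\<Sum>i<m. Df i 0 / fact i\<bar> \<le> ennreal (\<Sum>i<m. \<bar>Df i 0\<bar> / fact i)"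
    by (intro ennreal_leI order_trans[OF sum_abs] sum_mono) auto
  also have "\<dots> = (\<Sum>i<m. ennreal (1 / fact i) * ennreal \<bar>\<Phi> i 1\<bar>)"
    by (subst sum_ennreal[symmetric])
       (auto simp: Df_def abs_mult power_abs simp flip: ennreal_mult intro!: sum.cong)
  also have "\<dots> \<le> (\<Sum>i<m. ennreal (1 / fact i) * (\<Sum>w\<in>words i. ennreal (D ^ i) * ennreal \<bar>?P w (x + 1 *\<^sub>R v)\<bar>))"
    by (intro sum_mono mult_left_mono \<Phi>_le) auto
  also have "\<dots> = (\<Sum>i<m. \<Sum>w\<in>words i. ennreal (D ^ i / fact i) * ennreal \<bar>?P w (x + v)\<bar>)"
    unfolding sum_distrib_left using D0
    by (intro sum.cong refl) (simp add: mult.assoc[symmetric] flip: ennreal_mult)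
  finally have "ennreal \<bar>\<Sum>i<m. Df i 0 / fact i\<bar> \<le> (\<Sum>i<m. \<Sum>w\<in>words i. ennreal (D ^ i / fact i) *
      ennreal \<bar>?P w (x + v)\<bar>)" .
  moreover have "ennreal \<bar>g x\<bar> \<le> ennreal \<bar>\<Sum>i<m. Df i 0 / fact i\<bar> + ennreal \<bar>integral {0..1} I\<bar>"
    unfolding gx by (simp add: ennreal_leI[OF abs_triangle_ineq] flip: ennreal_plus)
  ultimately show ?thesis using rem by (meson add_mono order_trans)
qed

section \<open>Averaging over dilated cones\<close>

lemma nn_integral_scale:
  fixes H :: "'a::euclidean_space \<Rightarrow> ennreal"
  assumes "H \<in> borel_measurable borel" "t > 0"
  shows "(\<integral>\<^sup>+ y. H y \<partial>lborel) = ennreal (t ^ DIM('a)) * (\<integral>\<^sup>+ v. H (x + t *\<^sub>R v) \<partial>lborel)"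
proof -
  have "(\<integral>\<^sup>+ y. H y \<partial>lborel) =
      (\<integral>\<^sup>+ y. H y \<partial>density (distr lborel borel (\<lambda>v. x + t *\<^sub>R v)) (\<lambda>_. ennreal (\<bar>t\<bar> ^ DIM('a))))"
    using lborel_affine[of t x] assms(2) by simp
  also have "\<dots> = ennreal (t ^ DIM('a)) * (\<integral>\<^sup>+ v. H (x + t *\<^sub>R v) \<partial>lborel)"
    using assms by (simp add: nn_integral_density nn_integral_distr nn_integral_cmult)
  finally show ?thesis .
qed

text \<open>The weights in the arithmetic-geometric mean inequality are chosen such that both of its terms
  scale like \<open>t\<close> to the power \<open>-d/2\<close> under the dilation by \<open>t\<close>.\<close>

lemma dilated_integral_bound:
  fixes G :: "real ^ 'd \<Rightarrow> real"
  assumes [measurable]: "G \<in> borel_measurable borel" "K \<in> sets borel"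
    and G0: "\<And>y. G y \<ge> 0" and t: "t > 0" and K: "emeasure lborel K = ennreal \<mu>" "\<mu> \<ge> 0"
    and G2: "(\<integral>\<^sup>+ y. ennreal ((G y)\<^sup>2) \<partial>lborel) \<le> 1"
  shows "(\<integral>\<^sup>+ v. indicator K v * ennreal (G (x + t *\<^sub>R v)) \<partial>lborel) \<le>
    ennreal (t powr (- (real CARD('d) / 2)) * (\<mu> + 1) / 2)"
proof -
  define a where "a = t powr (- (real CARD('d) / 2))"
  have a: "a > 0" using t by (simp add: a_def)
  have "a * a = t powr (- (real CARD('d) / 2) + - (real CARD('d) / 2))"
    unfolding a_def by (rule powr_add[symmetric])
  also have "\<dots> = inverse (t ^ CARD('d))" using t by (simp add: powr_minus powr_realpow)
  finally have aa: "a * a * t ^ CARD('d) = 1" using t by simp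
  let ?I = "\<integral>\<^sup>+ v. ennreal ((G (x + t *\<^sub>R v))\<^sup>2) \<partial>lborel"
  have "ennreal (t ^ CARD('d)) * ?I \<le> 1"
    using nn_integral_scale[of "\<lambda>y. ennreal ((G y)\<^sup>2)" t x] G2 t by simp
  then have "ennreal (a * a) * (ennreal (t ^ CARD('d)) * ?I) \<le> ennreal (a * a) * 1"
    by (intro mult_left_mono) auto
  moreover have "ennreal (a * a) * (ennreal (t ^ CARD('d)) * ?I) = ?I"
    using a t aa by (simp add: mult.assoc[symmetric] flip: ennreal_mult)
  ultimately have I: "?I \<le> ennreal (a * a)" by simp
  have le: "G y \<le> a / 2 + (G y)\<^sup>2 / (2 * a)" for y
  proof -
    have "0 \<le> (G y - a)\<^sup>2 / (2 * a)" using a by simp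
    also have "\<dots> = a / 2 + (G y)\<^sup>2 / (2 * a) - G y"
      using a by (simp add: power2_eq_square field_simps)
    finally show ?thesis by simp
  qed
  have "(\<integral>\<^sup>+ v. indicator K v * ennreal (G (x + t *\<^sub>R v)) \<partial>lborel) \<le>
      (\<integral>\<^sup>+ v. ennreal (a / 2) * indicator K v + ennreal (1 / (2 * a)) * ennreal ((G (x + t *\<^sub>R v))\<^sup>2) \<partial>lborel)"
  proof (rule nn_integral_mono)
    fix v
    have "ennreal (G (x + t *\<^sub>R v)) \<le> ennreal (a / 2 + (G (x + t *\<^sub>R v))\<^sup>2 / (2 * a))"
      by (rule ennreal_leI[OF le])
    also have "\<dots> = ennreal (a / 2) + ennreal (1 / (2 * a)) * ennreal ((G (x + t *\<^sub>R v))\<^sup>2)"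
      using a by (simp flip: ennreal_mult ennreal_plus)
    finally show "indicator K v * ennreal (G (x + t *\<^sub>R v)) \<le>
        ennreal (a / 2) * indicator K v + ennreal (1 / (2 * a)) * ennreal ((G (x + t *\<^sub>R v))\<^sup>2)"
      by (auto simp: indicator_def)
  qed
  also have "\<dots> = ennreal (a / 2) * emeasure lborel K + ennreal (1 / (2 * a)) * ?I"
    by (simp add: nn_integral_add nn_integral_cmult)
  also have "\<dots> \<le> ennreal (a / 2) * ennreal \<mu> + ennreal (1 / (2 * a)) * ennreal (a * a)"
    unfolding K by (intro add_left_mono mult_left_mono I) auto
  also have "\<dots> = ennreal (a * (\<mu> + 1) / 2)"
    using a K by (simp add: field_simps flip: ennreal_mult ennreal_plus)
  finally show ?thesis by (simp add: a_def)
qed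

text \<open>The factor 1 / 2 of the lower-order part comes from
  \<open>dilated_integral_bound\<close> at t = 1. In the remainder part it is cancelled by the
  integral of s ^ (-1/2) over the unit interval, which is 2.\<close>

definition sobolev_const :: "'d::finite itself \<Rightarrow> real \<Rightarrow> nat \<Rightarrow> real" where
  "sobolev_const _ D m = (\<Sum>i<m. \<Sum>w\<in>(words i :: 'd list set). D ^ i / fact i) / 2 +
    (\<Sum>w\<in>(words m :: 'd list set). D ^ m / fact (m - 1))"

text \<open>The exponent -1/2 is the worst case of m - 1 - d/2 for integers with 2 m > d.\<close>

lemma nn_integral_powr_minus_half:
  "(\<integral>\<^sup>+ s. indicator {0<..1} s * ennreal (s powr (- (1 / 2))) \<partial>lborel) \<le> 2"
proof -
  have "(\<integral>\<^sup>+ s. indicator {0<..1} s * ennreal (s powr (- (1 / 2))) \<partial>lborel) \<le>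
      (\<integral>\<^sup>+ s. ennreal (indicator {0..1} s * s powr (- (1 / 2))) \<partial>lborel)"
    by (intro nn_integral_mono) (auto simp: indicator_def)
  also have "\<dots> = ennreal (1 powr (- (1 / 2) + 1) / (- (1 / 2) + 1))"
    by (rule nn_integral_has_integral_lebesgue[OF _ has_integral_powr_from_0]) auto
  finally show ?thesis by simp
qed

text \<open>Taylor's bound is integrated over all \<open>v\<close> in the cone. For fixed
  \<open>s\<close>, Tonelli leaves an integral over the cone dilated by \<open>s\<close>, at most a
  multiple of s ^ (-d/2); together with \<open>s ^ (m - 1)\<close> this is integrable at 0 because 2
  m > d.\<close>

lemma sobolev_cone_bound:
  fixes g :: "real ^ 'd \<Rightarrow> real"
  assumes \<Theta>: "open \<Theta>" and g: "g \<in> C_k m \<Theta>" and m: "2 * m > CARD('d)"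
    and cone: "is_finite_cone x C" and C: "C \<subseteq> \<Theta>" "x \<in> \<Theta>" "\<And>y. y \<in> C \<Longrightarrow> norm (y - x) \<le> D"
    and \<mu>: "emeasure lborel C = ennreal \<mu>" "\<mu> \<ge> 0" and D: "D \<ge> 0"
    and L2: "\<And>w. length w \<le> m \<Longrightarrow>
      (\<integral>\<^sup>+ y. ennreal (indicator \<Theta> y * (iter_partial (map coord_dir w) g y)\<^sup>2) \<partial>lborel) \<le> 1"
  shows "\<bar>g x\<bar> * \<mu> \<le> sobolev_const TYPE('d) D m * (\<mu> + 1)"
proof -
  have m0: "m > 0" using m by (cases m) auto
  \<comment> \<open>The cone is moved to the origin, so that dilating \<open>v\<close> means moving
    along a ray.\<close>
  define K where "K = {v. x + v \<in> C}"
  define G where "G w y = indicator \<Theta> y * \<bar>iter_partial (map coord_dir w) g y\<bar>" for w y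
  have oC: "open C" and star: "\<And>y t. y \<in> C \<Longrightarrow> 0 < t \<Longrightarrow> t \<le> 1 \<Longrightarrow> x + t *\<^sub>R (y - x) \<in> C"
    using finite_cone_properties[OF cone] by blast+
  have C_borel [measurable]: "C \<in> sets borel" using oC by simp
  have K [measurable]: "K \<in> sets borel" unfolding K_def by measurable
  have eK: "emeasure lborel K = ennreal \<mu>"
  proof -
    have "emeasure lborel C = (\<integral>\<^sup>+ y. indicator C y \<partial>lborel)" by simp
    also have "\<dots> = (\<integral>\<^sup>+ v. indicator C (x + 1 *\<^sub>R v) \<partial>lborel)"
      by (subst nn_integral_scale[of _ 1 x]) simp_all
    also have "\<dots> = (\<integral>\<^sup>+ v. indicator K v \<partial>lborel)"
      by (intro nn_integral_cong) (auto simp: indicator_def K_def)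
    finally show ?thesis using \<mu> by simp
  qed
  have seg: "x + t *\<^sub>R v \<in> \<Theta>" if "v \<in> K" "0 \<le> t" "t \<le> 1" for v t
    using star[of "x + v" t] that C(1,2) by (cases "t = 0") (auto simp: K_def)
  have Gm [measurable]: "G w \<in> borel_measurable borel" if "length w \<le> m" for w
  proof -
    have "continuous_on \<Theta> (\<lambda>y. \<bar>iter_partial (map coord_dir w) g y\<bar>)"
      using g that by (intro continuous_intros) (auto simp: C_k_def)
    from borel_measurable_continuous_on_indicator[OF _ this] \<Theta>
    show ?thesis by (simp add: G_def[abs_def])
  qed
  have Gb: "(\<integral>\<^sup>+ v. indicator K v * ennreal (G w (x + t *\<^sub>R v)) \<partial>lborel) \<le>
      ennreal (t powr (- (real CARD('d) / 2)) * (\<mu> + 1) / 2)" if "length w \<le> m" "t > 0" for w t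
  proof (rule dilated_integral_bound[OF Gm[OF that(1)] K _ that(2) eK \<mu>(2)])
    have "(G w y)\<^sup>2 = indicator \<Theta> y * (iter_partial (map coord_dir w) g y)\<^sup>2" for y
      by (simp add: G_def power_mult_distrib indicator_def)
    then show "(\<integral>\<^sup>+ y. ennreal ((G w y)\<^sup>2) \<partial>lborel) \<le> 1" using L2[OF that(1)] by simp
  qed (simp add: G_def)
  let ?A = "\<lambda>v. \<Sum>i<m. \<Sum>w\<in>words i. ennreal (D ^ i / fact i) * (indicator K v * ennreal (G w (x + 1 *\<^sub>R v)))"
  let ?h = "\<lambda>s. indicator {0<..1} s * ennreal (s ^ (m - 1))"
  let ?B = "\<lambda>v. \<Sum>w\<in>words m. ennreal (D ^ m / fact (m - 1)) *
      (\<integral>\<^sup>+ s. ?h s * (indicator K v * ennreal (G w (x + s *\<^sub>R v))) \<partial>lborel)"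
  have ptw: "ennreal \<bar>g x\<bar> * indicator K v \<le> ?A v + ?B v" for v
  proof (cases "v \<in> K")
    case True
    have vD: "\<bar>v $ i\<bar> \<le> D" for i
      using C(3)[of "x + v"] True component_le_norm_cart[of v i] by (simp add: K_def)
    have "ennreal \<bar>g x\<bar> \<le>
      (\<Sum>i<m. \<Sum>w\<in>words i. ennreal (D ^ i / fact i) * ennreal \<bar>iter_partial (map coord_dir w) g (x + v)\<bar>) +
      (\<Sum>w\<in>words m. ennreal (D ^ m / fact (m - 1)) *
       (\<integral>\<^sup>+ s. indicator {0<..1} s * ennreal (s ^ (m - 1)) * ennreal \<bar>iter_partial (map coord_dir w)
           g (x + s *\<^sub>R v)\<bar> \<partial>lborel))"
      by (rule Taylor_ray_bound[OF \<Theta> g m0 seg[OF True] vD])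
    also have "(\<Sum>i<m. \<Sum>w\<in>words i. ennreal (D ^ i / fact i) * ennreal \<bar>iter_partial (map coord_dir w)
        g (x + v)\<bar>) = ?A v"
      using seg[OF True, of 1] True by (intro sum.cong refl) (simp add: G_def)
    also have "(\<Sum>w\<in>words m. ennreal (D ^ m / fact (m - 1)) *
       (\<integral>\<^sup>+ s. indicator {0<..1} s * ennreal (s ^ (m - 1)) * ennreal \<bar>iter_partial (map coord_dir w)
           g (x + s *\<^sub>R v)\<bar> \<partial>lborel)) = ?B v"
    proof (rule sum.cong[OF refl], rule arg_cong2[of _ _ _ _ "(*)", OF refl nn_integral_cong])
      fix w :: "'d list" and s :: real
      show "indicator {0<..1} s * ennreal (s ^ (m - 1)) * ennreal \<bar>iter_partial (map coord_dir w) g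
          (x + s *\<^sub>R v)\<bar> =
          ?h s * (indicator K v * ennreal (G w (x + s *\<^sub>R v)))"
        using seg[OF True, of s] True by (cases "s \<in> {0<..1}") (simp_all add: G_def)
    qed
    finally show ?thesis using True by simp
  qed simp
  have pair_meas: "(\<lambda>(v, s). ?h s * (indicator K v * ennreal (G w (x + s *\<^sub>R v)))) \<in>
      borel_measurable (lborel \<Otimes>\<^sub>M lborel)"
    if "w \<in> words m" for w
  proof -
    have [measurable]: "G w \<in> borel_measurable borel" using Gm that by (simp add: words_def)
    show ?thesis by measurable
  qed
  have B_meas: "(\<lambda>v. \<integral>\<^sup>+ s. ?h s * (indicator K v * ennreal (G w (x + s *\<^sub>R v))) \<partial>lborel) \<in>
      borel_measurable borel"
    if "w \<in> words m" for w
    using lborel.borel_measurable_nn_integral[OF pair_meas[OF that]] by simp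
  have Fub: "(\<integral>\<^sup>+ v. \<integral>\<^sup>+ s. ?h s * (indicator K v * ennreal (G w (x + s *\<^sub>R v))) \<partial>lborel \<partial>lborel) \<le>
      ennreal (\<mu> + 1)"
    if w: "w \<in> words m" for w
  proof -
    have [measurable]: "G w \<in> borel_measurable borel" using Gm w by (simp add: words_def)
    have "(\<integral>\<^sup>+ v. \<integral>\<^sup>+ s. ?h s * (indicator K v * ennreal (G w (x + s *\<^sub>R v))) \<partial>lborel \<partial>lborel) =
        (\<integral>\<^sup>+ s. \<integral>\<^sup>+ v. ?h s * (indicator K v * ennreal (G w (x + s *\<^sub>R v))) \<partial>lborel \<partial>lborel)"
      using lborel_pair.Fubini'[OF pair_meas[OF w]] by simp
    also have "\<dots> = (\<integral>\<^sup>+ s. ?h s * (\<integral>\<^sup>+ v. indicator K v * ennreal (G w (x + s *\<^sub>R v)) \<partial>lborel) \<partial>lborel)"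
      by (intro nn_integral_cong nn_integral_cmult) measurable
    also have "\<dots> \<le> (\<integral>\<^sup>+ s. ennreal ((\<mu> + 1) / 2) * (indicator {0<..1} s * ennreal (s powr (- (1 /
        2)))) \<partial>lborel)"
    proof (rule nn_integral_mono)
      fix s :: real
      show "?h s * (\<integral>\<^sup>+ v. indicator K v * ennreal (G w (x + s *\<^sub>R v)) \<partial>lborel) \<le>
          ennreal ((\<mu> + 1) / 2) * (indicator {0<..1} s * ennreal (s powr (- (1 / 2))))"
      proof (cases "s \<in> {0<..1}")
        case True
        then have s: "0 < s" "s \<le> 1" by auto
        have "s ^ (m - 1) * s powr (- (real CARD('d) / 2)) = s powr (real (m - 1) - real CARD('d) / 2)"
          using s by (simp add: powr_realpow[symmetric] powr_add[symmetric])
        \<comment> \<open>For integers 2 m > d means 2 m \<ge> d + 1, that is m - 1 - d/2 \<ge>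
          -1/2, and \<open>s\<close> is at most 1.\<close>
        also have "\<dots> \<le> s powr (- (1 / 2))"
          using s m m0 by (intro powr_mono') (auto simp: of_nat_diff)
        finally have le: "s ^ (m - 1) * s powr (- (real CARD('d) / 2)) \<le> s powr (- (1 / 2))" .
        have "?h s * (\<integral>\<^sup>+ v. indicator K v * ennreal (G w (x + s *\<^sub>R v)) \<partial>lborel) \<le>
            ennreal (s ^ (m - 1)) * ennreal (s powr (- (real CARD('d) / 2)) * (\<mu> + 1) / 2)"
          using True Gb[of w s] w s by (auto simp: words_def intro!: mult_left_mono)
        also have "\<dots> = ennreal ((s ^ (m - 1) * s powr (- (real CARD('d) / 2))) * ((\<mu> + 1) / 2))"
          using s \<mu> by (simp add: mult.assoc flip: ennreal_mult)
        also have "\<dots> \<le> ennreal (s powr (- (1 / 2)) * ((\<mu> + 1) / 2))"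
          using \<mu> by (intro ennreal_leI mult_right_mono le) auto
        also have "\<dots> = ennreal ((\<mu> + 1) / 2) * (indicator {0<..1} s * ennreal (s powr (- (1 / 2))))"
          using True \<mu> by (simp add: mult.commute flip: ennreal_mult)
        finally show ?thesis .
      qed simp
    qed
    also have "\<dots> = ennreal ((\<mu> + 1) / 2) * (\<integral>\<^sup>+ s. indicator {0<..1} s * ennreal (s powr (- (1 / 2))) \<partial>lborel)"
      by (rule nn_integral_cmult) measurable
    also have "\<dots> \<le> ennreal ((\<mu> + 1) / 2) * 2"
      by (intro mult_left_mono nn_integral_powr_minus_half) auto
    also have "\<dots> = ennreal ((\<mu> + 1) / 2 * 2)"
      by (subst ennreal_mult) (use \<mu>(2) in auto)
    also have "(\<mu> + 1) / 2 * 2 = \<mu> + 1" by simp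
    finally show ?thesis .
  qed
  have "ennreal (\<bar>g x\<bar> * \<mu>) = (\<integral>\<^sup>+ v. ennreal \<bar>g x\<bar> * indicator K v \<partial>lborel)"
    using \<mu>(2) by (simp add: nn_integral_cmult eK ennreal_mult)
  also have "\<dots> \<le> (\<integral>\<^sup>+ v. ?A v + ?B v \<partial>lborel)" by (intro nn_integral_mono ptw)
  also have "\<dots> = (\<integral>\<^sup>+ v. ?A v \<partial>lborel) + (\<integral>\<^sup>+ v. ?B v \<partial>lborel)"
    by (rule nn_integral_add) (use B_meas Gm in \<open>auto simp: words_def intro!: borel_measurable_sum
        borel_measurable_times_ennreal\<close>)
  also have "(\<integral>\<^sup>+ v. ?A v \<partial>lborel) = (\<Sum>i<m. \<Sum>w\<in>words i. ennreal (D ^ i / fact i) *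
      (\<integral>\<^sup>+ v. indicator K v * ennreal (G w (x + 1 *\<^sub>R v)) \<partial>lborel))"
  proof -
    have meas: "(\<lambda>v. indicator K v * ennreal (G w (x + 1 *\<^sub>R v))) \<in> borel_measurable lborel" if "i <
        m" "w \<in> words i" for i w
    proof -
      have [measurable]: "G w \<in> borel_measurable borel" using Gm that by (simp add: words_def)
      show ?thesis by measurable
    qed
    then show ?thesis
      by (subst nn_integral_sum, force intro!: borel_measurable_sum borel_measurable_times_ennreal)
         (intro sum.cong refl, subst nn_integral_sum, auto simp: nn_integral_cmult)
  qed
  also have "\<dots> \<le> (\<Sum>i<m. \<Sum>w\<in>(words i :: 'd list set). ennreal (D ^ i / fact i) * ennreal ((\<mu> + 1) / 2))"
    using Gb[of _ 1] by (intro sum_mono mult_left_mono) (auto simp: words_def)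
  also have "\<dots> = (\<Sum>i<m. \<Sum>w\<in>(words i :: 'd list set). ennreal (D ^ i / fact i * ((\<mu> + 1) / 2)))"
    using D \<mu>(2) by (intro sum.cong refl ennreal_mult[symmetric]) auto
  also have "\<dots> = ennreal (\<Sum>i<m. \<Sum>w\<in>(words i :: 'd list set). D ^ i / fact i * ((\<mu> + 1) / 2))"
    using D \<mu>(2) by (simp add: sum_nonneg del: sum_constant)
  also have "(\<Sum>i<m. \<Sum>w\<in>(words i :: 'd list set). D ^ i / fact i * ((\<mu> + 1) / 2)) =
      (\<Sum>i<m. \<Sum>w\<in>(words i :: 'd list set). D ^ i / fact i) * ((\<mu> + 1) / 2)"
    by (simp only: sum_distrib_right)
  also have "\<dots> = (\<Sum>i<m. \<Sum>w\<in>(words i :: 'd list set). D ^ i / fact i) / 2 * (\<mu> + 1)"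
    by (simp only: times_divide_eq_right times_divide_eq_left)
  also have "(\<integral>\<^sup>+ v. ?B v \<partial>lborel) = (\<Sum>w\<in>words m. ennreal (D ^ m / fact (m - 1)) *
      (\<integral>\<^sup>+ v. \<integral>\<^sup>+ s. ?h s * (indicator K v * ennreal (G w (x + s *\<^sub>R v))) \<partial>lborel \<partial>lborel))"
    using B_meas by (subst nn_integral_sum) (auto simp: nn_integral_cmult)
  also have "\<dots> \<le> (\<Sum>w\<in>(words m :: 'd list set). ennreal (D ^ m / fact (m - 1)) * ennreal (\<mu> + 1))"
    by (intro sum_mono mult_left_mono Fub) auto
  also have "\<dots> = (\<Sum>w\<in>(words m :: 'd list set). ennreal (D ^ m / fact (m - 1) * (\<mu> + 1)))"
    using D \<mu>(2) by (intro sum.cong refl ennreal_mult[symmetric]) auto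
  also have "\<dots> = ennreal (\<Sum>w\<in>(words m :: 'd list set). D ^ m / fact (m - 1) * (\<mu> + 1))"
    using D \<mu>(2) by (simp add: sum_nonneg del: sum_constant)
  also have "(\<Sum>w\<in>(words m :: 'd list set). D ^ m / fact (m - 1) * (\<mu> + 1)) =
      (\<Sum>w\<in>(words m :: 'd list set). D ^ m / fact (m - 1)) * (\<mu> + 1)"
    by (simp only: sum_distrib_right)
  finally have "ennreal (\<bar>g x\<bar> * \<mu>) \<le>
     ennreal ((\<Sum>i<m. \<Sum>w\<in>(words i :: 'd list set). D ^ i / fact i) / 2 * (\<mu> + 1)) +
     ennreal ((\<Sum>w\<in>(words m :: 'd list set). D ^ m / fact (m - 1)) * (\<mu> + 1))"
    by (meson add_mono order_trans order_refl)
  also have "\<dots> = ennreal (sobolev_const TYPE('d) D m * (\<mu> + 1))"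
    using D \<mu>(2) by (simp add: sobolev_const_def distrib_right sum_nonneg flip: ennreal_plus)
  finally have "ennreal (\<bar>g x\<bar> * \<mu>) \<le> ennreal (sobolev_const TYPE('d) D m * (\<mu> + 1))" .
  moreover have "0 \<le> sobolev_const TYPE('d) D m * (\<mu> + 1)"
    using D \<mu>(2) by (simp add: sobolev_const_def sum_nonneg)
  ultimately show ?thesis by (simp add: ennreal_le_iff)
qed

text \<open>Congruent cones contain balls of the same radius, so the volume of every cone is at
  least \<open>\<mu>0\<close> and the pointwise bound becomes independent of the vertex. Boundedness
  of \<Theta> limits the length of the rays by \<open>D\<close>.\<close>

theorem sobolev_embedding:
  fixes \<Theta> :: "(real ^ 'd) set"
  assumes \<Theta>: "open \<Theta>" "bounded \<Theta>" "cone_property \<Theta>" and m: "2 * m > CARD('d)"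
  obtains C where "C > 0" "\<And>g x. g \<in> C_k m \<Theta> \<Longrightarrow> x \<in> \<Theta> \<Longrightarrow>
    (\<And>w. length w \<le> m \<Longrightarrow>
      (\<integral>\<^sup>+ y. ennreal (indicator \<Theta> y * (iter_partial (map coord_dir w) g y)\<^sup>2) \<partial>lborel) \<le> 1) \<Longrightarrow> \<bar>g x\<bar> \<le> C"
proof -
  obtain x0 C0 where C0: "is_finite_cone x0 C0"
    and cones: "\<And>x. x \<in> \<Theta> \<Longrightarrow> \<exists>C. is_finite_cone x C \<and> C \<subseteq> \<Theta> \<and> congruent_sets C0 C"
    using \<Theta>(3) unfolding cone_property_def by blast
  obtain p r where pr: "r > 0" "ball p r \<subseteq> C0"
    using finite_cone_properties(1,2)[OF C0] openE by blast
  obtain R where R: "R > 0" "\<And>y. y \<in> \<Theta> \<Longrightarrow> norm y \<le> R"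
    using \<Theta>(2) by (auto simp: bounded_pos)
  define D where "D = 2 * R"
  define \<mu>0 where "\<mu>0 = measure lborel (ball (0 :: real ^ 'd) r)"
  have \<mu>0: "\<mu>0 > 0" unfolding \<mu>0_def using content_ball_pos[OF pr(1), of "0 :: real ^ 'd"] by simp
  let ?c = "sobolev_const TYPE('d) D m"
  have c: "?c \<ge> 0" using R by (simp add: sobolev_const_def D_def sum_nonneg)
  show ?thesis
  \<comment> \<open>The final summand 1 makes the constant positive even if the Sobolev constant
    were 0.\<close>
  proof (rule that[of "?c * (1 + 1 / \<mu>0) + 1"])
    show "?c * (1 + 1 / \<mu>0) + 1 > 0" using c \<mu>0 by (intro add_nonneg_pos mult_nonneg_nonneg) auto
    fix g :: "real ^ 'd \<Rightarrow> real" and x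
    assume g: "g \<in> C_k m \<Theta>" and x: "x \<in> \<Theta>"
      and L2: "\<And>w. length w \<le> m \<Longrightarrow>
        (\<integral>\<^sup>+ y. ennreal (indicator \<Theta> y * (iter_partial (map coord_dir w) g y)\<^sup>2) \<partial>lborel) \<le> 1"
    obtain C where C: "is_finite_cone x C" "C \<subseteq> \<Theta>" "congruent_sets C0 C" using cones[OF x] by blast
    obtain a T where T: "orthogonal_transformation T" "C = (\<lambda>v. a + T v) ` C0"
      using C(3) unfolding congruent_sets_def by blast
    have "ball (a + T p) r = (+) a ` T ` ball p r"
      unfolding image_orthogonal_transformation_ball[OF T(1)] by (rule ball_translation)
    then have sub: "ball (a + T p) r \<subseteq> C" unfolding T(2) using pr(2) by auto
    have bC: "bounded C" "open C" using C(2) \<Theta>(2) bounded_subset finite_cone_properties(1)[OF C(1)] by auto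
    have fin: "emeasure lborel C = ennreal (measure lborel C)"
      using emeasure_bounded_finite[OF bC(1)] by (intro emeasure_eq_ennreal_measure) auto
    have "\<mu>0 = measure lborel (ball (a + T p) r)"
      unfolding \<mu>0_def using content_ball_conv_unit_ball[of r "a + T p"]
          content_ball_conv_unit_ball[of r "0 :: real ^ 'd"] pr(1)
      by simp
    also have "\<dots> \<le> measure lborel C"
      using sub bC emeasure_bounded_finite[OF bC(1)] by (intro measure_mono_fmeasurable) (auto simp:
          fmeasurable_def)
    finally have le: "\<mu>0 \<le> measure lborel C" .
    have "\<bar>g x\<bar> * measure lborel C \<le> ?c * (measure lborel C + 1)"
    proof (rule sobolev_cone_bound[OF \<Theta>(1) g m C(1,2) x _ fin _ _ L2])
      fix y assume "y \<in> C"
      then show "norm (y - x) \<le> D"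
        using R(2)[OF x] R(2)[of y] C(2) norm_triangle_ineq4[of y x] by (auto simp: D_def)
    qed (use R in \<open>auto simp: D_def\<close>)
    then have "\<bar>g x\<bar> \<le> ?c * (1 + 1 / measure lborel C)"
      using le \<mu>0 by (simp add: field_simps)
    also have "\<dots> \<le> ?c * (1 + 1 / \<mu>0)"
      using le \<mu>0 c by (intro mult_left_mono add_left_mono divide_left_mono) auto
    finally show "\<bar>g x\<bar> \<le> ?c * (1 + 1 / \<mu>0) + 1" by simp
  qed
qed

section \<open>Positive definiteness of the derivative kernel\<close>

text \<open>A list of weighted points is a finitely supported signed measure, possibly with repeated
  points, and \<open>ev\<close> integrates against it.\<close>

definition ev :: "(real \<times> 'a) list \<Rightarrow> ('a \<Rightarrow> real) \<Rightarrow> real" where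
  "ev l f = (\<Sum>(c, p)\<leftarrow>l. c * f p)"

text \<open>The signed measure behind \<open>fdiff\<close>: it displays a difference quotient as a
  finite combination of point values, the form to which positive definiteness of \<open>h\<close>
  speaks.\<close>

primrec fd_list :: "real \<Rightarrow> 'a::real_normed_vector list \<Rightarrow> 'a \<Rightarrow> (real \<times> 'a) list" where
  "fd_list t [] x = [(1, x)]"
| "fd_list t (b # bs) x = map (\<lambda>(c, p). (c / t, p)) (fd_list t bs (x + t *\<^sub>R b)) @
     map (\<lambda>(c, p). (- c / t, p)) (fd_list t bs x)"

lemma ev_append: "ev (l @ l') f = ev l f + ev l' f"
  by (simp add: ev_def)

lemma ev_scale: "ev (map (\<lambda>(c, p). (s * c, p)) l) f = s * ev l f"
  by (induction l) (auto simp: ev_def algebra_simps)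

lemma ev_divide:
  "ev (map (\<lambda>(c, p). (c / t, p)) l) f = ev l f / t"
  "ev (map (\<lambda>(c, p). (- c / t, p)) l) f = - (ev l f / t)"
  by (induction l) (auto simp: ev_def add_divide_distrib)

lemma fdiff_eq_ev: "fdiff t bs f x = ev (fd_list t bs x) f"
proof (induction bs arbitrary: x)
  case (Cons b bs)
  show ?case
    by (simp only: fdiff_simps fd_list.simps ev_append ev_divide diff_quot_def Cons) (simp add:
        diff_divide_distrib)
qed (simp add: ev_def)

lemma fd_list_near:
  "(c, p) \<in> set (fd_list t bs x) \<Longrightarrow> norm (p - x) \<le> \<bar>t\<bar> * sum_list (map norm bs)"
proof (induction bs arbitrary: x c p)
  case (Cons b bs)
  have nn: "0 \<le> \<bar>t\<bar> * norm b" by simp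
  from Cons.prems obtain c' where "(c', p) \<in> set (fd_list t bs (x + t *\<^sub>R b)) \<or> (c', p) \<in> set (fd_list t bs x)"
    by auto
  then show ?case
  proof
    assume "(c', p) \<in> set (fd_list t bs (x + t *\<^sub>R b))"
    from Cons.IH[OF this] have "norm (p - (x + t *\<^sub>R b)) \<le> \<bar>t\<bar> * sum_list (map norm bs)" .
    then show ?thesis using norm_triangle_ineq[of "p - (x + t *\<^sub>R b)" "t *\<^sub>R b"] by (simp add: algebra_simps)
  next
    assume "(c', p) \<in> set (fd_list t bs x)"
    from Cons.IH[OF this] nn show ?thesis unfolding list.map sum_list.Cons distrib_left by linarith
  qed
qed simp

lemma fdiff_sum:
  "fdiff t bs (\<lambda>p. \<Sum>v\<in>V. F v * g v p) x = (\<Sum>v\<in>V. F v * fdiff t bs (g v) x)"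
proof (induction bs arbitrary: x)
  case (Cons b bs)
  then show ?case
    by (simp add: diff_quot_def sum_subtractf[symmetric] sum_divide_distrib right_diff_distrib)
qed simp

text \<open>Difference quotients in the two variables act independently, so a mixed one is a double
  pairing of the kernel with two lists of weighted points.\<close>

lemma fdiff_prod:
  "fdiff t (map (\<lambda>b. (b, 0)) bs @ map (\<lambda>c. (0, c)) cs) F (x, y) =
    fdiff t bs (\<lambda>p. fdiff t cs (\<lambda>q. F (p, q)) y) x"
proof -
  have r: "fdiff t (map (\<lambda>c. (0, c)) cs) F (p, q) = fdiff t cs (\<lambda>q. F (p, q)) q" for p q
    by (induction cs arbitrary: q) (auto simp: diff_quot_def)
  have "fdiff t (map (\<lambda>b. (b, 0)) bs) G (p, q) = fdiff t bs (\<lambda>p. G (p, q)) p" for G :: "'a \<times> 'b \<Rightarrow> real" and p q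
    by (induction bs arbitrary: p) (auto simp: diff_quot_def)
  then show ?thesis by (simp add: fdiff_append r)
qed

lemma pos_def_kernel_ev:
  assumes "pos_def_kernel \<Theta> h" "\<And>c p. (c, p) \<in> set l \<Longrightarrow> p \<in> \<Theta>"
  shows "0 \<le> ev l (\<lambda>p. ev l (\<lambda>q. h (p, q)))"
proof -
  have ev: "ev l f = (\<Sum>i<length l. fst (l ! i) * f (snd (l ! i)))" for f
    unfolding ev_def by (simp add: sum_list_sum_nth atLeast0LessThan case_prod_beta')
  have "\<forall>i<length l. snd (l ! i) \<in> \<Theta>"
    using assms(2) by (metis nth_mem prod.collapse)
  then have "0 \<le> (\<Sum>i<length l. \<Sum>j<length l. fst (l ! i) * h (snd (l ! i), snd (l ! j)) * fst (l ! j))"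
    using assms(1)[unfolded pos_def_kernel_def, THEN conjunct2, rule_format,
        of "length l" "\<lambda>i. snd (l ! i)" "\<lambda>i. fst (l ! i)"] by simp
  also have "\<dots> = ev l (\<lambda>p. ev l (\<lambda>q. h (p, q)))"
    unfolding ev by (simp add: sum_distrib_left mult_ac)
  finally show ?thesis .
qed

lemma iter_partial_swap:
  "iter_partial (map prod.swap bs) (\<lambda>q. f (prod.swap q)) = (\<lambda>q. iter_partial bs f (prod.swap q))"
proof (induction bs)
  case (Cons b bs)
  have "partial_deriv (prod.swap b) (\<lambda>q. g (prod.swap q)) p = partial_deriv b g (prod.swap p)" for g p
    by (cases p; cases b) (simp add: partial_deriv_def)
  then show ?case by (simp add: Cons)
qed simp

lemma sum_delta2:
  assumes "finite U" "a \<in> U" "b \<in> U"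
  shows "(\<Sum>u\<in>U. \<Sum>v\<in>U. if a = u then if b = v then X u v else (0::real) else 0) = X a b"
proof -
  have "(\<Sum>v\<in>U. if a = u then if b = v then X u v else 0 else 0) = (if a = u then X u b else 0)" for u
    using assms by (cases "a = u") simp_all
  then show ?thesis using assms by simp
qed

section \<open>From non-negative finite sums to non-negative integral forms\<close>

context finite_measure
begin

lemma Fubini_quadratic:
  assumes "bdd_measurable (M \<Otimes>\<^sub>M M) K" "bdd_measurable M f" "bdd_measurable M g"
  shows "(\<integral>x. (\<integral>y. K (x, y) * f y \<partial>M) * g x \<partial>M) = (\<integral>p. K p * (g (fst p) * f (snd p)) \<partial>(M \<Otimes>\<^sub>M M))"
proof -
  have "bdd_measurable (M \<Otimes>\<^sub>M M) (\<lambda>p. K p * (g (fst p) * f (snd p)))"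
    by (intro bdd_measurable_mult assms bdd_measurable_compose[OF assms(2)]
        bdd_measurable_compose[OF assms(3)]) measurable
  from Fubini_bdd(1)[OF this]
  have "(\<integral>p. K p * (g (fst p) * f (snd p)) \<partial>(M \<Otimes>\<^sub>M M)) = (\<integral>x. \<integral>y. K (x, y) * (g x * f y) \<partial>M \<partial>M)" by simp
  also have "\<dots> = (\<integral>x. \<integral>y. (K (x, y) * f y) * g x \<partial>M \<partial>M)" by (simp only: mult_ac)
  finally show ?thesis by simp
qed

lemma integral_product_bdd:
  assumes "bdd_measurable M f" "bdd_measurable M g"
  shows "(\<integral>p. f (fst p) * g (snd p) \<partial>(M \<Otimes>\<^sub>M M)) = (\<integral>x. f x \<partial>M) * (\<integral>x. g x \<partial>M)"
proof -
  have "bdd_measurable (M \<Otimes>\<^sub>M M) (\<lambda>p. f (fst p) * g (snd p))"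
    by (intro bdd_measurable_mult bdd_measurable_compose[OF assms(1)] bdd_measurable_compose[OF
        assms(2)]) measurable
  from Fubini_bdd(1)[OF this] show ?thesis by simp
qed

text \<open>\<open>\<phi> n\<close> rounds points to a finite set. For the rounded kernel the form
  is a finite sum whose weights are the integrals of \<open>f\<close> over the cells, hence
  non-negative; dominated convergence removes the rounding.\<close>

lemma quadratic_form_nonneg:
  assumes K: "bdd_measurable (M \<Otimes>\<^sub>M M) K" and f: "bdd_measurable M f"
    and U: "\<And>n. finite (U n)" "\<And>n. U n \<subseteq> space M"
    and \<phi>: "\<And>n w. w \<in> space M \<Longrightarrow> \<phi> n w \<in> U n" "\<And>n u. {w \<in> space M. \<phi> n w = u} \<in> sets M"
    and pos: "\<And>V F. finite V \<Longrightarrow> V \<subseteq> space M \<Longrightarrow> 0 \<le> (\<Sum>u\<in>V. \<Sum>v\<in>V. F u * K (u, v) * F v)"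
    and lim: "\<And>w w'. w \<in> space M \<Longrightarrow> w' \<in> space M \<Longrightarrow> (\<lambda>n. K (\<phi> n w, \<phi> n w')) \<longlonglongrightarrow> K (w, w')"
  shows "0 \<le> (\<integral>p. K p * (f (fst p) * f (snd p)) \<partial>(M \<Otimes>\<^sub>M M))"
proof -
  interpret Q: finite_measure "M \<Otimes>\<^sub>M M" by (rule finite_measure_pair_measure) unfold_locales
  define g where "g n u w = f w * indicator {w \<in> space M. \<phi> n w = u} w" for n u w
  have g: "bdd_measurable M (g n u)" for n u
    unfolding g_def by (intro bdd_measurable_mult f bdd_measurableI[where c = 1]
        borel_measurable_indicator \<phi>(2))
      (auto simp: indicator_def)
  define S where "S n p = (\<Sum>u\<in>U n. \<Sum>v\<in>U n. K (u, v) * (g n u (fst p) * g n v (snd p)))" for n p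
  have gg: "bdd_measurable (M \<Otimes>\<^sub>M M) (\<lambda>p. g n u (fst p) * g n v (snd p))" for n u v
    by (intro bdd_measurable_mult bdd_measurable_compose[OF g]) measurable
  have S: "bdd_measurable (M \<Otimes>\<^sub>M M) (S n)" for n
    unfolding S_def by (intro bdd_measurable_sum bdd_measurable_cmult gg)
  have S_eq: "S n p = K (\<phi> n (fst p), \<phi> n (snd p)) * (f (fst p) * f (snd p))" if "p \<in> space (M \<Otimes>\<^sub>M M)" for n p
  proof -
    have p: "fst p \<in> space M" "snd p \<in> space M" using that by (auto simp: space_pair_measure)
    have "S n p = (\<Sum>u\<in>U n. \<Sum>v\<in>U n. if \<phi> n (fst p) = u then if \<phi> n (snd p) = v then
        K (u, v) * (f (fst p) * f (snd p)) else 0 else 0)"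
      unfolding S_def by (intro sum.cong refl) (use p in \<open>auto simp: g_def\<close>)
    also have "\<dots> = K (\<phi> n (fst p), \<phi> n (snd p)) * (f (fst p) * f (snd p))"
      by (rule sum_delta2[OF U(1) \<phi>(1)[OF p(1)] \<phi>(1)[OF p(2)]])
    finally show ?thesis .
  qed
  have S_pos: "0 \<le> (\<integral>p. S n p \<partial>(M \<Otimes>\<^sub>M M))" for n
  proof -
    have i: "integrable (M \<Otimes>\<^sub>M M) (\<lambda>p. K (u, v) * (g n u (fst p) * g n v (snd p)))" for u v
      by (intro Q.bdd_measurable_integrable bdd_measurable_cmult gg)
    have "(\<integral>p. S n p \<partial>(M \<Otimes>\<^sub>M M)) = (\<Sum>u\<in>U n. \<Sum>v\<in>U n. K (u, v) * (\<integral>p. g n u (fst p) * g n v (snd p) \<partial>(M \<Otimes>\<^sub>M M)))"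
      unfolding S_def
      by (subst Bochner_Integration.integral_sum, intro Bochner_Integration.integrable_sum i,
          intro sum.cong refl, subst Bochner_Integration.integral_sum, rule i, simp)
    also have "\<dots> = (\<Sum>u\<in>U n. \<Sum>v\<in>U n. (\<integral>w. g n u w \<partial>M) * K (u, v) * (\<integral>w. g n v w \<partial>M))"
      by (simp add: integral_product_bdd[OF g g] mult_ac)
    finally show ?thesis using pos[OF U(1)[of n] U(2)[of n], of "\<lambda>u. \<integral>w. g n u w \<partial>M"] by simp
  qed
  obtain B where B: "B \<ge> 0" "\<And>p. p \<in> space (M \<Otimes>\<^sub>M M) \<Longrightarrow> \<bar>K p\<bar> \<le> B" using bdd_measurable_bound[OF K] by blast
  obtain c where c: "c \<ge> 0" "\<And>x. x \<in> space M \<Longrightarrow> \<bar>f x\<bar> \<le> c" using bdd_measurable_bound[OF f] by blast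
  have "(\<lambda>n. \<integral>p. S n p \<partial>(M \<Otimes>\<^sub>M M)) \<longlonglongrightarrow> (\<integral>p. K p * (f (fst p) * f (snd p)) \<partial>(M \<Otimes>\<^sub>M M))"
  proof (rule integral_dominated_convergence)
    show "(\<lambda>p. K p * (f (fst p) * f (snd p))) \<in> borel_measurable (M \<Otimes>\<^sub>M M)"
      by (intro bdd_measurableD bdd_measurable_mult K bdd_measurable_compose[OF f]) measurable
    show "S n \<in> borel_measurable (M \<Otimes>\<^sub>M M)" for n by (rule bdd_measurableD[OF S])
    show "integrable (M \<Otimes>\<^sub>M M) (\<lambda>_. B * (c * c))" by simp
    show "AE p in M \<Otimes>\<^sub>M M. (\<lambda>n. S n p) \<longlonglongrightarrow> K p * (f (fst p) * f (snd p))"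
    proof (rule AE_I2)
      fix p assume p: "p \<in> space (M \<Otimes>\<^sub>M M)"
      then have "(\<lambda>n. K (\<phi> n (fst p), \<phi> n (snd p))) \<longlonglongrightarrow> K p" using lim by (auto simp: space_pair_measure)
      then show "(\<lambda>n. S n p) \<longlonglongrightarrow> K p * (f (fst p) * f (snd p))" unfolding S_eq[OF p] by (intro tendsto_intros)
    qed
    show "AE p in M \<Otimes>\<^sub>M M. norm (S n p) \<le> B * (c * c)" for n
    proof (rule AE_I2)
      fix p assume p: "p \<in> space (M \<Otimes>\<^sub>M M)"
      then have p': "fst p \<in> space M" "snd p \<in> space M" by (auto simp: space_pair_measure)
      have "(\<phi> n (fst p), \<phi> n (snd p)) \<in> space (M \<Otimes>\<^sub>M M)"
        using \<phi>(1)[OF p'(1)] \<phi>(1)[OF p'(2)] U(2) by (auto simp: space_pair_measure)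
      then show "norm (S n p) \<le> B * (c * c)"
        unfolding S_eq[OF p] using B c p' by (auto simp: abs_mult intro!: mult_mono)
    qed
  qed
  then show ?thesis by (rule LIMSEQ_le_const) (use S_pos in auto)
qed

end

text \<open>Rounding to the first listed centre within distance \<open>\<delta>\<close>, a selection
  that is measurable by construction. The default \<open>x\<close> does not occur at points covered
  by the balls.\<close>

primrec near :: "real \<Rightarrow> 'a::metric_space list \<Rightarrow> 'a \<Rightarrow> 'a" where
  "near \<delta> [] x = x"
| "near \<delta> (c # cs) x = (if dist x c < \<delta> then c else near \<delta> cs x)"

lemma near_in: "\<exists>c\<in>set cs. dist x c < \<delta> \<Longrightarrow> near \<delta> cs x \<in> set cs \<and> dist x (near \<delta> cs x) < \<delta>"
  by (induction cs) auto

lemma near_measurable [measurable]: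
  "near \<delta> (cs :: 'a::{metric_space, second_countable_topology} list) \<in> borel_measurable borel"
proof (induction cs)
  case (Cons c cs)
  note [measurable] = this
  show ?case by simp
qed simp

lemma bounded_finite_net:
  fixes S :: "'a::heine_borel set"
  assumes "bounded S" "\<delta> > 0"
  shows "\<exists>cs. set cs \<subseteq> S \<and> (\<forall>x\<in>S. \<exists>c\<in>set cs. dist x c < \<delta>)"
proof -
  have "compact (closure S)" using assms(1) by simp
  moreover have "closure S \<subseteq> (\<Union>c\<in>S. ball c \<delta>)"
    using assms(2) by (auto simp: closure_approachable)
  ultimately obtain D where D: "D \<subseteq> S" "finite D" "closure S \<subseteq> (\<Union>c\<in>D. ball c \<delta>)"
    using compactE_image[of "closure S" S "\<lambda>c. ball c \<delta>"] by auto
  obtain cs where "set cs = D" using finite_list D(2) by blast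
  moreover have "\<exists>c\<in>D. dist x c < \<delta>" if "x \<in> S" for x
    using D(3) that closure_subset by (force simp: dist_commute)
  ultimately show ?thesis using D(1) by blast
qed

section \<open>The derivative kernel on multi-indexed points\<close>

text \<open>The derivative orders controlled by \<open>C_kk_closure\<close>, as a predicate on words
  that is invariant under reordering.\<close>

definition admissible :: "nat \<Rightarrow> ('d + 'd) list \<Rightarrow> bool" where
  "admissible k ds \<longleftrightarrow> length (filter isl ds) \<le> k \<and> length (filter (\<lambda>d. \<not> isl d) ds) \<le> k"

lemma admissible_perm: "mset ds = mset es \<Longrightarrow> admissible k ds \<longleftrightarrow> admissible k es"
  unfolding admissible_def by (metis mset_filter size_mset)

lemma admissible_Inl_Inr:
  "admissible k (map Inl xs @ map Inr ys) \<longleftrightarrow> length xs \<le> k \<and> length ys \<le> k"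
  "admissible k (map Inr ys @ map Inl xs) \<longleftrightarrow> length xs \<le> k \<and> length ys \<le> k"
  by (auto simp: admissible_def filter_map comp_def)

lemma measurable_pair_index:
  assumes "countable A" "\<And>a b. a \<in> A \<Longrightarrow> b \<in> A \<Longrightarrow> (\<lambda>p. g ((a, fst p), (b, snd p))) \<in> borel_measurable (M \<Otimes>\<^sub>M M)"
  shows "g \<in> borel_measurable ((count_space A \<Otimes>\<^sub>M M) \<Otimes>\<^sub>M (count_space A \<Otimes>\<^sub>M M))" (is "_ \<in> borel_measurable ?N")
proof -
  have 1: "(\<lambda>p. g ((a, snd (fst p)), (b, snd (snd p)))) \<in> borel_measurable ?N" if "a \<in> A" "b \<in> A" for a b
    using measurable_compose[OF _ assms(2)[OF that], of "\<lambda>p. (snd (fst p), snd (snd p))" ?N] by simp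
  have 2: "(\<lambda>p. g ((a, snd (fst p)), (fst (snd p), snd (snd p)))) \<in> borel_measurable ?N" if "a \<in> A" for a
    by (rule measurable_compose_countable'[where f = "\<lambda>b p. g ((a, snd (fst p)), (b, snd (snd p)))"
          and g = "\<lambda>p. fst (snd p)" and I = A]) (use 1[OF that] assms(1) in simp_all)
  have "(\<lambda>p. g ((fst (fst p), snd (fst p)), (fst (snd p), snd (snd p)))) \<in> borel_measurable ?N"
    by (rule measurable_compose_countable'[where f = "\<lambda>a p. g ((a, snd (fst p)), (fst (snd p), snd (snd p)))"
          and g = "\<lambda>p. fst (fst p)" and I = A]) (use 2 assms(1) in simp_all)
  then show ?thesis by simp
qed

locale smooth_kernel =
  fixes \<Theta> :: "(real ^ 'd) set" and k :: nat and h :: "(real ^ 'd) \<times> (real ^ 'd) \<Rightarrow> real"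
  assumes \<Theta>: "open \<Theta>" "bounded \<Theta>" and h: "h \<in> C_kk_closure k \<Theta>" and pd: "pos_def_kernel \<Theta> h"
begin

definition A :: "(nat ^ 'd) set" where "A = {\<alpha>. mi_order \<alpha> \<le> k}"

definition L :: "(real ^ 'd) measure" where "L = restrict_space lborel \<Theta>"

definition N :: "((nat ^ 'd) \<times> (real ^ 'd)) measure" where "N = count_space A \<Otimes>\<^sub>M L"

definition H :: "((nat ^ 'd) \<times> (real ^ 'd)) \<times> ((nat ^ 'd) \<times> (real ^ 'd)) \<Rightarrow> real" where
  "H = (\<lambda>((\<alpha>, x), (\<beta>, y)). mixed_deriv \<alpha> \<beta> h (x, y))"

abbreviation kd :: "('d + 'd) list \<Rightarrow> (real ^ 'd) \<times> (real ^ 'd) \<Rightarrow> real" where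
  "kd ds \<equiv> iter_partial (map coord_dir2 ds) h"

lemma finite_A [simp]: "finite A" unfolding A_def by (rule finite_mi_order_le)

lemma zero_A [simp]: "0 \<in> A" by (simp add: A_def mi_order_def)

lemma len_A: "\<alpha> \<in> A \<longleftrightarrow> length (mi_dirs \<alpha>) \<le> k" by (simp add: A_def length_mi_dirs)

lemma space_L [simp]: "space L = \<Theta>" by (simp add: L_def space_restrict_space)

lemma space_N [simp]: "space N = A \<times> \<Theta>" by (simp add: N_def space_pair_measure)

lemma kd_regular:
  assumes "admissible k ds"
  shows "iter_partial_exists (\<Theta> \<times> \<Theta>) (map coord_dir2 ds) h"
    and "uniformly_continuous_on (\<Theta> \<times> \<Theta>) (kd ds)" and "continuous_on (\<Theta> \<times> \<Theta>) (kd ds)"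
proof -
  show *: "iter_partial_exists (\<Theta> \<times> \<Theta>) (map coord_dir2 ds) h" "uniformly_continuous_on (\<Theta> \<times> \<Theta>) (kd ds)"
    using h assms by (auto simp: C_kk_closure_def admissible_def)
  show "continuous_on (\<Theta> \<times> \<Theta>) (kd ds)" by (rule uniformly_continuous_imp_continuous[OF *(2)])
qed

lemma kd_perm:
  assumes "admissible k ds" "mset ds = mset es" "p \<in> \<Theta> \<times> \<Theta>"
  shows "kd ds p = kd es p"
proof -
  have "admissible k es" using assms(1,2) admissible_perm by blast
  then show ?thesis using assms \<Theta>(1)
    by (intro iter_partial_perm[of "\<Theta> \<times> \<Theta>"] kd_regular open_Times) (auto simp del: map_append)
qed

lemma kd_bounded:
  assumes "admissible k ds"
  obtains B where "B \<ge> 0" "\<And>x y. x \<in> \<Theta> \<Longrightarrow> y \<in> \<Theta> \<Longrightarrow> \<bar>kd ds (x, y)\<bar> \<le> B"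
proof -
  have "bounded (kd ds ` (\<Theta> \<times> \<Theta>))"
    by (rule bounded_uniformly_continuous_image[OF kd_regular(2)[OF assms] bounded_Times[OF \<Theta>(2,2)]])
  then obtain B where "B > 0" "\<forall>z\<in>kd ds ` (\<Theta> \<times> \<Theta>). norm z \<le> B" unfolding bounded_pos by blast
  then show ?thesis by (intro that[of B]) auto
qed

lemma mixed_deriv_eq_kd: "mixed_deriv \<alpha> \<beta> h = kd (map Inl (mi_dirs \<alpha>) @ map Inr (mi_dirs \<beta>))"
  by (simp add: mixed_deriv_def)

lemma H_eq: "H ((\<alpha>, x), (\<beta>, y)) = kd (map Inl (mi_dirs \<alpha>) @ map Inr (mi_dirs \<beta>)) (x, y)"
  by (simp add: H_def mixed_deriv_eq_kd)

lemma continuous_measurable_L: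
  assumes "continuous_on \<Theta> f" shows "f \<in> borel_measurable L"
proof -
  have "sets L = sets (restrict_space borel \<Theta>)" by (simp add: L_def sets_restrict_space)
  then show ?thesis using borel_measurable_continuous_on_restrict[OF assms] measurable_cong_sets by blast
qed

lemma continuous_measurable_LL:
  fixes f :: "(real ^ 'd) \<times> (real ^ 'd) \<Rightarrow> real"
  assumes "continuous_on (\<Theta> \<times> \<Theta>) f" shows "f \<in> borel_measurable (L \<Otimes>\<^sub>M L)"
proof -
  have id: "(\<lambda>x. x) \<in> measurable L borel" by (rule continuous_measurable_L) (rule continuous_on_id) 
  have [measurable]: "fst \<in> measurable (L \<Otimes>\<^sub>M L) borel" "snd \<in> measurable (L \<Otimes>\<^sub>M L) borel"
    using measurable_compose[OF measurable_fst id, of L] measurable_compose[OF measurable_snd id, of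
        L] by simp_all
  have "(\<lambda>p. (fst p, snd p)) \<in> measurable (L \<Otimes>\<^sub>M L) (borel :: ((real ^ 'd) \<times> (real ^ 'd)) measure)"
    unfolding borel_prod[symmetric] by measurable
  then have "(\<lambda>p. p) \<in> measurable (L \<Otimes>\<^sub>M L) (restrict_space borel (\<Theta> \<times> \<Theta>))"
    by (intro measurable_restrict_space2) (auto simp: space_pair_measure)
  from measurable_compose[OF this borel_measurable_continuous_on_restrict[OF assms]] show ?thesis .
qed

sublocale L: finite_measure L
proof
  have "emeasure L (space L) = emeasure lborel \<Theta>"
    unfolding space_L unfolding L_def using \<Theta>(1) by (subst emeasure_restrict_space) auto
  then show "emeasure L (space L) \<noteq> \<infinity>" using emeasure_bounded_finite[OF \<Theta>(2)] by simp
qed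

sublocale cA: finite_measure "count_space A" by (rule finite_measure_count_space) simp

sublocale AL: pair_sigma_finite "count_space A" L ..

sublocale N: finite_measure N
proof -
  interpret P: finite_measure "count_space A \<Otimes>\<^sub>M L" by (rule finite_measure_pair_measure) unfold_locales
  show "finite_measure N" unfolding N_def by unfold_locales
qed

sublocale NN: finite_measure "N \<Otimes>\<^sub>M N" by (rule finite_measure_pair_measure) unfold_locales

lemma bdd_measurable_N:
  assumes "\<And>\<alpha>. \<alpha> \<in> A \<Longrightarrow> bdd_measurable L (\<lambda>x. f (\<alpha>, x))"
  shows "bdd_measurable N f"
proof -
  obtain c where c: "\<And>\<alpha>. \<alpha> \<in> A \<Longrightarrow> \<forall>x\<in>\<Theta>. \<bar>f (\<alpha>, x)\<bar> \<le> c \<alpha>"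
    using assms unfolding bdd_measurable_def space_L by metis
  show ?thesis
  proof (rule bdd_measurableI[where c = "\<Sum>\<alpha>\<in>A. \<bar>c \<alpha>\<bar>"])
    show "f \<in> borel_measurable N" unfolding N_def
      by (rule measurable_pair_measure_countable1) (use assms in \<open>auto simp: countable_finite dest:
          bdd_measurableD\<close>)
    fix w assume "w \<in> space N"
    then obtain \<alpha> x where w: "w = (\<alpha>, x)" "\<alpha> \<in> A" "x \<in> \<Theta>" by auto
    then have "\<bar>f w\<bar> \<le> \<bar>c \<alpha>\<bar>" using c by force
    also have "\<dots> \<le> (\<Sum>\<alpha>\<in>A. \<bar>c \<alpha>\<bar>)" by (rule member_le_sum) (use w in auto)
    finally show "\<bar>f w\<bar> \<le> (\<Sum>\<alpha>\<in>A. \<bar>c \<alpha>\<bar>)" .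
  qed
qed

lemma bdd_measurable_N_section:
  assumes "bdd_measurable N f" "\<alpha> \<in> A" shows "bdd_measurable L (\<lambda>x. f (\<alpha>, x))"
  by (rule bdd_measurable_compose[OF assms(1)]) (use assms(2) in \<open>simp add: N_def\<close>)

lemma integral_N:
  assumes "bdd_measurable N f"
  shows "(\<integral>w. f w \<partial>N) = (\<Sum>\<alpha>\<in>A. \<integral>x. f (\<alpha>, x) \<partial>L)"
proof -
  have "(\<integral>w. f w \<partial>N) = (\<integral>\<alpha>. \<integral>x. f (\<alpha>, x) \<partial>L \<partial>count_space A)"
    using AL.integral_fst'[OF N.bdd_measurable_integrable[OF assms, unfolded N_def]] by (simp add: N_def)
  also have "\<dots> = (\<Sum>\<alpha>\<in>A. \<integral>x. f (\<alpha>, x) \<partial>L)" by (rule lebesgue_integral_count_space_finite) simp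
  finally show ?thesis .
qed

lemma H_bdd: "bdd_measurable (N \<Otimes>\<^sub>M N) H"
proof -
  have adm: "admissible k (map Inl (mi_dirs \<alpha>) @ map Inr (mi_dirs \<beta>))" if "\<alpha> \<in> A" "\<beta> \<in> A" for \<alpha> \<beta>
    using that by (simp add: admissible_Inl_Inr len_A)
  have "\<exists>c. \<forall>x\<in>\<Theta>. \<forall>y\<in>\<Theta>. \<bar>H ((\<alpha>, x), (\<beta>, y))\<bar> \<le> c" if "\<alpha> \<in> A" "\<beta> \<in> A" for \<alpha> \<beta>
    using kd_bounded[OF adm[OF that]] unfolding H_eq by metis
  then obtain c where c: "\<And>\<alpha> \<beta>. \<alpha> \<in> A \<Longrightarrow> \<beta> \<in> A \<Longrightarrow> \<forall>x\<in>\<Theta>. \<forall>y\<in>\<Theta>. \<bar>H ((\<alpha>, x), (\<beta>, y))\<bar> \<le> c \<alpha> \<beta>"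
    by metis
  show ?thesis
  proof (rule bdd_measurableI[where c = "\<Sum>\<alpha>\<in>A. \<Sum>\<beta>\<in>A. \<bar>c \<alpha> \<beta>\<bar>"])
    show "H \<in> borel_measurable (N \<Otimes>\<^sub>M N)"
      unfolding N_def
    proof (rule measurable_pair_index)
      fix \<alpha> \<beta> assume "\<alpha> \<in> A" "\<beta> \<in> A"
      from continuous_measurable_LL[OF kd_regular(3)[OF adm[OF this]]]
      show "(\<lambda>p. H ((\<alpha>, fst p), (\<beta>, snd p))) \<in> borel_measurable (L \<Otimes>\<^sub>M L)"
        by (simp add: H_eq del: map_append)
    qed (simp add: countable_finite)
    fix p assume "p \<in> space (N \<Otimes>\<^sub>M N)"
    then obtain \<alpha> x \<beta> y where p: "p = ((\<alpha>, x), (\<beta>, y))" "\<alpha> \<in> A" "x \<in> \<Theta>" "\<beta> \<in> A" "y \<in> \<Theta>"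
      by (auto simp: space_pair_measure)
    then have "\<bar>H p\<bar> \<le> \<bar>c \<alpha> \<beta>\<bar>" using c by force
    also have "\<dots> \<le> (\<Sum>\<beta>\<in>A. \<bar>c \<alpha> \<beta>\<bar>)" by (rule member_le_sum) (use p in auto)
    also have "\<dots> \<le> (\<Sum>\<alpha>\<in>A. \<Sum>\<beta>\<in>A. \<bar>c \<alpha> \<beta>\<bar>)"
      by (rule member_le_sum[of \<alpha> A "\<lambda>\<alpha>. \<Sum>\<beta>\<in>A. \<bar>c \<alpha> \<beta>\<bar>"]) (use p in \<open>auto intro: sum_nonneg\<close>)
    finally show "\<bar>H p\<bar> \<le> (\<Sum>\<alpha>\<in>A. \<Sum>\<beta>\<in>A. \<bar>c \<alpha> \<beta>\<bar>)" .
  qed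
qed

text \<open>Exchanging the variables of \<open>h\<close> exchanges the two kinds of directions but
  leaves the derivatives in the wrong order; continuity of the derivatives in both orders permits
  the rearrangement.\<close>

lemma H_sym:
  assumes "v \<in> space N" "w \<in> space N"
  shows "H (v, w) = H (w, v)"
proof -
  obtain \<alpha> x \<beta> y where vw: "v = (\<alpha>, x)" "w = (\<beta>, y)" "\<alpha> \<in> A" "x \<in> \<Theta>" "\<beta> \<in> A" "y \<in> \<Theta>"
    using assms by auto
  let ?l = "map Inl (mi_dirs \<alpha>) @ map Inr (mi_dirs \<beta>)"
  let ?r = "map Inr (mi_dirs \<alpha>) @ map Inl (mi_dirs \<beta>)"
  have sw: "map coord_dir2 ?l = map prod.swap (map coord_dir2 ?r)" by simp
  have "kd ?l (x, y) = iter_partial (map coord_dir2 ?l) (\<lambda>q. h (prod.swap q)) (x, y)"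
    by (rule iter_partial_cong[of "\<Theta> \<times> \<Theta>"])
       (use pd vw \<Theta>(1) in \<open>auto simp: pos_def_kernel_def open_Times\<close>)
  also have "\<dots> = kd ?r (y, x)" unfolding sw by (subst iter_partial_swap) simp
  also have "\<dots> = kd (map Inl (mi_dirs \<beta>) @ map Inr (mi_dirs \<alpha>)) (y, x)"
    by (rule kd_perm) (use vw in \<open>auto simp: admissible_Inl_Inr len_A\<close>)
  finally show ?thesis by (simp add: vw H_eq del: map_append)
qed

text \<open>A point with multi-index \<alpha> is replaced by the nodes of a difference quotient of
  order \<alpha>. The double difference of \<open>h\<close> is a value of its positive definite
  form, and it tends to the derivative kernel with the step.\<close>

lemma H_pos:
  assumes "finite U" "U \<subseteq> space N"
  shows "0 \<le> (\<Sum>u\<in>U. \<Sum>v\<in>U. F u * H (u, v) * F v)"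
proof -
  obtain us where us: "set us = U" "distinct us" using finite_distinct_list[OF assms(1)] by blast
  define ds where "ds u = map coord_dir (mi_dirs (fst u))" for u :: "(nat ^ 'd) \<times> (real ^ 'd)"
  \<comment> \<open>One list for the whole sum: the coefficients \<open>F u\<close> are absorbed
    into the weights.\<close>
  define l where "l t = concat (map (\<lambda>u. map (\<lambda>(c, p). (F u * c, p)) (fd_list t (ds u) (snd u))) us)" for t
  have ev_l: "ev (l t) f = (\<Sum>u\<in>U. F u * fdiff t (ds u) f (snd u))" for t f
  proof -
    have "ev (concat (map (\<lambda>u. map (\<lambda>(c, p). (F u * c, p)) (fd_list t (ds u) (snd u))) us)) f =
        (\<Sum>u\<leftarrow>us. F u * fdiff t (ds u) f (snd u))" for us
      by (induction us) (auto simp: ev_append ev_scale fdiff_eq_ev, simp add: ev_def)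
    then show ?thesis unfolding l_def using us by (simp add: sum_list_distinct_conv_sum_set)
  qed
  define q where "q t = (\<Sum>u\<in>U. \<Sum>v\<in>U. F u * fdiff t (map coord_dir2 (map Inl (mi_dirs (fst u)) @ map
      Inr (mi_dirs (fst v)))) h (snd u, snd v) * F v)" for t
  have q_eq: "q t = ev (l t) (\<lambda>p. ev (l t) (\<lambda>q. h (p, q)))" for t
  proof -
    have "map coord_dir2 (map Inl (mi_dirs (fst u)) @ map Inr (mi_dirs (fst v))) =
        map (\<lambda>b. (b, 0)) (ds u) @ map (\<lambda>c. (0, c)) (ds v)" for u v :: "(nat ^ 'd) \<times> (real ^ 'd)"
      by (simp add: ds_def)
    then have "q t = (\<Sum>u\<in>U. \<Sum>v\<in>U. F u * fdiff t (ds u) (\<lambda>p. fdiff t (ds v) (\<lambda>q. h (p, q)) (snd v))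
        (snd u) * F v)"
      by (simp only: q_def fdiff_prod)
    also have "\<dots> = ev (l t) (\<lambda>p. ev (l t) (\<lambda>q. h (p, q)))"
      unfolding ev_l fdiff_sum by (simp add: sum_distrib_left mult_ac)
    finally show ?thesis .
  qed
  \<comment> \<open>For small steps all nodes stay in \<Theta>, where positive definiteness is
    available.\<close>
  have ev: "\<forall>\<^sub>F t in at 0. \<forall>u\<in>U. \<forall>c p. (c, p) \<in> set (fd_list t (ds u) (snd u)) \<longrightarrow> p \<in> \<Theta>"
  proof (rule eventually_ball_finite[OF assms(1)], rule ballI)
    fix u assume "u \<in> U"
    then have "snd u \<in> \<Theta>" using assms(2) by auto
    then obtain r where r: "r > 0" "ball (snd u) r \<subseteq> \<Theta>" using \<Theta>(1) openE by blast
    have "((\<lambda>t. \<bar>t\<bar> * sum_list (map norm (ds u))) \<longlongrightarrow> \<bar>0\<bar> * sum_list (map norm (ds u))) (at 0)"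
      by (intro tendsto_intros)
    then have "\<forall>\<^sub>F t in at 0. \<bar>t\<bar> * sum_list (map norm (ds u)) < r" using r by (intro order_tendstoD) auto
    then show "\<forall>\<^sub>F t in at 0. \<forall>c p. (c, p) \<in> set (fd_list t (ds u) (snd u)) \<longrightarrow> p \<in> \<Theta>"
    proof eventually_elim
      case (elim t)
      then show ?case using fd_list_near[of _ _ t "ds u" "snd u"] r(2)
        by (force simp: dist_norm norm_minus_commute)
    qed
  qed
  have "\<forall>\<^sub>F t in at 0. 0 \<le> q t"
    using ev
  proof eventually_elim
    case (elim t)
    have "p \<in> \<Theta>" if "(c, p) \<in> set (l t)" for c p using that elim us by (auto simp: l_def)
    then show ?case unfolding q_eq by (rule pos_def_kernel_ev[OF pd])
  qed
  moreover have "(q \<longlongrightarrow> (\<Sum>u\<in>U. \<Sum>v\<in>U. F u * H (u, v) * F v)) (at 0)"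
    unfolding q_def
  proof (intro tendsto_intros)
    fix u v assume "u \<in> U" "v \<in> U"
    then have "u \<in> A \<times> \<Theta>" "v \<in> A \<times> \<Theta>" using assms(2) by auto
    then obtain \<alpha> x \<beta> y where uv: "u = (\<alpha>, x)" "v = (\<beta>, y)" "\<alpha> \<in> A" "x \<in> \<Theta>" "\<beta> \<in> A" "y \<in> \<Theta>"
      by blast
    let ?l = "map Inl (mi_dirs \<alpha>) @ map Inr (mi_dirs \<beta>)"
    \<comment> \<open>The limit of the difference quotients comes with the reversed order of
      derivatives.\<close>
    have adm: "admissible k ?l" "admissible k (rev ?l)"
      using uv admissible_perm[of "rev ?l" ?l] by (auto simp: admissible_Inl_Inr len_A simp del: rev_append)
    have "((\<lambda>t. fdiff t (map coord_dir2 ?l) h (x, y)) \<longlongrightarrow> iter_partial (rev (map coord_dir2 ?l)) h (x, y)) (at 0)"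
      by (rule fdiff_tendsto[of "\<Theta> \<times> \<Theta>"])
         (use kd_regular[OF adm(2)] uv \<Theta>(1) in \<open>auto simp: open_Times simp flip: rev_map simp del:
             map_append rev_append\<close>)
    moreover have "iter_partial (rev (map coord_dir2 ?l)) h (x, y) = H (u, v)"
      using kd_perm[OF adm(2), of ?l "(x, y)"] uv by (simp add: H_eq rev_map del: map_append rev_append)
    ultimately show "((\<lambda>t. fdiff t (map coord_dir2 (map Inl (mi_dirs (fst u)) @ map Inr (mi_dirs
        (fst v)))) h (snd u, snd v))
        \<longlongrightarrow> H (u, v)) (at 0)" using uv by simp
  qed
  ultimately show ?thesis by (intro tendsto_lowerbound[of q _ "at 0"]) auto
qed

text \<open>Only the spatial variable is rounded, to finite nets of mesh 1 / (n + 1), as the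
  multi-indices already form a finite set. Continuity of the derivatives of \<open>h\<close> gives
  the convergence.\<close>

lemma H_quadratic_form_nonneg:
  assumes f: "bdd_measurable N f"
  shows "0 \<le> (\<integral>p. H p * (f (fst p) * f (snd p)) \<partial>(N \<Otimes>\<^sub>M N))"
proof -
  have "\<exists>cs. set cs \<subseteq> \<Theta> \<and> (\<forall>x\<in>\<Theta>. \<exists>c\<in>set cs. dist x c < 1 / real (Suc n))" for n
    by (rule bounded_finite_net[OF \<Theta>(2)]) simp
  then obtain cs where cs: "\<And>n. set (cs n) \<subseteq> \<Theta>" "\<And>n x. x \<in> \<Theta> \<Longrightarrow> \<exists>c\<in>set (cs n). dist x c < 1 / real (Suc n)"
    by metis
  define \<pi> where "\<pi> n = near (1 / real (Suc n)) (cs n)" for n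
  have \<pi>: "\<pi> n x \<in> set (cs n)" "dist x (\<pi> n x) < 1 / real (Suc n)" "\<pi> n x \<in> \<Theta>" if "x \<in> \<Theta>" for n x
    using near_in[OF cs(2)[OF that]] cs(1) by (auto simp: \<pi>_def)
  have \<pi>_lim: "(\<lambda>n. \<pi> n x) \<longlonglongrightarrow> x" if "x \<in> \<Theta>" for x
  proof (rule tendsto_dist_iff[THEN iffD2], rule Lim_null_comparison)
    show "\<forall>\<^sub>F n in sequentially. norm (dist (\<pi> n x) x) \<le> 1 / real (Suc n)"
      using \<pi>(2)[OF that] by (intro always_eventually allI) (simp add: dist_commute less_imp_le)
    show "(\<lambda>n. 1 / real (Suc n)) \<longlonglongrightarrow> 0" using LIMSEQ_inverse_real_of_nat by (simp add: inverse_eq_divide)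
  qed
  have \<pi>_meas: "\<pi> n \<in> measurable L borel" for n
    unfolding \<pi>_def L_def by (intro measurable_restrict_space1) simp
  have sub: "A \<times> set (cs n) \<subseteq> space N" for n using cs(1)[of n] by auto
  show ?thesis
  proof (rule N.quadratic_form_nonneg[OF H_bdd f, of "\<lambda>n. A \<times> set (cs n)" "\<lambda>n w. (fst w, \<pi> n (snd w))"])
    fix n u
    have m: "(\<lambda>w. \<pi> n (snd w)) \<in> measurable N borel" unfolding N_def
      by (rule measurable_compose[OF measurable_snd \<pi>_meas])
    have m': "fst \<in> measurable N (count_space A)" unfolding N_def by simp
    have "(fst -` ({fst u} \<inter> A) \<inter> space N) \<inter> ((\<lambda>w. \<pi> n (snd w)) -` {snd u} \<inter> space N) \<in> sets N"
      by (rule sets.Int[OF measurable_sets[OF m'] measurable_sets[OF m]]) auto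
    moreover have "{w \<in> space N. (fst w, \<pi> n (snd w)) = u} =
        (fst -` ({fst u} \<inter> A) \<inter> space N) \<inter> ((\<lambda>w. \<pi> n (snd w)) -` {snd u} \<inter> space N)"
      by (cases u) auto
    ultimately show "{w \<in> space N. (fst w, \<pi> n (snd w)) = u} \<in> sets N" by simp
  next
    fix w w' assume "w \<in> space N" "w' \<in> space N"
    then obtain \<alpha> x \<beta> y where w: "w = (\<alpha>, x)" "w' = (\<beta>, y)" "\<alpha> \<in> A" "x \<in> \<Theta>" "\<beta> \<in> A" "y \<in> \<Theta>" by auto
    let ?l = "map Inl (mi_dirs \<alpha>) @ map Inr (mi_dirs \<beta>)"
    have adm: "admissible k ?l" using w by (simp add: admissible_Inl_Inr len_A)
    have "(\<lambda>n. kd ?l (\<pi> n x, \<pi> n y)) \<longlonglongrightarrow> kd ?l (x, y)"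
      by (rule continuous_on_tendsto_compose[OF kd_regular(3)[OF adm] tendsto_Pair[OF \<pi>_lim \<pi>_lim]])
         (use w \<pi> in auto)
    then show "(\<lambda>n. H ((fst w, \<pi> n (snd w)), (fst w', \<pi> n (snd w')))) \<longlonglongrightarrow> H (w, w')"
      by (simp add: w H_eq del: map_append)
  qed (use \<pi> sub H_pos in auto)
qed

end

section \<open>The kernel operator\<close>

lemma iter_partial_sum:
  assumes "open S" "finite I" "\<And>j. j \<in> I \<Longrightarrow> iter_partial_exists S bs (f j)" "x \<in> S"
  shows "iter_partial bs (\<lambda>x. \<Sum>j\<in>I. c j * f j x) x = (\<Sum>j\<in>I. c j * iter_partial bs (f j) x)"
  using assms(3,4)
proof (induction bs arbitrary: x)
  case (Cons b bs)
  let ?g = "\<lambda>x. \<Sum>j\<in>I. c j * iter_partial bs (f j) x"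
  have "((\<lambda>t. ?g (x + t *\<^sub>R b)) has_real_derivative (\<Sum>j\<in>I. c j * iter_partial (b # bs) (f j) x)) (at 0)"
    by (intro DERIV_sum DERIV_cmult iter_partial_has_derivative[OF Cons.prems])
  then have "partial_deriv b ?g x = (\<Sum>j\<in>I. c j * iter_partial (b # bs) (f j) x)"
    by (rule partial_deriv_eqI)
  moreover have "partial_deriv b (iter_partial bs (\<lambda>x. \<Sum>j\<in>I. c j * f j x)) x = partial_deriv b ?g x"
    by (rule partial_deriv_cong[OF assms(1) Cons.prems(2)]) (use Cons in auto)
  ultimately show ?case by simp
qed simp

lemma C_k_closure_properties:
  assumes "f \<in> C_k_closure k \<Theta>" "mi_order \<alpha> \<le> k"
  shows "f \<in> C_k k \<Theta>" "uniformly_continuous_on \<Theta> (classical_deriv \<alpha> f)"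
  using assms by (auto simp: C_k_closure_def)

lemma mi_dirs_0 [simp]: "mi_dirs 0 = []"
  using length_mi_dirs[of 0] by (simp add: mi_order_def)

lemma classical_deriv_0 [simp]: "classical_deriv 0 f = f"
  by (simp add: classical_deriv_def)

text \<open>Local integrability speaks about compact subsets. Measurability on all of \<Theta> is
  inherited from the classical derivative, since changes on null sets preserve Lebesgue
  measurability.\<close>

lemma has_weak_deriv_measurable:
  fixes f :: "real ^ 'd \<Rightarrow> real"
  assumes "open \<Theta>" "f \<in> C_k k \<Theta>" "mi_order \<alpha> \<le> k"
  shows "weak_deriv \<Theta> \<alpha> f \<in> borel_measurable (lebesgue_on \<Theta>)"
    and "classical_deriv \<alpha> f \<in> borel_measurable (lebesgue_on \<Theta>)"
proof -
  have "continuous_on \<Theta> (classical_deriv \<alpha> f)"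
    using assms by (simp add: C_k_def classical_deriv_def length_mi_dirs)
  from integral_lebesgue_on_open(3)[OF assms(1) borel_measurable_continuous_on_restrict[OF this]]
  show m: "classical_deriv \<alpha> f \<in> borel_measurable (lebesgue_on \<Theta>)" .
  have \<Theta>: "\<Theta> \<in> sets lebesgue" using assms(1) by simp
  have "AE x in lebesgue. x \<in> \<Theta> \<longrightarrow> weak_deriv \<Theta> \<alpha> f x = classical_deriv \<alpha> f x"
    using weak_deriv_eq_classical(1)[OF assms] \<Theta> by (subst (asm) AE_restrict_space_iff) simp_all
  then have ae: "AE x in lebesgue. indicator \<Theta> x *\<^sub>R classical_deriv \<alpha> f x = indicator \<Theta> x *\<^sub>R
      weak_deriv \<Theta> \<alpha> f x"
    by eventually_elim (simp add: indicator_def)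
  have "(\<lambda>x. indicator \<Theta> x *\<^sub>R classical_deriv \<alpha> f x) \<in> borel_measurable lebesgue"
    using m \<Theta> by (subst (asm) borel_measurable_restrict_space_iff) auto
  from borel_measurable_AE[OF this ae]
  have "(\<lambda>x. indicator \<Theta> x *\<^sub>R weak_deriv \<Theta> \<alpha> f x) \<in> borel_measurable lebesgue" .
  then show "weak_deriv \<Theta> \<alpha> f \<in> borel_measurable (lebesgue_on \<Theta>)"
    using \<Theta> by (subst borel_measurable_restrict_space_iff) auto
qed

section \<open>Jets and the smoothing effect of the kernel operator\<close>

context smooth_kernel
begin

definition jet :: "(real ^ 'd \<Rightarrow> real) \<Rightarrow> (nat ^ 'd) \<times> (real ^ 'd) \<Rightarrow> real" where
  "jet f = (\<lambda>(\<alpha>, x). classical_deriv \<alpha> f x)"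

text \<open>The zeroth component of the operator on families; \<open>jet_T\<close> recovers the
  other components as its derivatives.\<close>

definition T :: "((nat ^ 'd) \<times> (real ^ 'd) \<Rightarrow> real) \<Rightarrow> real ^ 'd \<Rightarrow> real" where
  "T F y = (\<integral>w. H (w, (0, y)) * F w \<partial>N)"

text \<open>The derivatives in the second variable are outermost, unlike in
  \<open>mixed_deriv\<close>, so that one more of them arises by differentiating under the
  integral.\<close>

definition G :: "'d list \<Rightarrow> (nat ^ 'd) \<times> (real ^ 'd) \<Rightarrow> real ^ 'd \<Rightarrow> real" where
  "G ds w y = kd (map Inr ds @ map Inl (mi_dirs (fst w))) (snd w, y)"

lemma G_admissible:
  "length ds \<le> k \<Longrightarrow> \<alpha> \<in> A \<Longrightarrow> admissible k (map Inr ds @ map Inl (mi_dirs \<alpha>))"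
  by (simp add: admissible_Inl_Inr len_A)

lemma G_bounded:
  assumes "length ds \<le> k"
  shows "\<exists>B\<ge>0. \<forall>w\<in>space N. \<forall>y\<in>\<Theta>. \<bar>G ds w y\<bar> \<le> B"
proof -
  have "\<exists>B\<ge>0. \<forall>x\<in>\<Theta>. \<forall>y\<in>\<Theta>. \<bar>G ds (\<alpha>, x) y\<bar> \<le> B" if "\<alpha> \<in> A" for \<alpha>
    by (rule kd_bounded[OF G_admissible[OF assms that]]) (auto simp: G_def simp del: map_append)
  then obtain B where B: "\<And>\<alpha>. \<alpha> \<in> A \<Longrightarrow> B \<alpha> \<ge> 0 \<and> (\<forall>x\<in>\<Theta>. \<forall>y\<in>\<Theta>. \<bar>G ds (\<alpha>, x) y\<bar> \<le> B \<alpha>)" by metis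
  show ?thesis
  proof (intro exI[of _ "\<Sum>\<alpha>\<in>A. B \<alpha>"] conjI ballI)
    fix w y assume w: "w \<in> space N" and y: "y \<in> \<Theta>"
    then have "\<bar>G ds w y\<bar> \<le> B (fst w)" using B[of "fst w"] by auto
    also have "\<dots> \<le> (\<Sum>\<alpha>\<in>A. B \<alpha>)" by (rule member_le_sum) (use B w in auto)
    finally show "\<bar>G ds w y\<bar> \<le> (\<Sum>\<alpha>\<in>A. B \<alpha>)" .
  qed (use B in \<open>auto intro: sum_nonneg\<close>)
qed

lemma G_continuous:
  assumes "length ds \<le> k" "\<alpha> \<in> A" "x \<in> \<Theta>"
  shows "continuous_on \<Theta> (G ds (\<alpha>, x))" "continuous_on \<Theta> (\<lambda>z. G ds (\<alpha>, z) x)"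
  unfolding G_def fst_conv snd_conv
  by (rule continuous_on_compose2[OF kd_regular(3)[OF G_admissible[OF assms(1,2)]]];
      use assms(3) in \<open>auto intro!: continuous_intros\<close>)+

lemma G_bdd:
  assumes "length ds \<le> k" "y \<in> \<Theta>"
  shows "bdd_measurable N (\<lambda>w. G ds w y)"
proof (rule bdd_measurable_N)
  fix \<alpha> assume "\<alpha> \<in> A"
  obtain B where "B \<ge> 0" "\<And>w y. w \<in> space N \<Longrightarrow> y \<in> \<Theta> \<Longrightarrow> \<bar>G ds w y\<bar> \<le> B"
    using G_bounded[OF assms(1)] by blast
  then show "bdd_measurable L (\<lambda>x. G ds (\<alpha>, x) y)"
    using \<open>\<alpha> \<in> A\<close> assms by (intro bdd_measurableI[of _ _ B] continuous_measurable_L G_continuous) auto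
qed

lemma G_eq_H: "\<beta> \<in> A \<Longrightarrow> w \<in> space N \<Longrightarrow> y \<in> \<Theta> \<Longrightarrow> G (mi_dirs \<beta>) w y = H (w, (\<beta>, y))"
  unfolding G_def by (cases w) (auto simp: H_eq len_A G_admissible simp del: map_append intro!: kd_perm)

lemma G_integral_derivative:
  assumes F: "bdd_measurable N F" and ds: "length (d # ds) \<le> k" and y: "y \<in> \<Theta>"
  shows "((\<lambda>s. \<integral>w. G ds w (y + s *\<^sub>R coord_dir d) * F w \<partial>N) has_real_derivative
    (\<integral>w. G (d # ds) w y * F w \<partial>N)) (at 0)"
proof -
  have ds': "length ds \<le> k" using ds by simp
  obtain B1 where B1: "B1 \<ge> 0" "\<And>w y. w \<in> space N \<Longrightarrow> y \<in> \<Theta> \<Longrightarrow> \<bar>G ds w y\<bar> \<le> B1"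
    using G_bounded[OF ds'] by blast
  obtain B2 where B2: "B2 \<ge> 0" "\<And>w y. w \<in> space N \<Longrightarrow> y \<in> \<Theta> \<Longrightarrow> \<bar>G (d # ds) w y\<bar> \<le> B2"
    using G_bounded[OF ds] by blast
  show ?thesis
  proof (rule has_derivative_under_integral[OF \<Theta>(1) y N.bdd_measurable_integrable[OF F], where B = "B1 + B2"])
    fix w z assume w: "w \<in> space N" and z: "z \<in> \<Theta>"
    show "\<bar>G ds w z\<bar> \<le> B1 + B2" "\<bar>G (d # ds) w z\<bar> \<le> B1 + B2" using B1 B2 w z by force+
    let ?l = "map Inr ds @ map Inl (mi_dirs (fst w))"
    have "((\<lambda>t. kd ?l ((snd w, z) + t *\<^sub>R coord_dir2 (Inr d))) has_real_derivative kd (Inr d # ?l)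
        (snd w, z)) (at 0)"
      unfolding list.map
      by (rule iter_partial_has_derivative[of "\<Theta> \<times> \<Theta>"])
         (use kd_regular(1)[OF G_admissible[OF ds, of "fst w"]] w z in auto)
    then show "((\<lambda>s. G ds w (z + s *\<^sub>R coord_dir d)) has_real_derivative G (d # ds) w z) (at 0)"
      by (simp add: G_def)
  qed (use G_bdd[OF ds'] G_bdd[OF ds] y in \<open>auto dest: bdd_measurableD\<close>)
qed

lemma G_integral_continuous:
  assumes F: "bdd_measurable N F" and ds: "length ds \<le> k"
  shows "continuous_on \<Theta> (\<lambda>y. \<integral>w. G ds w y * F w \<partial>N)"
  unfolding continuous_on_sequentially comp_def
proof (intro allI ballI impI, elim conjE)
  fix X a assume a: "a \<in> \<Theta>" and X: "\<forall>n. X n \<in> \<Theta>" "X \<longlonglongrightarrow> a"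
  obtain B where B: "B \<ge> 0" "\<And>w y. w \<in> space N \<Longrightarrow> y \<in> \<Theta> \<Longrightarrow> \<bar>G ds w y\<bar> \<le> B"
    using G_bounded[OF ds] by blast
  show "(\<lambda>n. \<integral>w. G ds w (X n) * F w \<partial>N) \<longlonglongrightarrow> (\<integral>w. G ds w a * F w \<partial>N)"
  proof (rule integral_dominated_convergence)
    show "integrable N (\<lambda>w. B * \<bar>F w\<bar>)" using N.bdd_measurable_integrable[OF F] by simp
    show "AE w in N. (\<lambda>n. G ds w (X n) * F w) \<longlonglongrightarrow> G ds w a * F w"
    proof (intro AE_I2 tendsto_mult_right)
      fix w assume "w \<in> space N"
      then have "continuous_on \<Theta> (G ds w)" using G_continuous(1)[OF ds, of "fst w" "snd w"] by auto
      then show "(\<lambda>n. G ds w (X n)) \<longlonglongrightarrow> G ds w a"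
        using X a by (intro continuous_on_tendsto_compose[of \<Theta> "G ds w"]) auto
    qed
    show "AE w in N. norm (G ds w (X n) * F w) \<le> B * \<bar>F w\<bar>" for n
      using B X(1) by (intro AE_I2) (auto simp: abs_mult intro!: mult_right_mono)
  qed (use G_bdd[OF ds] F a X in \<open>auto intro!: bdd_measurableD bdd_measurable_mult\<close>)
qed

lemma iter_partial_T:
  assumes F: "bdd_measurable N F"
  shows "length ds \<le> k \<Longrightarrow> iter_partial_exists \<Theta> (map coord_dir ds) (T F)"
    and "length ds \<le> k \<Longrightarrow> y \<in> \<Theta> \<Longrightarrow> iter_partial (map coord_dir ds) (T F) y = (\<integral>w. G ds w y * F w \<partial>N)"
proof (induction ds arbitrary: y)
  case Nil
  {
    case 1
    show ?case by simp
  next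
    case 2
    have "G [] w y = H (w, (0, y))" if "w \<in> space N" for w using G_eq_H[of 0 w y] that 2 by simp
    then have "T F y = (\<integral>w. G [] w y * F w \<partial>N)"
      unfolding T_def by (intro Bochner_Integration.integral_cong refl) (simp only:)
    then show ?case by simp
  }
next
  case (Cons d ds)
  have eq: "iter_partial (map coord_dir ds) (T F) z = (\<integral>w. G ds w z * F w \<partial>N)"
    if "length (d # ds) \<le> k" "z \<in> \<Theta>" for z using Cons.IH(2) that by simp
  have der: "((\<lambda>s. iter_partial (map coord_dir ds) (T F) (y + s *\<^sub>R coord_dir d)) has_real_derivative
      (\<integral>w. G (d # ds) w y * F w \<partial>N)) (at 0)" if l: "length (d # ds) \<le> k" and y: "y \<in> \<Theta>" for y
  proof (rule DERIV_transform_ev[OF G_integral_derivative[OF F l y]])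
    show "\<forall>\<^sub>F s in nhds 0. (\<integral>w. G ds w (y + s *\<^sub>R coord_dir d) * F w \<partial>N) =
        iter_partial (map coord_dir ds) (T F) (y + s *\<^sub>R coord_dir d)"
      using eventually_line[OF \<Theta>(1) y, of "coord_dir d"] by eventually_elim (use eq[OF l] in simp)
  qed
  {
    case 1
    then show ?case using der Cons.IH(1) by (auto simp: field_differentiable_def)
  next
    case 2
    then show ?case using der by (auto intro!: partial_deriv_eqI)
  }
qed

text \<open>\<open>F\<close> is merely bounded and measurable; all regularity stems from the
  kernel.\<close>

lemma T_C_k:
  assumes F: "bdd_measurable N F"
  shows "T F \<in> C_k k \<Theta>"
  unfolding C_k_def mem_Collect_eq
proof (intro allI impI conjI)
  fix ds :: "'d list" assume l: "length ds \<le> k"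
  show "iter_partial_exists \<Theta> (map coord_dir ds) (T F)" by (rule iter_partial_T(1)[OF F l])
  show "continuous_on \<Theta> (iter_partial (map coord_dir ds) (T F))"
    by (rule continuous_on_eq[OF G_integral_continuous[OF F l]]) (rule iter_partial_T(2)[OF F l, symmetric])
qed

text \<open>The integral operator maps every bounded measurable family to a jet. Its eigenfunctions
  for non-zero eigenvalues therefore come from functions on \<Theta> with \<open>k\<close>
  continuous derivatives.\<close>

lemma jet_T:
  assumes "bdd_measurable N F" "w \<in> space N"
  shows "jet (T F) w = (\<integral>v. H (v, w) * F v \<partial>N)"
proof -
  obtain \<beta> y where w: "w = (\<beta>, y)" "\<beta> \<in> A" "y \<in> \<Theta>" using assms(2) by auto
  have "jet (T F) w = (\<integral>v. G (mi_dirs \<beta>) v y * F v \<partial>N)"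
    using iter_partial_T(2)[OF assms(1)] w by (simp add: jet_def classical_deriv_def len_A)
  also have "\<dots> = (\<integral>v. H (v, w) * F v \<partial>N)"
    using G_eq_H w by (intro Bochner_Integration.integral_cong refl) auto
  finally show ?thesis .
qed

lemma jet_bdd:
  assumes f: "f \<in> C_k k \<Theta>" and "\<And>w. w \<in> space N \<Longrightarrow> \<bar>jet f w\<bar> \<le> B"
  shows "bdd_measurable N (jet f)"
proof (rule bdd_measurable_N)
  fix \<alpha> assume \<alpha>: "\<alpha> \<in> A"
  then have "continuous_on \<Theta> (classical_deriv \<alpha> f)" using f by (simp add: C_k_def classical_deriv_def len_A)
  then show "bdd_measurable L (\<lambda>x. jet f (\<alpha>, x))"
    using assms(2) \<alpha> by (intro bdd_measurableI[of _ _ B] continuous_measurable_L) (auto simp: jet_def)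
qed

lemma jet_closure_bdd:
  assumes f: "f \<in> C_k_closure k \<Theta>"
  shows "bdd_measurable N (jet f)"
proof (rule bdd_measurable_N)
  fix \<alpha> assume "\<alpha> \<in> A"
  then have uc: "uniformly_continuous_on \<Theta> (classical_deriv \<alpha> f)"
    using C_k_closure_properties(2)[OF f] by (simp add: A_def)
  then obtain B where "\<And>x. x \<in> \<Theta> \<Longrightarrow> \<bar>classical_deriv \<alpha> f x\<bar> \<le> B"
    using bounded_uniformly_continuous_image[OF uc \<Theta>(2)] by (auto simp: bounded_pos)
  then show "bdd_measurable L (\<lambda>x. jet f (\<alpha>, x))"
    using uniformly_continuous_imp_continuous[OF uc]
    by (intro bdd_measurableI[of _ _ B] continuous_measurable_L) (auto simp: jet_def)
qed

lemma integral_lebesgue_on_L: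
  fixes f :: "real ^ 'd \<Rightarrow> real"
  assumes "f \<in> borel_measurable L"
  shows "(\<integral>x. f x \<partial>lebesgue_on \<Theta>) = (\<integral>x. f x \<partial>L)" "integrable (lebesgue_on \<Theta>) f \<longleftrightarrow> integrable L f"
    "f \<in> borel_measurable (lebesgue_on \<Theta>)"
proof -
  have "f \<in> borel_measurable (restrict_space borel \<Theta>)"
    using assms measurable_cong_sets[of L "restrict_space borel \<Theta>" borel borel]
    by (simp add: L_def sets_restrict_space)
  from integral_lebesgue_on_open[OF \<Theta>(1) this] 
  show "(\<integral>x. f x \<partial>lebesgue_on \<Theta>) = (\<integral>x. f x \<partial>L)" "integrable (lebesgue_on \<Theta>) f \<longleftrightarrow> integrable L f"
    "f \<in> borel_measurable (lebesgue_on \<Theta>)" by (auto simp: L_def)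
qed

text \<open>Serves both the kernel operator, with the sum under the integral, and the Sobolev inner
  product, with the sum outside. \<open>Q\<close> is the factor as it occurs in the definitions and
  may differ from \<open>P\<close> on a null set.\<close>

lemma integral_jets:
  assumes f: "f \<in> C_k k \<Theta>" "bdd_measurable N (jet f)" and P: "bdd_measurable N P"
    and P': "\<And>\<alpha>. \<alpha> \<in> A \<Longrightarrow> Q \<alpha> \<in> borel_measurable (lebesgue_on \<Theta>)"
      "\<And>\<alpha>. \<alpha> \<in> A \<Longrightarrow> AE x in lebesgue_on \<Theta>. Q \<alpha> x = P (\<alpha>, x)"
  shows "(\<integral>x. (\<Sum>\<alpha> | mi_order \<alpha> \<le> k. Q \<alpha> x * weak_deriv \<Theta> \<alpha> f x) \<partial>lebesgue_on \<Theta>) = (\<integral>w. P w * jet f w \<partial>N)"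
    and "(\<Sum>\<alpha> | mi_order \<alpha> \<le> k. \<integral>x. Q \<alpha> x * weak_deriv \<Theta> \<alpha> f x \<partial>lebesgue_on \<Theta>) = (\<integral>w. P w * jet f w \<partial>N)"
proof -
  have Pj: "bdd_measurable L (\<lambda>x. P (\<alpha>, x) * jet f (\<alpha>, x))" if "\<alpha> \<in> A" for \<alpha>
    by (intro bdd_measurable_mult bdd_measurable_N_section P f that)
  have m: "(\<lambda>x. Q \<alpha> x * weak_deriv \<Theta> \<alpha> f x) \<in> borel_measurable (lebesgue_on \<Theta>)" if "\<alpha> \<in> A" for \<alpha>
    using P'(1)[OF that] has_weak_deriv_measurable(1)[OF \<Theta>(1) f(1)] that by (auto simp: A_def)
  have eq: "AE x in lebesgue_on \<Theta>. Q \<alpha> x * weak_deriv \<Theta> \<alpha> f x = P (\<alpha>, x) * jet f (\<alpha>, x)" if "\<alpha> \<in> A" for \<alpha>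
    using P'(2)[OF that] weak_deriv_eq_classical(1)[OF \<Theta>(1) f(1), of \<alpha>] that
    by (auto simp: A_def jet_def elim: eventually_elim2)
  have i: "(\<integral>x. Q \<alpha> x * weak_deriv \<Theta> \<alpha> f x \<partial>lebesgue_on \<Theta>) = (\<integral>x. P (\<alpha>, x) * jet f (\<alpha>, x) \<partial>L)"
    "integrable (lebesgue_on \<Theta>) (\<lambda>x. Q \<alpha> x * weak_deriv \<Theta> \<alpha> f x)" if \<alpha>: "\<alpha> \<in> A" for \<alpha>
  proof -
    note mm = integral_lebesgue_on_L[OF bdd_measurableD[OF Pj[OF \<alpha>]]]
    show "(\<integral>x. Q \<alpha> x * weak_deriv \<Theta> \<alpha> f x \<partial>lebesgue_on \<Theta>) = (\<integral>x. P (\<alpha>, x) * jet f (\<alpha>, x) \<partial>L)"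
      unfolding mm(1)[symmetric] by (rule integral_cong_AE[OF m[OF \<alpha>] mm(3) eq[OF \<alpha>]])
    show "integrable (lebesgue_on \<Theta>) (\<lambda>x. Q \<alpha> x * weak_deriv \<Theta> \<alpha> f x)"
      by (rule integrable_cong_AE_imp[OF mm(2)[THEN iffD2, OF L.bdd_measurable_integrable[OF Pj[OF
          \<alpha>]]] m[OF \<alpha>]])
         (use eq[OF \<alpha>] in \<open>auto elim: eventually_mono\<close>)
  qed
  show 2: "(\<Sum>\<alpha> | mi_order \<alpha> \<le> k. \<integral>x. Q \<alpha> x * weak_deriv \<Theta> \<alpha> f x \<partial>lebesgue_on \<Theta>) = (\<integral>w. P w * jet f w \<partial>N)"
    unfolding A_def[symmetric] using i(1) integral_N[OF bdd_measurable_mult[OF P f(2)]] by simp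
  show "(\<integral>x. (\<Sum>\<alpha> | mi_order \<alpha> \<le> k. Q \<alpha> x * weak_deriv \<Theta> \<alpha> f x) \<partial>lebesgue_on \<Theta>) = (\<integral>w. P w * jet f w \<partial>N)"
    unfolding 2[symmetric] using i(2) by (intro Bochner_Integration.integral_sum) (auto simp: A_def)
qed

lemma sobolev_inner_eq:
  assumes "f \<in> C_k k \<Theta>" "bdd_measurable N (jet f)" "g \<in> C_k k \<Theta>" "bdd_measurable N (jet g)"
  shows "sobolev_inner \<Theta> k f g = (\<integral>w. jet f w * jet g w \<partial>N)"
  unfolding sobolev_inner_def
  by (rule integral_jets(2)[OF assms(3,4,2)])
     (use has_weak_deriv_measurable(1)[OF \<Theta>(1) assms(1)] weak_deriv_eq_classical(1)[OF \<Theta>(1) assms(1)]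
       in \<open>auto simp: A_def jet_def\<close>)

lemma H_section_bdd:
  assumes "w \<in> space N" shows "bdd_measurable N (\<lambda>v. H (v, w))" "bdd_measurable N (\<lambda>v. H (w, v))"
  using N.bdd_measurable_sections[OF H_bdd assms] by auto

lemma kernel_op_eq:
  assumes "f \<in> C_k k \<Theta>" "bdd_measurable N (jet f)" "y \<in> \<Theta>"
  shows "kernel_op \<Theta> k h f y = T (jet f) y"
  unfolding kernel_op_def T_def
proof (rule integral_jets(1)[OF assms(1,2)])
  show P: "bdd_measurable N (\<lambda>w. H (w, (0, y)))" by (rule H_section_bdd(1)) (use assms(3) in auto)
  show "(\<lambda>x. mixed_deriv \<alpha> 0 h (x, y)) \<in> borel_measurable (lebesgue_on \<Theta>)" if "\<alpha> \<in> A" for \<alpha>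
    using integral_lebesgue_on_L(3)[OF bdd_measurableD[OF bdd_measurable_N_section[OF P that]]] by
        (simp add: H_def)
qed (simp add: H_def)

lemma L2_space_bdd:
  assumes "bdd_measurable L f"
  shows "f \<in> L2_space \<Theta>"
  using integral_lebesgue_on_L(3)[OF bdd_measurableD[OF assms]]
    integral_lebesgue_on_L(2)[OF bdd_measurableD[OF bdd_measurable_mult[OF assms assms]]]
    L.bdd_measurable_integrable[OF bdd_measurable_mult[OF assms assms]]
  by (simp add: L2_space_def power2_eq_square)

lemma sobolevI:
  assumes "f \<in> C_k k \<Theta>" "bdd_measurable N (jet f)"
  shows "f \<in> sobolev \<Theta> k"
proof -
  have L2: "classical_deriv \<alpha> f \<in> L2_space \<Theta>" if "\<alpha> \<in> A" for \<alpha>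
    using L2_space_bdd[OF bdd_measurable_N_section[OF assms(2) that]] by (simp add: jet_def)
  then show ?thesis
    using L2[OF zero_A] has_weak_deriv_classical[OF \<Theta>(1) assms(1)] by (auto simp: sobolev_def A_def)
qed

end

section \<open>The remainder of the eigenfunction expansion\<close>

text \<open>The set where the two functions differ is open, and a non-empty open set is not
  negligible.\<close>

lemma continuous_AE_eq:
  fixes f g :: "'a::euclidean_space \<Rightarrow> real"
  assumes "open \<Theta>" "continuous_on \<Theta> f" "continuous_on \<Theta> g" "AE x in lebesgue_on \<Theta>. f x = g x" "x \<in> \<Theta>"
  shows "f x = g x"
proof (rule ccontr)
  assume ne: "f x \<noteq> g x"
  define S where "S = \<Theta> \<inter> (\<lambda>x. f x - g x) -` (- {0 :: real})"
  have "open S" unfolding S_def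
    by (rule continuous_open_preimage) (use assms in \<open>auto intro!: continuous_intros\<close>)
  moreover have "S \<noteq> {}" using ne assms(5) by (auto simp: S_def)
  ultimately have "\<not> negligible S" by (rule open_not_negligible)
  moreover have "AE x in lebesgue. x \<in> \<Theta> \<longrightarrow> f x = g x"
    using assms(1,4) by (subst (asm) AE_restrict_space_iff) auto
  then have "AE x in lebesgue. x \<notin> S" by eventually_elim (auto simp: S_def)
  then have "S \<in> null_sets lebesgue"
    using \<open>open S\<close> by (subst AE_iff_null_sets) auto
  ultimately show False by (simp add: negligible_iff_null_sets)
qed

text \<open>A uniformly continuous function extends continuously to the closure, and
  \<open>closure_ext\<close> agrees with that extension; hence limits along arbitrary sequences
  compute it.\<close>

lemma closure_ext_tendsto:
  fixes f :: "'a::metric_space \<Rightarrow> real"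
  assumes "uniformly_continuous_on S f" "\<And>n. X n \<in> S" "X \<longlonglongrightarrow> p"
  shows "(\<lambda>n. f (X n)) \<longlonglongrightarrow> closure_ext S f p"
proof -
  obtain g where g: "uniformly_continuous_on (closure S) g" "\<And>x. x \<in> S \<Longrightarrow> f x = g x"
    using uniformly_continuous_on_extension_on_closure[OF assms(1)] by metis
  have p: "p \<in> closure S" using assms(2,3) closure_sequential by blast
  have cg: "continuous_on (closure S) g" using g(1) by (rule uniformly_continuous_imp_continuous)
  have "closure_ext S f p = g p"
  proof (cases "p \<in> S")
    case False
    have "(g \<longlongrightarrow> g p) (at p within S)"
      using cg p closure_subset[of S] by (auto simp: continuous_on_def intro: tendsto_within_subset)
    then have "(f \<longlongrightarrow> g p) (at p within S)"
      by (rule Lim_transform_within[of _ _ _ _ 1]) (use g(2) in auto)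
    moreover have "at p within S \<noteq> bot"
      using p False by (simp add: trivial_limit_within islimpt_in_closure)
    ultimately show ?thesis using False by (simp add: closure_ext_def tendsto_Lim)
  qed (simp add: closure_ext_def g(2))
  moreover have "(\<lambda>n. g (X n)) \<longlonglongrightarrow> g p"
    by (rule continuous_on_tendsto_compose[OF cg assms(3) p always_eventually])
       (use assms(2) closure_subset in blast)
  ultimately show ?thesis using g(2) assms(2) by simp
qed

context smooth_kernel
begin

lemma jet_0: "jet f (0, y) = f y"
  by (simp add: jet_def)

lemma jet_sum:
  assumes "finite I" "\<And>i. i \<in> I \<Longrightarrow> f i \<in> C_k k \<Theta>" "\<And>x. x \<in> \<Theta> \<Longrightarrow> g x = (\<Sum>i\<in>I. c i * f i x)" "w \<in> space N"
  shows "jet g w = (\<Sum>i\<in>I. c i * jet (f i) w)"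
proof -
  obtain \<beta> y where w: "w = (\<beta>, y)" "\<beta> \<in> A" "y \<in> \<Theta>" using assms(4) by auto
  let ?bs = "map coord_dir (mi_dirs \<beta>)"
  have "iter_partial ?bs g y = iter_partial ?bs (\<lambda>x. \<Sum>i\<in>I. c i * f i x) y"
    by (rule iter_partial_cong[OF \<Theta>(1) assms(3) w(3)])
  also have "\<dots> = (\<Sum>i\<in>I. c i * iter_partial ?bs (f i) y)"
    by (rule iter_partial_sum[OF \<Theta>(1) assms(1) _ w(3)]) (use assms(2) w(2) in \<open>auto simp: C_k_def len_A\<close>)
  finally show ?thesis by (simp add: w jet_def classical_deriv_def)
qed

sublocale PH: pos_kernel N H
  by unfold_locales
     (use H_bdd H_sym H_quadratic_form_nonneg N.Fubini_quadratic[OF H_bdd] in auto)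

end

section \<open>Bessel's inequality and the partial sums of the expansion\<close>

locale kernel_eigensystem = smooth_kernel \<Theta> k h
  for \<Theta> :: "(real ^ 'd) set" and k and h :: "(real ^ 'd) \<times> (real ^ 'd) \<Rightarrow> real" +
  fixes J :: "nat set" and lam :: "nat \<Rightarrow> real" and e :: "nat \<Rightarrow> real ^ 'd \<Rightarrow> real"
  assumes es: "eigensystem \<Theta> k h J lam e"
begin

abbreviation "E j \<equiv> jet (e j)"

lemma e_closure: "j \<in> J \<Longrightarrow> e j \<in> C_k_closure k \<Theta>"
  using es by (simp add: eigensystem_def)

lemma e_C_k: "j \<in> J \<Longrightarrow> e j \<in> C_k k \<Theta>"
  using e_closure by (simp add: C_k_closure_def)

lemma E_bdd: "j \<in> J \<Longrightarrow> bdd_measurable N (E j)"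
  by (rule jet_closure_bdd[OF e_closure])

lemma E_orthonormal:
  assumes "i \<in> J" "j \<in> J" shows "(\<integral>w. E i w * E j w \<partial>N) = (if i = j then 1 else 0)"
  using es assms sobolev_inner_eq[OF e_C_k E_bdd e_C_k E_bdd, OF assms(1,1,2,2)]
  by (simp add: eigensystem_def)

text \<open>The eigenvalue equation is given almost everywhere and for the zeroth component.
  Continuity makes it hold throughout \<Theta>, after which differentiating both sides gives it for
  every multi-index.\<close>

lemma E_eigen:
  assumes j: "j \<in> J" and w: "w \<in> space N"
  shows "PH.op (E j) w = lam j * E j w"
proof -
  have "AE y in lebesgue_on \<Theta>. kernel_op \<Theta> k h (e j) y = lam j * e j y"
    using es j by (simp add: eigensystem_def eigenfunction_def)
  then have "AE y in lebesgue_on \<Theta>. T (E j) y = lam j * e j y"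
    using AE_space
  proof eventually_elim
    case (elim y)
    then show ?case using kernel_op_eq[OF e_C_k[OF j] E_bdd[OF j]] by simp
  qed
  then have T: "T (E j) y = lam j * e j y" if "y \<in> \<Theta>" for y
    using C_k_continuous[OF T_C_k[OF E_bdd[OF j]]] C_k_continuous[OF e_C_k[OF j]]
    by (intro continuous_AE_eq[OF \<Theta>(1) _ _ _ that]) (auto intro!: continuous_intros)
  have "PH.op (E j) w = (\<integral>v. H (v, w) * E j v \<partial>N)"
    unfolding PH.op_def using H_sym w by (intro Bochner_Integration.integral_cong refl) auto
  also have "\<dots> = jet (T (E j)) w" by (rule jet_T[OF E_bdd[OF j] w, symmetric])
  also have "\<dots> = (\<Sum>i\<in>{j}. lam i * E i w)"
    by (rule jet_sum[OF _ _ _ w]) (use T e_C_k j in auto)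
  finally show ?thesis by simp
qed

definition a :: "nat \<Rightarrow> ((nat ^ 'd) \<times> (real ^ 'd) \<Rightarrow> real) \<Rightarrow> real" where
  "a j f = (\<integral>w. E j w * f w \<partial>N)"

definition quad :: "((nat ^ 'd) \<times> (real ^ 'd) \<Rightarrow> real) \<Rightarrow> real" where
  "quad f = (\<integral>w. PH.op f w * f w \<partial>N)"

lemma quad_nonneg: "bdd_measurable N f \<Longrightarrow> 0 \<le> quad f"
  using PH.K_pos by (simp add: quad_def PH.op_def)

text \<open>The two mixed terms contribute \<open>- lam j * (a j f)\<^sup>2\<close> each, by
  self-adjointness, and the quadratic term gives one of them back because \<open>E j\<close> is
  normalised.\<close>

lemma quad_diff:
  assumes f: "bdd_measurable N f" and j: "j \<in> J"
  shows "quad (\<lambda>w. f w + (- a j f) * E j w) = quad f - lam j * (a j f)\<^sup>2"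
proof -
  let ?a = "a j f" and ?E = "E j"
  note E = E_bdd[OF j]
  have int: "integrable N (\<lambda>w. u w * v w)" if "bdd_measurable N u" "bdd_measurable N v" for u v
    by (intro N.bdd_measurable_integrable bdd_measurable_mult that)
  have i1: "(\<integral>w. PH.op f w * ?E w \<partial>N) = lam j * ?a"
  proof -
    have "(\<integral>w. PH.op f w * ?E w \<partial>N) = (\<integral>w. f w * PH.op ?E w \<partial>N)" by (rule PH.op_self_adjoint[OF f E])
    also have "\<dots> = (\<integral>w. lam j * (?E w * f w) \<partial>N)"
      using E_eigen[OF j] by (intro Bochner_Integration.integral_cong refl) (simp only: mult_ac)
    finally show ?thesis by (simp add: a_def)
  qed
  have "quad (\<lambda>w. f w + (- ?a) * ?E w) =
      (\<integral>w. PH.op f w * f w - ?a * (PH.op f w * ?E w) - ?a * lam j * (?E w * f w) + ?a * ?a * lam j *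
          (?E w * ?E w) \<partial>N)"
    unfolding quad_def
  proof (intro Bochner_Integration.integral_cong refl)
    fix w assume "w \<in> space N"
    then have op: "PH.op (\<lambda>w. f w + (- ?a) * ?E w) w = PH.op f w + (- ?a) * (lam j * ?E w)"
      using PH.op_add_cmult[OF f E, of w "- ?a"] E_eigen[OF j, of w] by simp
    show "PH.op (\<lambda>w. f w + (- ?a) * ?E w) w * (f w + (- ?a) * ?E w) =
        PH.op f w * f w - ?a * (PH.op f w * ?E w) - ?a * lam j * (?E w * f w) + ?a * ?a * lam j * (?E w * ?E w)"
      unfolding op by (simp add: algebra_simps)
  qed
  also have "\<dots> = quad f - ?a * (lam j * ?a) - ?a * lam j * ?a + ?a * ?a * lam j * 1"
    using int[OF PH.op_bdd[OF f] f] int[OF PH.op_bdd[OF f] E] int[OF E f] int[OF E E] i1 E_orthonormal[OF j j]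
    by (simp add: quad_def a_def)
  finally show ?thesis by (simp add: power2_eq_square)
qed

text \<open>Removing one component lowers the form by exactly its contribution, orthogonality
  preserves the other coefficients, and the form of what is left at the end is non-negative.\<close>

lemma Bessel:
  assumes "finite I" "I \<subseteq> J" "bdd_measurable N f"
  shows "(\<Sum>j\<in>I. lam j * (a j f)\<^sup>2) \<le> quad f"
  using assms
proof (induction I arbitrary: f)
  case empty
  then show ?case by (simp add: quad_nonneg)
next
  case (insert i I)
  let ?f = "\<lambda>w. f w + (- a i f) * E i w"
  have i: "i \<in> J" and f: "bdd_measurable N f" using insert.prems by auto
  have "a j ?f = a j f" if "j \<in> I" for j
  proof -
    have j: "j \<in> J" "j \<noteq> i" using that insert by auto
    have "integrable N (\<lambda>w. E j w * f w)" "integrable N (\<lambda>w. E j w * E i w)"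
      using f E_bdd i j by (auto intro!: N.bdd_measurable_integrable bdd_measurable_mult)
    moreover have "(\<lambda>w. E j w * ?f w) = (\<lambda>w. E j w * f w - a i f * (E j w * E i w))"
      by (simp add: algebra_simps)
    ultimately show ?thesis using E_orthonormal[OF j(1) i] j(2) by (simp add: a_def[of j])
  qed
  then have "(\<Sum>j\<in>I. lam j * (a j f)\<^sup>2) = (\<Sum>j\<in>I. lam j * (a j ?f)\<^sup>2)" by simp
  also have "\<dots> \<le> quad ?f"
    using insert by (intro insert.IH bdd_measurable_add bdd_measurable_cmult E_bdd) auto
  also have "\<dots> = quad f - lam i * (a i f)\<^sup>2" by (rule quad_diff[OF f i])
  finally show ?case using insert.hyps by simp
qed

text \<open>\<open>eigensystem\<close> only excludes the eigenvalue 0; the sign comes from the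
  positive form evaluated at the normalised \<open>E j\<close>.\<close>

lemma lam_pos: "j \<in> J \<Longrightarrow> lam j > 0"
proof -
  assume j: "j \<in> J"
  have "quad (E j) = (\<integral>w. lam j * (E j w * E j w) \<partial>N)"
    unfolding quad_def using E_eigen[OF j] by (intro Bochner_Integration.integral_cong refl) (simp
        only: mult_ac)
  then have "0 \<le> lam j" using quad_nonneg[OF E_bdd[OF j]] E_orthonormal[OF j j] by simp
  moreover have "lam j \<noteq> 0" using es j by (simp add: eigensystem_def)
  ultimately show ?thesis by simp
qed

text \<open>The value 0 off \<open>J\<close> turns finite and infinite index sets alike into series
  over all natural numbers.\<close>

definition summand :: "nat \<Rightarrow> (nat ^ 'd) \<times> (real ^ 'd) \<Rightarrow> (nat ^ 'd) \<times> (real ^ 'd) \<Rightarrow> real" where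
  "summand j v w = (if j \<in> J then lam j * E j v * E j w else 0)"

definition Rem :: "nat \<Rightarrow> ((nat ^ 'd) \<times> (real ^ 'd)) \<times> ((nat ^ 'd) \<times> (real ^ 'd)) \<Rightarrow> real" where
  "Rem n p = H p - (\<Sum>j<n. summand j (fst p) (snd p))"

lemma sum_summand: "(\<Sum>j<n. summand j v w) = (\<Sum>j\<in>J \<inter> {..<n}. lam j * E j v * E j w)"
  unfolding summand_def by (simp add: sum.If_cases Int_commute)

lemma summand_bdd: "bdd_measurable (N \<Otimes>\<^sub>M N) (\<lambda>p. summand j (fst p) (snd p))"
  unfolding summand_def
  by (cases "j \<in> J")
     (auto intro!: bdd_measurable_mult bdd_measurable_const bdd_measurable_compose[OF E_bdd])

lemma Rem_bdd: "bdd_measurable (N \<Otimes>\<^sub>M N) (Rem n)"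
  unfolding Rem_def by (intro bdd_measurable_diff bdd_measurable_sum summand_bdd H_bdd)

lemma integral_Rem_section:
  assumes f: "bdd_measurable N f" and w: "w \<in> space N"
  shows "(\<integral>v. Rem n (w, v) * f v \<partial>N) = PH.op f w - (\<Sum>j\<in>J \<inter> {..<n}. lam j * E j w * a j f)"
proof -
  have Ef: "integrable N (\<lambda>v. lam j * E j w * (E j v * f v))" if "j \<in> J" for j
    by (intro N.bdd_measurable_integrable bdd_measurable_cmult bdd_measurable_mult E_bdd[OF that] f)
  have Hf: "integrable N (\<lambda>v. H (w, v) * f v)"
    by (intro N.bdd_measurable_integrable bdd_measurable_mult H_section_bdd(2)[OF w] f)
  have "(\<integral>v. Rem n (w, v) * f v \<partial>N) =
      (\<integral>v. H (w, v) * f v - (\<Sum>j\<in>J \<inter> {..<n}. lam j * E j w * (E j v * f v)) \<partial>N)"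
    by (intro Bochner_Integration.integral_cong refl)
       (simp add: Rem_def sum_summand left_diff_distrib sum_distrib_right mult.assoc)
  also have "\<dots> = PH.op f w - (\<Sum>j\<in>J \<inter> {..<n}. \<integral>v. lam j * E j w * (E j v * f v) \<partial>N)"
    using Hf Ef by (subst Bochner_Integration.integral_diff)
      (auto simp: PH.op_def intro!: Bochner_Integration.integrable_sum Bochner_Integration.integral_sum)
  finally show ?thesis by (simp add: a_def)
qed

lemma quadratic_Rem:
  assumes f: "bdd_measurable N f"
  shows "(\<integral>p. Rem n p * (f (fst p) * f (snd p)) \<partial>(N \<Otimes>\<^sub>M N)) = quad f - (\<Sum>j\<in>J \<inter> {..<n}. lam j * (a j f)\<^sup>2)"
proof -
  have Ef: "integrable N (\<lambda>w. lam j * a j f * (E j w * f w))" if "j \<in> J" for j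
    by (intro N.bdd_measurable_integrable bdd_measurable_cmult bdd_measurable_mult E_bdd[OF that] f)
  have opf: "integrable N (\<lambda>w. PH.op f w * f w)"
    by (intro N.bdd_measurable_integrable bdd_measurable_mult PH.op_bdd f)
  have "(\<integral>p. Rem n p * (f (fst p) * f (snd p)) \<partial>(N \<Otimes>\<^sub>M N)) = (\<integral>w. (\<integral>v. Rem n (w, v) * f v \<partial>N) * f w \<partial>N)"
    by (rule N.Fubini_quadratic[OF Rem_bdd f f, symmetric])
  also have "\<dots> = (\<integral>w. PH.op f w * f w - (\<Sum>j\<in>J \<inter> {..<n}. lam j * a j f * (E j w * f w)) \<partial>N)"
    using integral_Rem_section[OF f]
    by (intro Bochner_Integration.integral_cong refl)
       (simp add: right_diff_distrib sum_distrib_left sum_distrib_right mult_ac)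
  also have "\<dots> = quad f - (\<Sum>j\<in>J \<inter> {..<n}. \<integral>w. lam j * a j f * (E j w * f w) \<partial>N)"
    using opf Ef by (subst Bochner_Integration.integral_diff)
      (auto simp: quad_def intro!: Bochner_Integration.integrable_sum Bochner_Integration.integral_sum)
  finally show ?thesis by (simp add: a_def power2_eq_square mult.assoc)
qed

lemma summand_continuous:
  assumes "\<alpha> \<in> A" "\<beta> \<in> A"
  shows "continuous_on (\<Theta> \<times> \<Theta>) (\<lambda>p. summand j (\<alpha>, fst p) (\<beta>, snd p))"
proof (cases "j \<in> J")
  case True
  have "continuous_on \<Theta> (classical_deriv \<gamma> (e j))" if "\<gamma> \<in> A" for \<gamma>
    using e_C_k[OF True] that by (simp add: C_k_def classical_deriv_def len_A)
  note c = continuous_on_compose2[OF this, of _ "\<Theta> \<times> \<Theta>"]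
  have "continuous_on (\<Theta> \<times> \<Theta>) (\<lambda>p. classical_deriv \<alpha> (e j) (fst p))"
    "continuous_on (\<Theta> \<times> \<Theta>) (\<lambda>p. classical_deriv \<beta> (e j) (snd p))"
    using assms by (auto intro!: c continuous_intros)
  then show ?thesis using True by (simp add: summand_def jet_def continuous_on_mult continuous_on_const)
qed (simp add: summand_def)

lemma Rem_continuous:
  assumes "\<alpha> \<in> A" "\<beta> \<in> A"
  shows "continuous_on (\<Theta> \<times> \<Theta>) (\<lambda>p. Rem n ((\<alpha>, fst p), (\<beta>, snd p)))"
proof -
  have "continuous_on (\<Theta> \<times> \<Theta>) (\<lambda>p. H ((\<alpha>, fst p), (\<beta>, snd p)))"
    using kd_regular(3)[of "map Inl (mi_dirs \<alpha>) @ map Inr (mi_dirs \<beta>)"] assms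
    by (simp add: H_eq admissible_Inl_Inr len_A)
  moreover have "continuous_on (\<Theta> \<times> \<Theta>) (\<lambda>p. summand j (\<alpha>, fst p) (\<beta>, snd p))" for j
    using summand_continuous[OF assms] .
  ultimately show ?thesis unfolding Rem_def fst_conv snd_conv by (intro continuous_intros)
qed

text \<open>Testing the quadratic form of the remainder on the indicator of a small ball shows that the
  remainder is non-negative on the diagonal.\<close>

lemma Rem_diag_nonneg:
  assumes w: "w \<in> space N"
  shows "0 \<le> Rem n (w, w)"
proof (rule ccontr)
  assume neg: "\<not> 0 \<le> Rem n (w, w)"
  obtain \<alpha> x where w': "w = (\<alpha>, x)" "\<alpha> \<in> A" "x \<in> \<Theta>" using w by auto
  define \<phi> where "\<phi> p = Rem n ((\<alpha>, fst p), (\<alpha>, snd p))" for p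
  \<comment> \<open>Half of the deficit, so that the kernel stays below -\<epsilon> on a whole
    neighbourhood.\<close>
  define \<epsilon> where "\<epsilon> = - \<phi> (x, x) / 2"
  have \<epsilon>: "\<epsilon> > 0" using neg by (simp add: \<epsilon>_def \<phi>_def w')
  have "continuous_on (\<Theta> \<times> \<Theta>) \<phi>" unfolding \<phi>_def by (rule Rem_continuous[OF w'(2,2)])
  then have "isCont \<phi> (x, x)"
    using w'(3) \<Theta>(1) by (simp add: continuous_on_eq_continuous_at open_Times)
  then obtain d where d: "d > 0" "\<And>p. dist p (x, x) < d \<Longrightarrow> \<bar>\<phi> p - \<phi> (x, x)\<bar> < \<epsilon>"
    using \<epsilon> unfolding continuous_at_eps_delta dist_real_def by blast
  obtain r where r: "r > 0" "ball x r \<subseteq> \<Theta>" using \<Theta>(1) w'(3) openE by blast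
  \<comment> \<open>Half of \<open>d\<close> for each factor, as the product distance is at most the
    sum of the two distances.\<close>
  define b where "b = ball x (min r (d / 2))"
  have b: "b \<subseteq> \<Theta>" using r(2) by (auto simp: b_def)
  have \<phi>b: "\<phi> (y, z) \<le> - \<epsilon>" if "y \<in> b" "z \<in> b" for y z
  proof -
    have "dist (y, z) (x, x) \<le> dist y x + dist z x"
      unfolding dist_prod_def by (simp add: sqrt_sum_squares_le_sum)
    also have "\<dots> < d" using that by (auto simp: b_def dist_commute)
    finally show ?thesis using d(2)[of "(y, z)"] by (simp add: \<epsilon>_def)
  qed
  \<comment> \<open>Supported on the single multi-index \<alpha>, \<open>f\<close> lets the form see
    only the diagonal block of \<alpha>.\<close>
  define f :: "(nat ^ 'd) \<times> (real ^ 'd) \<Rightarrow> real" where "f v = indicator ({\<alpha>} \<times> b) v" for v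
  have bL: "b \<in> sets L" using b \<Theta>(1) unfolding L_def b_def by (subst sets_restrict_space_iff) auto
  have f: "bdd_measurable N f"
  proof (rule bdd_measurableI[of _ _ 1])
    have "{\<alpha>} \<times> b \<in> sets N" unfolding N_def using bL w'(2) by (intro pair_measureI) auto
    then show "f \<in> borel_measurable N" unfolding f_def by (intro borel_measurable_indicator)
  qed (simp add: f_def indicator_def)
  have "emeasure L b = emeasure lborel b"
    using b \<Theta>(1) unfolding L_def by (subst emeasure_restrict_space) (auto simp: b_def)
  then have "measure L b > 0"
    using content_ball_pos[of "min r (d / 2)" x] r(1) d(1) by (simp add: measure_def b_def)
  moreover have "(\<integral>v. f v \<partial>N) = measure L b"
  proof -
    have "(\<integral>v. f v \<partial>N) = (\<Sum>\<gamma>\<in>A. \<integral>y. f (\<gamma>, y) \<partial>L)" by (rule integral_N[OF f])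
    also have "\<dots> = (\<Sum>\<gamma>\<in>A. if \<gamma> = \<alpha> then measure L b else 0)"
    proof (intro sum.cong refl)
      fix \<gamma>
      have "(\<lambda>y. f (\<gamma>, y)) = (if \<gamma> = \<alpha> then indicator b else (\<lambda>_. 0))"
        by (auto simp: f_def indicator_def fun_eq_iff)
      then show "(\<integral>y. f (\<gamma>, y) \<partial>L) = (if \<gamma> = \<alpha> then measure L b else 0)"
        using b by (simp add: Int_absorb2)
    qed
    finally show ?thesis using w'(2) by simp
  qed
  ultimately have If: "(\<integral>v. f v \<partial>N) > 0" by simp
  have ff: "bdd_measurable (N \<Otimes>\<^sub>M N) (\<lambda>p. f (fst p) * f (snd p))"
    by (intro bdd_measurable_mult bdd_measurable_compose[OF f]) measurable
  have "0 \<le> quad f - (\<Sum>j\<in>J \<inter> {..<n}. lam j * (a j f)\<^sup>2)"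
    using Bessel[of "J \<inter> {..<n}" f] f by simp
  also have "\<dots> = (\<integral>p. Rem n p * (f (fst p) * f (snd p)) \<partial>(N \<Otimes>\<^sub>M N))"
    by (rule quadratic_Rem[OF f, symmetric])
  also have "\<dots> \<le> (\<integral>p. - \<epsilon> * (f (fst p) * f (snd p)) \<partial>(N \<Otimes>\<^sub>M N))"
  proof (rule integral_mono)
    show "integrable (N \<Otimes>\<^sub>M N) (\<lambda>p. Rem n p * (f (fst p) * f (snd p)))"
      by (intro NN.bdd_measurable_integrable bdd_measurable_mult[OF Rem_bdd ff])
    show "integrable (N \<Otimes>\<^sub>M N) (\<lambda>p. - \<epsilon> * (f (fst p) * f (snd p)))"
      by (intro NN.bdd_measurable_integrable bdd_measurable_cmult ff)
    fix p :: "((nat ^ 'd) \<times> (real ^ 'd)) \<times> ((nat ^ 'd) \<times> (real ^ 'd))"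
    show "Rem n p * (f (fst p) * f (snd p)) \<le> - \<epsilon> * (f (fst p) * f (snd p))"
      using \<phi>b by (cases p) (auto simp: f_def \<phi>_def indicator_def)
  qed
  also have "\<dots> = - \<epsilon> * ((\<integral>v. f v \<partial>N) * (\<integral>v. f v \<partial>N))"
    by (simp add: N.integral_product_bdd[OF f f])
  also have "\<dots> < 0" using If \<epsilon> by (simp add: mult_pos_pos)
  finally show False by simp
qed

lemma H_bound: "\<exists>B\<ge>0. \<forall>p\<in>space (N \<Otimes>\<^sub>M N). \<bar>H p\<bar> \<le> B"
  using bdd_measurable_bound[OF H_bdd] by metis

definition B :: real where
  "B = (SOME B. B \<ge> 0 \<and> (\<forall>p\<in>space (N \<Otimes>\<^sub>M N). \<bar>H p\<bar> \<le> B))"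

lemma B: "B \<ge> 0" "v \<in> space N \<Longrightarrow> w \<in> space N \<Longrightarrow> \<bar>H (v, w)\<bar> \<le> B"
  using someI_ex[of "\<lambda>B. B \<ge> 0 \<and> (\<forall>p\<in>space (N \<Otimes>\<^sub>M N). \<bar>H p\<bar> \<le> B)"] H_bound
  unfolding B_def[symmetric] by (auto simp: space_pair_measure)

lemma summand_diag_nonneg: "0 \<le> summand j w w"
proof (cases "j \<in> J")
  case True
  then have "0 \<le> lam j * (E j w * E j w)" by (intro mult_nonneg_nonneg[OF less_imp_le[OF lam_pos]
      zero_le_square])
  then show ?thesis using True by (simp add: summand_def mult.assoc)
qed (simp add: summand_def)

lemma sum_summand_diag_le: "w \<in> space N \<Longrightarrow> (\<Sum>j<n. summand j w w) \<le> B"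
  using Rem_diag_nonneg[of w n] B(2)[of w w] by (simp add: Rem_def)

text \<open>The arithmetic-geometric mean inequality moves off-diagonal terms to the diagonal, where
  all terms are non-negative and their sums are bounded.\<close>

lemma abs_summand_le: "\<bar>summand j v w\<bar> \<le> (summand j v v + summand j w w) / 2"
proof (cases "j \<in> J")
  case True
  have "2 * \<bar>E j v * E j w\<bar> \<le> E j v * E j v + E j w * E j w"
    using sum_squares_bound[of "\<bar>E j v\<bar>" "\<bar>E j w\<bar>"] by (simp add: power2_eq_square abs_mult)
  then have "lam j * (2 * \<bar>E j v * E j w\<bar>) \<le> lam j * (E j v * E j v + E j w * E j w)"
    using lam_pos[OF True] by (intro mult_left_mono) auto
  then show ?thesis using True lam_pos[OF True] by (simp add: summand_def abs_mult algebra_simps)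
qed (simp add: summand_def)

lemma summable_summand:
  assumes "v \<in> space N" "w \<in> space N"
  shows "summable (\<lambda>j. summand j v w)"
proof -
  have "summable (\<lambda>j. summand j u u)" if "u \<in> space N" for u
    by (rule summableI_nonneg_bounded[OF summand_diag_nonneg sum_summand_diag_le[OF that]])
  then have "summable (\<lambda>j. (summand j v v + summand j w w) / 2)" using assms by (intro
      summable_divide summable_add)
  then show ?thesis by (rule summable_comparison_test'[of _ 0]) (use abs_summand_le in auto)
qed

lemma Rem_le:
  assumes "v \<in> space N" "w \<in> space N"
  shows "\<bar>Rem n (v, w)\<bar> \<le> 2 * B"
proof -
  have "\<bar>\<Sum>j<n. summand j v w\<bar> \<le> (\<Sum>j<n. (summand j v v + summand j w w) / 2)"
    by (rule order_trans[OF sum_abs sum_mono]) (rule abs_summand_le)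
  also have "\<dots> = ((\<Sum>j<n. summand j v v) + (\<Sum>j<n. summand j w w)) / 2"
    by (simp add: sum.distrib sum_divide_distrib[symmetric])
  also have "\<dots> \<le> B" using sum_summand_diag_le[OF assms(1), of n] sum_summand_diag_le[OF assms(2), of n]
    by (simp add: field_simps)
  finally show ?thesis using B(2)[OF assms] by (simp add: Rem_def)
qed

text \<open>A trace bound: integrating the diagonal of a partial sum gives the sum of its
  eigenvalues, because each \<open>E j\<close> has norm 1, and that diagonal is at most
  \<open>B\<close>.\<close>

lemma sum_lam_le: "finite I \<Longrightarrow> I \<subseteq> J \<Longrightarrow> sum lam I \<le> B * measure N (space N)"
proof -
  assume I: "finite I" "I \<subseteq> J"
  then obtain n where n: "I \<subseteq> {..<n}" using finite_nat_iff_bounded by blast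
  have int: "integrable N (\<lambda>w. lam j * (E j w * E j w))" if "j \<in> J" for j
    by (intro N.bdd_measurable_integrable bdd_measurable_cmult bdd_measurable_mult E_bdd that)
  have "sum lam I \<le> sum lam (J \<inter> {..<n})"
    using I n lam_pos by (intro sum_mono2) (auto intro: less_imp_le)
  also have "\<dots> = (\<Sum>j\<in>J \<inter> {..<n}. \<integral>w. lam j * (E j w * E j w) \<partial>N)"
    using E_orthonormal by (intro sum.cong) auto
  also have "\<dots> = (\<integral>w. (\<Sum>j\<in>J \<inter> {..<n}. lam j * (E j w * E j w)) \<partial>N)"
    using int by (intro Bochner_Integration.integral_sum[symmetric]) auto
  also have "\<dots> \<le> (\<integral>w. B \<partial>N)"
  proof (rule integral_mono)
    show "integrable N (\<lambda>w. \<Sum>j\<in>J \<inter> {..<n}. lam j * (E j w * E j w))"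
      using int by (intro Bochner_Integration.integrable_sum) auto
    show "(\<Sum>j\<in>J \<inter> {..<n}. lam j * (E j w * E j w)) \<le> B" if "w \<in> space N" for w
      using sum_summand_diag_le[OF that, of n] by (simp add: sum_summand mult.assoc)
  qed simp
  finally show ?thesis by (simp add: mult.commute)
qed

lemma lam_summable: "lam summable_on J"
proof (rule nonneg_bdd_above_summable_on)
  show "bdd_above (sum lam ` {F. F \<subseteq> J \<and> finite F})"
    using sum_lam_le by (intro bdd_aboveI[of _ "B * measure N (space N)"]) auto
qed (use lam_pos less_imp_le in auto)

section \<open>The limit of the remainders\<close>

definition R :: "((nat ^ 'd) \<times> (real ^ 'd)) \<times> ((nat ^ 'd) \<times> (real ^ 'd)) \<Rightarrow> real" where
  "R p = H p - (\<Sum>j. summand j (fst p) (snd p))"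

lemma Rem_tendsto: "v \<in> space N \<Longrightarrow> w \<in> space N \<Longrightarrow> (\<lambda>n. Rem n (v, w)) \<longlonglongrightarrow> R (v, w)"
  unfolding Rem_def R_def fst_conv snd_conv
  by (intro tendsto_intros summable_LIMSEQ summable_summand)

lemma R_bdd: "bdd_measurable (N \<Otimes>\<^sub>M N) R"
proof (rule bdd_measurableI[of _ _ "2 * B"])
  show "R \<in> borel_measurable (N \<Otimes>\<^sub>M N)"
  proof (rule borel_measurable_LIMSEQ_real[of _ Rem])
    show "Rem n \<in> borel_measurable (N \<Otimes>\<^sub>M N)" for n by (rule bdd_measurableD[OF Rem_bdd])
  qed (use Rem_tendsto in \<open>auto simp: space_pair_measure\<close>)
  fix p assume "p \<in> space (N \<Otimes>\<^sub>M N)"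
  then obtain v w where p: "p = (v, w)" "v \<in> space N" "w \<in> space N" by (cases p) (auto simp: space_pair_measure)
  show "\<bar>R p\<bar> \<le> 2 * B"
    unfolding p by (rule LIMSEQ_le_const2[OF tendsto_rabs[OF Rem_tendsto[OF p(2,3)]]]) (use
        Rem_le[OF p(2,3)] in auto)
qed

lemma integral_R_section:
  assumes f: "bdd_measurable N f" and w: "w \<in> space N"
  shows "(\<lambda>n. PH.op f w - (\<Sum>j\<in>J \<inter> {..<n}. lam j * E j w * a j f)) \<longlonglongrightarrow> (\<integral>v. R (w, v) * f v \<partial>N)"
  unfolding integral_Rem_section[OF f w, symmetric]
proof (rule integral_dominated_convergence)
  show "integrable N (\<lambda>v. 2 * B * \<bar>f v\<bar>)" using N.bdd_measurable_integrable[OF f] by simp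
  show "AE v in N. (\<lambda>n. Rem n (w, v) * f v) \<longlonglongrightarrow> R (w, v) * f v"
    using Rem_tendsto w by (intro AE_I2 tendsto_mult_right) auto
  show "AE v in N. norm (Rem n (w, v) * f v) \<le> 2 * B * \<bar>f v\<bar>" for n
    using Rem_le[OF w] by (intro AE_I2) (auto simp: abs_mult intro!: mult_right_mono)
qed (use f in \<open>auto intro!: bdd_measurableD bdd_measurable_mult N.bdd_measurable_sections(1)[OF R_bdd w]
    N.bdd_measurable_sections(1)[OF Rem_bdd w]\<close>)

text \<open>Positivity is Bessel's inequality in the limit. With this interpretation
  \<open>eigenvector_exists\<close> becomes available for the remainder.\<close>

sublocale PR: pos_kernel N R
proof
  show "bdd_measurable (N \<Otimes>\<^sub>M N) R" by (rule R_bdd)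
  show "R (v, w) = R (w, v)" if "v \<in> space N" "w \<in> space N" for v w
    using H_sym[OF that] by (simp add: R_def summand_def mult_ac cong: if_cong)
  fix f assume f: "bdd_measurable N f"
  have ff: "bdd_measurable (N \<Otimes>\<^sub>M N) (\<lambda>p. f (fst p) * f (snd p))"
    by (intro bdd_measurable_mult bdd_measurable_compose[OF f]) measurable
  have "(\<lambda>n. \<integral>p. Rem n p * (f (fst p) * f (snd p)) \<partial>(N \<Otimes>\<^sub>M N)) \<longlonglongrightarrow> (\<integral>p. R p * (f (fst p) * f (snd p)) \<partial>(N \<Otimes>\<^sub>M N))"
  proof (rule integral_dominated_convergence)
    show "integrable (N \<Otimes>\<^sub>M N) (\<lambda>p. 2 * B * \<bar>f (fst p) * f (snd p)\<bar>)"
      using NN.bdd_measurable_integrable[OF ff] by (intro integrable_mult_right integrable_abs)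
    show "AE p in N \<Otimes>\<^sub>M N. (\<lambda>n. Rem n p * (f (fst p) * f (snd p))) \<longlonglongrightarrow> R p * (f (fst p) * f (snd p))"
      using Rem_tendsto by (intro AE_I2 tendsto_mult_right) (auto simp: space_pair_measure)
    show "AE p in N \<Otimes>\<^sub>M N. norm (Rem n p * (f (fst p) * f (snd p))) \<le> 2 * B * \<bar>f (fst p) * f (snd p)\<bar>" for n
    proof (intro AE_I2)
      fix p assume "p \<in> space (N \<Otimes>\<^sub>M N)"
      then have "\<bar>Rem n p\<bar> \<le> 2 * B" using Rem_le by (cases p) (simp add: space_pair_measure)
      then show "norm (Rem n p * (f (fst p) * f (snd p))) \<le> 2 * B * \<bar>f (fst p) * f (snd p)\<bar>"
        unfolding real_norm_def abs_mult[of "Rem n p"] by (rule mult_right_mono) simp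
    qed
  qed (use bdd_measurableD[OF bdd_measurable_mult[OF R_bdd ff]] bdd_measurableD[OF
      bdd_measurable_mult[OF Rem_bdd ff]] in auto)
  moreover have "0 \<le> (\<integral>p. Rem n p * (f (fst p) * f (snd p)) \<partial>(N \<Otimes>\<^sub>M N))" for n
    using Bessel[of "J \<inter> {..<n}" f] f by (simp add: quadratic_Rem)
  ultimately have "0 \<le> (\<integral>p. R p * (f (fst p) * f (snd p)) \<partial>(N \<Otimes>\<^sub>M N))" by (intro LIMSEQ_le_const) auto
  then show "0 \<le> (\<integral>x. (\<integral>y. R (x, y) * f y \<partial>N) * f x \<partial>N)" by (simp add: N.Fubini_quadratic[OF R_bdd f f])
qed

text \<open>Once the partial sum includes the index \<open>i\<close>, orthonormality makes it
  reproduce \<open>PH.op (E i)\<close> exactly.\<close>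

lemma op_R_E:
  assumes i: "i \<in> J" and w: "w \<in> space N"
  shows "PR.op (E i) w = 0"
proof -
  have "PH.op (E i) w - (\<Sum>j\<in>J \<inter> {..<n}. lam j * E j w * a j (E i)) = 0" if "n > i" for n
  proof -
    have "(\<Sum>j\<in>J \<inter> {..<n}. lam j * E j w * a j (E i)) = (\<Sum>j\<in>J \<inter> {..<n}. if j = i then lam i * E i w else 0)"
      using E_orthonormal[OF _ i] by (intro sum.cong) (auto simp: a_def)
    then show ?thesis using that i E_eigen[OF i w] by simp
  qed
  then have "\<forall>\<^sub>F n in sequentially. PH.op (E i) w - (\<Sum>j\<in>J \<inter> {..<n}. lam j * E j w * a j (E i)) = 0"
    by (rule eventually_mono[OF eventually_gt_at_top[of i]])
  then have "(\<lambda>n. PH.op (E i) w - (\<Sum>j\<in>J \<inter> {..<n}. lam j * E j w * a j (E i))) \<longlonglongrightarrow> 0"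
    by (rule tendsto_eventually)
  then show ?thesis using integral_R_section[OF E_bdd[OF i] w] LIMSEQ_unique unfolding PR.op_def by blast
qed

text \<open>An eigenfunction of the remainder is orthogonal to all \<open>E j\<close>, hence an eigenfunction of the
  original operator that the eigensystem does not account for.\<close>

lemma op_R_zero:
  assumes f0: "bdd_measurable N f0"
  shows "AE w in N. PR.op f0 w = 0"
proof (rule ccontr)
  assume "\<not> (AE w in N. PR.op f0 w = 0)"
  then obtain \<rho> F where \<rho>: "\<rho> > 0" and F: "bdd_measurable N F"
    and F_pos: "0 < (\<integral>x. F x * F x \<partial>N)" and eig: "\<And>w. w \<in> space N \<Longrightarrow> PR.op F w = \<rho> * F w"
    using PR.eigenvector_exists[OF f0] by blast
  \<comment> \<open>The remainder operator has the eigenvalue \<rho> at \<open>F\<close> and 0 at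
    \<open>E j\<close>; eigenfunctions for different eigenvalues are orthogonal.\<close>
  have orth: "a j F = 0" if j: "j \<in> J" for j
  proof -
    have "\<rho> * a j F = (\<integral>w. PR.op F w * E j w \<partial>N)"
      unfolding a_def integral_mult_right_zero[symmetric]
      using eig by (intro Bochner_Integration.integral_cong refl) (simp only: mult_ac)
    also have "\<dots> = (\<integral>w. F w * PR.op (E j) w \<partial>N)" by (rule PR.op_self_adjoint[OF F E_bdd[OF j]])
    also have "\<dots> = (\<integral>w. 0 \<partial>N)" using op_R_E[OF j] by (intro Bochner_Integration.integral_cong refl) simp
    finally show ?thesis using \<rho> by simp
  qed
  have opF: "PH.op F w = \<rho> * F w" if w: "w \<in> space N" for w
  proof -
    have "(\<lambda>n :: nat. PH.op F w) \<longlonglongrightarrow> PR.op F w"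
      using integral_R_section[OF F w] orth by (simp add: PR.op_def)
    then show ?thesis using eig[OF w] by (simp add: LIMSEQ_const_iff)
  qed
  have HF: "(\<integral>v. H (v, w) * F v \<partial>N) = \<rho> * F w" if w: "w \<in> space N" for w
  proof -
    have "(\<integral>v. H (v, w) * F v \<partial>N) = PH.op F w"
      unfolding PH.op_def using H_sym w by (intro Bochner_Integration.integral_cong refl) auto
    then show ?thesis using opF[OF w] by simp
  qed
  \<comment> \<open>Division by \<rho> makes the jet of \<open>T F'\<close> equal to
    \<open>F\<close>, so that \<open>F\<close> comes from a function on \<Theta>.\<close>
  define F' where "F' w = 1 / \<rho> * F w" for w
  have F': "bdd_measurable N F'" unfolding F'_def by (rule bdd_measurable_cmult[OF F])
  define f where "f = T F'"
  have f: "f \<in> C_k k \<Theta>" unfolding f_def by (rule T_C_k[OF F'])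
  have jf: "jet f w = F w" if w: "w \<in> space N" for w
  proof -
    have "jet f w = (\<integral>v. 1 / \<rho> * (H (v, w) * F v) \<partial>N)"
      unfolding f_def jet_T[OF F' w] F'_def by (simp only: mult_ac)
    also have "\<dots> = 1 / \<rho> * (\<rho> * F w)" by (simp only: integral_mult_right_zero HF[OF w])
    finally show ?thesis using \<rho> by simp
  qed
  obtain c where "\<And>w. w \<in> space N \<Longrightarrow> \<bar>F w\<bar> \<le> c" using F unfolding bdd_measurable_def by blast
  then have jf_bdd: "bdd_measurable N (jet f)" using jf by (intro jet_bdd[OF f, of c]) simp
  have "eigenfunction \<Theta> k h \<rho> f"
    unfolding eigenfunction_def
  proof (intro conjI sobolevI[OF f jf_bdd] AE_I2)
    fix y assume y: "y \<in> space (lebesgue_on \<Theta>)"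
    then have w: "(0, y) \<in> space N" by simp
    have "kernel_op \<Theta> k h f y = T (jet f) y" using kernel_op_eq[OF f jf_bdd] y by simp
    also have "\<dots> = (\<integral>v. H (v, (0, y)) * F v \<partial>N)"
      unfolding T_def using jf by (intro Bochner_Integration.integral_cong refl) (simp only:)
    also have "\<dots> = \<rho> * f y" using HF[OF w] jf[OF w] by (simp add: jet_0)
    finally show "kernel_op \<Theta> k h f y = \<rho> * f y" .
  qed
  moreover have "finite {j \<in> J. lam j = \<rho>} \<and> (\<forall>f. eigenfunction \<Theta> k h \<rho> f \<longrightarrow>
      (\<exists>c. AE y in lebesgue_on \<Theta>. f y = (\<Sum>j | j \<in> J \<and> lam j = \<rho>. c j * e j y)))"
    using es \<rho> by (simp add: eigensystem_def)
  ultimately obtain c where fin: "finite {j \<in> J. lam j = \<rho>}"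
    and ae: "AE y in lebesgue_on \<Theta>. f y = (\<Sum>j | j \<in> J \<and> lam j = \<rho>. c j * e j y)" by blast
  have fe: "f y = (\<Sum>j | j \<in> J \<and> lam j = \<rho>. c j * e j y)" if "y \<in> \<Theta>" for y
    by (rule continuous_AE_eq[OF \<Theta>(1) C_k_continuous[OF f] _ ae that])
       (intro continuous_intros C_k_continuous[OF e_C_k], simp)
  have FE: "F w = (\<Sum>j | j \<in> J \<and> lam j = \<rho>. c j * E j w)" if w: "w \<in> space N" for w
    unfolding jf[OF w, symmetric] by (rule jet_sum[OF fin _ fe w]) (use e_C_k in auto)
  \<comment> \<open>\<open>F\<close> is now a combination of functions \<open>E j\<close> to which
    it is orthogonal, so its norm vanishes.\<close>
  have "(\<integral>w. F w * F w \<partial>N) = (\<integral>w. (\<Sum>j | j \<in> J \<and> lam j = \<rho>. c j * (E j w * F w)) \<partial>N)"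
  proof (intro Bochner_Integration.integral_cong refl)
    fix w assume "w \<in> space N"
    from FE[OF this] have "F w * F w = (\<Sum>j | j \<in> J \<and> lam j = \<rho>. c j * E j w) * F w" by (simp only:)
    then show "F w * F w = (\<Sum>j | j \<in> J \<and> lam j = \<rho>. c j * (E j w * F w))"
      by (simp only: sum_distrib_right mult.assoc)
  qed
  also have "\<dots> = (\<Sum>j | j \<in> J \<and> lam j = \<rho>. \<integral>w. c j * (E j w * F w) \<partial>N)"
    by (rule Bochner_Integration.integral_sum)
       (auto intro!: N.bdd_measurable_integrable bdd_measurable_cmult bdd_measurable_mult E_bdd F
           simp del: integrable_mult_right_iff)
  also have "\<dots> = 0" using orth by (simp add: a_def)
  finally show False using F_pos by simp
qed

end

section \<open>The expansion of the kernel\<close>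

context kernel_eigensystem
begin

text \<open>A word reorders the directions of some multi-index \<open>\<gamma>\<close>, and the
  square integral of that derivative is one of the non-negative terms that add up to the squared
  norm 1.\<close>

lemma iter_partial_L2_le_1:
  assumes j: "j \<in> J" and w: "length w \<le> k"
  shows "(\<integral>\<^sup>+ y. ennreal (indicator \<Theta> y * (iter_partial (map coord_dir w) (e j) y)\<^sup>2) \<partial>lborel) \<le> 1"
proof -
  define \<gamma> :: "nat ^ 'd" where "\<gamma> = (\<chi> i. count_list w i)"
  have perm: "mset w = mset (mi_dirs \<gamma>)"
    by (rule multiset_eqI) (simp add: count_mset count_list_mi_dirs \<gamma>_def)
  then have \<gamma>: "\<gamma> \<in> A" using w by (metis len_A size_mset)
  have eq: "iter_partial (map coord_dir w) (e j) y = E j (\<gamma>, y)" if "y \<in> \<Theta>" for y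
    using C_k_perm[OF \<Theta>(1) e_C_k[OF j] perm w that] by (simp add: jet_def classical_deriv_def)
  have EE: "bdd_measurable N (\<lambda>v. E j v * E j v)" by (intro bdd_measurable_mult E_bdd j)
  have int: "integrable L (\<lambda>y. E j (\<alpha>, y) * E j (\<alpha>, y))" if "\<alpha> \<in> A" for \<alpha>
    by (rule L.bdd_measurable_integrable[OF bdd_measurable_N_section[OF EE that]])
  have "(\<integral>\<^sup>+ y. ennreal (indicator \<Theta> y * (iter_partial (map coord_dir w) (e j) y)\<^sup>2) \<partial>lborel) =
      (\<integral>\<^sup>+ y. ennreal (E j (\<gamma>, y) * E j (\<gamma>, y)) * indicator \<Theta> y \<partial>lborel)"
    by (intro nn_integral_cong) (auto simp: indicator_def eq power2_eq_square)
  also have "\<dots> = (\<integral>\<^sup>+ y. ennreal (E j (\<gamma>, y) * E j (\<gamma>, y)) \<partial>L)"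
    unfolding L_def using \<Theta>(1) by (subst nn_integral_restrict_space) auto
  also have "\<dots> = ennreal (\<integral>y. E j (\<gamma>, y) * E j (\<gamma>, y) \<partial>L)"
    by (rule nn_integral_eq_integral[OF int[OF \<gamma>]]) simp
  also have "\<dots> \<le> ennreal (\<Sum>\<alpha>\<in>A. \<integral>y. E j (\<alpha>, y) * E j (\<alpha>, y) \<partial>L)"
    by (intro ennreal_leI member_le_sum[OF \<gamma>, of "\<lambda>\<alpha>. \<integral>y. E j (\<alpha>, y) * E j (\<alpha>, y) \<partial>L"]) auto
  also have "\<dots> = 1" using integral_N[OF EE] E_orthonormal[OF j j] by simp
  finally show ?thesis .
qed

lemma AE_L_continuous_eq_0:
  assumes "continuous_on \<Theta> f" "AE x in L. f x = 0" "x \<in> \<Theta>"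
  shows "f x = (0 :: real)"
proof -
  have "AE x in lborel. x \<in> \<Theta> \<longrightarrow> f x = 0"
    using assms(2) \<Theta>(1) unfolding L_def by (subst (asm) AE_restrict_space_iff) auto
  from AE_completion[OF this] have "AE x in lebesgue_on \<Theta>. f x = 0"
    using \<Theta>(1) by (subst AE_restrict_space_iff) auto
  from continuous_AE_eq[OF \<Theta>(1) assms(1) _ this assms(3)] show ?thesis by simp
qed

context
  fixes s :: nat and C :: real
  assumes s: "s \<le> k" and C: "C > 0"
    and bound: "\<And>j \<alpha> x. j \<in> J \<Longrightarrow> mi_order \<alpha> \<le> s \<Longrightarrow> x \<in> \<Theta> \<Longrightarrow> \<bar>classical_deriv \<alpha> (e j) x\<bar> \<le> C"
begin

lemma low_order_A: "mi_order \<alpha> \<le> s \<Longrightarrow> \<alpha> \<in> A"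
  using s by (simp add: A_def)

lemma abs_summand_le_C:
  assumes "mi_order \<alpha> \<le> s" "mi_order \<beta> \<le> s" "x \<in> \<Theta>" "y \<in> \<Theta>"
  shows "\<bar>summand j (\<alpha>, x) (\<beta>, y)\<bar> \<le> C\<^sup>2 * (if j \<in> J then lam j else 0)"
proof (cases "j \<in> J")
  case True
  have "\<bar>E j (\<alpha>, x)\<bar> * \<bar>E j (\<beta>, y)\<bar> \<le> C * C"
    using bound[OF True] assms C by (intro mult_mono) (auto simp: jet_def)
  from mult_left_mono[OF this, of "lam j"] show ?thesis
    using True lam_pos[OF True] by (simp add: summand_def abs_mult power2_eq_square mult_ac)
qed (simp add: summand_def)

text \<open>The uniform bound on the derivatives and the summability of the eigenvalues give the
  majorant of the Weierstrass test. The bound \<open>C\<close> covers orders up to \<open>s\<close>,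
  whence the restriction on \<alpha> and \<beta>.\<close>

lemma R_continuous:
  assumes "mi_order \<alpha> \<le> s" "mi_order \<beta> \<le> s"
  shows "continuous_on (\<Theta> \<times> \<Theta>) (\<lambda>p. R ((\<alpha>, fst p), (\<beta>, snd p)))"
proof -
  have "summable (\<lambda>j. C\<^sup>2 * (if j \<in> J then lam j else 0))"
  proof (intro summable_mult summableI_nonneg_bounded[of _ "B * measure N (space N)"])
    show "(\<Sum>j<n. if j \<in> J then lam j else 0) \<le> B * measure N (space N)" for n
      using sum_lam_le[of "J \<inter> {..<n}"] by (simp add: sum.If_cases Int_commute)
  qed (use lam_pos less_imp_le in auto)
  then have "uniform_limit (\<Theta> \<times> \<Theta>) (\<lambda>n p. \<Sum>j<n. summand j (\<alpha>, fst p) (\<beta>, snd p))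
      (\<lambda>p. \<Sum>j. summand j (\<alpha>, fst p) (\<beta>, snd p)) sequentially"
  proof (rule Weierstrass_m_test[where M = "\<lambda>j. C\<^sup>2 * (if j \<in> J then lam j else 0)", rotated])
    fix j p assume "p \<in> \<Theta> \<times> \<Theta>"
    then show "norm (summand j (\<alpha>, fst p) (\<beta>, snd p)) \<le> C\<^sup>2 * (if j \<in> J then lam j else 0)"
      unfolding real_norm_def by (intro abs_summand_le_C assms) auto
  qed
  then have "continuous_on (\<Theta> \<times> \<Theta>) (\<lambda>p. \<Sum>j. summand j (\<alpha>, fst p) (\<beta>, snd p))"
    by (intro uniform_limit_theorem[rotated])
       (auto intro!: always_eventually continuous_on_sum summand_continuous low_order_A assms)
  moreover have "continuous_on (\<Theta> \<times> \<Theta>) (\<lambda>p. H ((\<alpha>, fst p), (\<beta>, snd p)))"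
    using kd_regular(3)[of "map Inl (mi_dirs \<alpha>) @ map Inr (mi_dirs \<beta>)"] low_order_A[OF assms(1)]
        low_order_A[OF assms(2)]
    by (simp add: H_eq admissible_Inl_Inr len_A)
  ultimately show ?thesis unfolding R_def fst_conv snd_conv by (intro continuous_intros)
qed

text \<open>The remainder operator is applied to the row of \<open>R\<close> at
  \<open>(\<alpha>, x0)\<close>, cut down to the multi-index \<beta>. At that same point the result
  is the integral of the squared row, so the row vanishes almost everywhere and, being continuous,
  everywhere.\<close>

lemma R_eq_0:
  assumes \<alpha>: "mi_order \<alpha> \<le> s" and \<beta>: "mi_order \<beta> \<le> s" and x0: "x0 \<in> \<Theta>" and y0: "y0 \<in> \<Theta>"
  shows "R ((\<alpha>, x0), (\<beta>, y0)) = 0"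
proof -
  have A: "\<alpha> \<in> A" "\<beta> \<in> A" using low_order_A \<alpha> \<beta> by auto
  define r where "r x y = R ((\<alpha>, x), (\<beta>, y))" for x y
  have cont: "continuous_on (\<Theta> \<times> \<Theta>) (\<lambda>p. r (fst p) (snd p))" unfolding r_def by (rule R_continuous[OF \<alpha> \<beta>])
  have c1: "continuous_on \<Theta> (\<lambda>x. r x y)" if "y \<in> \<Theta>" for y
  proof -
    have "continuous_on \<Theta> (\<lambda>x. (x, y))" by (intro continuous_on_Pair continuous_on_id continuous_on_const)
    from continuous_on_compose2[OF cont this] that show ?thesis by auto
  qed
  have c2: "continuous_on \<Theta> (r x)" if "x \<in> \<Theta>" for x
  proof -
    have "continuous_on \<Theta> (\<lambda>y. (x, y))" by (intro continuous_on_Pair continuous_on_id continuous_on_const)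
    from continuous_on_compose2[OF cont this] that show ?thesis by auto
  qed
  have r_le: "\<bar>r x y\<bar> \<le> 2 * B" if "x \<in> \<Theta>" "y \<in> \<Theta>" for x y
    unfolding r_def
    by (rule LIMSEQ_le_const2[OF tendsto_rabs[OF Rem_tendsto]]) (use Rem_le A that in auto)
  have r_bdd: "bdd_measurable L (r x)" if "x \<in> \<Theta>" for x
    using r_le that by (intro bdd_measurableI[of _ _ "2 * B"] continuous_measurable_L c2) auto
  define f where "f v = R ((\<alpha>, x0), v) * (if fst v = \<beta> then 1 else 0)" for v
  have f: "bdd_measurable N f"
    unfolding f_def
  proof (intro bdd_measurable_mult N.bdd_measurable_sections(1)[OF R_bdd] bdd_measurable_N)
    show "bdd_measurable L (\<lambda>x. if fst (\<gamma>, x) = \<beta> then 1 else 0)" for \<gamma>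
      by (cases "\<gamma> = \<beta>") (auto intro: bdd_measurable_const)
  qed (use A x0 in auto)
  \<comment> \<open>Continuity of \<open>\<psi>\<close> will allow evaluation at \<open>x0\<close>,
    about which vanishing almost everywhere alone says nothing.\<close>
  define \<psi> where "\<psi> x = (\<integral>y. r x y * r x0 y \<partial>L)" for x
  have op: "PR.op f (\<alpha>, x) = \<psi> x" if x: "x \<in> \<Theta>" for x
  proof -
    have "bdd_measurable N (\<lambda>v. R ((\<alpha>, x), v) * f v)"
      by (intro bdd_measurable_mult N.bdd_measurable_sections(1)[OF R_bdd] f) (use A x in auto)
    from integral_N[OF this] have "PR.op f (\<alpha>, x) = (\<Sum>\<gamma>\<in>A. \<integral>y. R ((\<alpha>, x), (\<gamma>, y)) * f (\<gamma>, y) \<partial>L)"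
      by (simp add: PR.op_def)
    also have "\<dots> = (\<Sum>\<gamma>\<in>A. if \<gamma> = \<beta> then \<psi> x else 0)"
      by (intro sum.cong refl) (auto simp: f_def \<psi>_def r_def)
    finally show ?thesis using A by simp
  qed
  \<comment> \<open>Vanishing almost everywhere on \<open>N\<close> holds for each single
    multi-index, since points have counting measure 1.\<close>
  from AL.AE_pair[of "\<lambda>v. PR.op f v = 0", folded N_def, OF op_R_zero[OF f]] have "AE x in L. PR.op f
      (\<alpha>, x) = 0" using A by (simp add: AE_count_space)
  then have ae: "AE x in L. \<psi> x = 0" using AE_space by eventually_elim (use op in auto)
  have "continuous_on \<Theta> \<psi>"
    unfolding continuous_on_sequentially comp_def
  proof (intro allI ballI impI, elim conjE)
    fix X a assume a: "a \<in> \<Theta>" and X: "\<forall>n. X n \<in> \<Theta>" "X \<longlonglongrightarrow> a"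
    show "(\<lambda>n. \<psi> (X n)) \<longlonglongrightarrow> \<psi> a"
      unfolding \<psi>_def
    proof (rule integral_dominated_convergence)
      show "integrable L (\<lambda>_. 2 * B * (2 * B))" by simp
      show "AE y in L. (\<lambda>n. r (X n) y * r x0 y) \<longlonglongrightarrow> r a y * r x0 y"
        using continuous_on_tendsto_compose[OF c1 X(2) a] X(1)
        by (intro AE_I2 tendsto_mult_right) auto
      show "AE y in L. norm (r (X n) y * r x0 y) \<le> 2 * B * (2 * B)" for n
        using r_le X(1) x0 B(1) by (intro AE_I2) (auto simp only: real_norm_def abs_mult space_L
            intro!: mult_mono)
    qed (use bdd_measurableD[OF bdd_measurable_mult[OF r_bdd r_bdd[OF x0]]] a X(1) in auto)
  qed
  from AE_L_continuous_eq_0[OF this ae x0] have "(\<integral>y. r x0 y * r x0 y \<partial>L) = 0" by (simp add: \<psi>_def)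
  then have "AE y in L. r x0 y * r x0 y = 0"
    using L.bdd_measurable_integrable[OF bdd_measurable_mult[OF r_bdd r_bdd, OF x0 x0]]
    by (subst (asm) integral_nonneg_eq_0_iff_AE) auto
  then have "AE y in L. r x0 y = 0" by eventually_elim simp
  from AE_L_continuous_eq_0[OF c2[OF x0] this y0] show ?thesis by (simp add: r_def)
qed

text \<open>As \<open>R\<close> vanishes, the error after \<open>m\<close> terms is the limit of
  finite blocks of the series, each dominated by C^2 times the corresponding block of
  eigenvalues.\<close>

lemma expansion_bound:
  assumes "mi_order \<alpha> \<le> s" "mi_order \<beta> \<le> s" and x: "x \<in> \<Theta>" and y: "y \<in> \<Theta>"
  shows "\<bar>mixed_deriv \<alpha> \<beta> h (x, y) - (\<Sum>j | j \<in> J \<and> j \<le> m. lam j * classical_deriv \<alpha> (e j) x *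
      classical_deriv \<beta> (e j) y)\<bar>
    \<le> C\<^sup>2 * (\<Sum>\<^sub>\<infinity>j\<in>{j \<in> J. j > m}. lam j)"
proof -
  let ?v = "(\<alpha>, x)" and ?w = "(\<beta>, y)"
  let ?S = "\<Sum>\<^sub>\<infinity>j\<in>{j \<in> J. j > m}. lam j"
  have vw: "?v \<in> space N" "?w \<in> space N" using low_order_A assms by auto
  have H: "mixed_deriv \<alpha> \<beta> h (x, y) = H (?v, ?w)" by (simp add: H_def)
  have fin: "(\<Sum>j | j \<in> J \<and> j \<le> m. lam j * classical_deriv \<alpha> (e j) x * classical_deriv \<beta> (e j) y) =
      (\<Sum>j<Suc m. summand j ?v ?w)"
    unfolding sum_summand by (intro sum.cong) (auto simp: jet_def)
  have lim: "(\<lambda>n. \<Sum>j<n. summand j ?v ?w) \<longlonglongrightarrow> H (?v, ?w)"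
    using summable_LIMSEQ[OF summable_summand[OF vw]] R_eq_0[OF assms] by (simp add: R_def)
  have "\<bar>(\<Sum>j<n. summand j ?v ?w) - (\<Sum>j<Suc m. summand j ?v ?w)\<bar> \<le> C\<^sup>2 * ?S" if n: "n \<ge> Suc m" for n
  proof -
    have "(\<Sum>j<n. summand j ?v ?w) - (\<Sum>j<Suc m. summand j ?v ?w) = (\<Sum>j=Suc m..<n. summand j ?v ?w)"
      using sum_diff_nat_ivl[of 0 "Suc m" n "\<lambda>j. summand j ?v ?w"] n by (simp add: atLeast0LessThan)
    also have "\<bar>\<dots>\<bar> \<le> (\<Sum>j=Suc m..<n. C\<^sup>2 * (if j \<in> J then lam j else 0))"
      by (rule order_trans[OF sum_abs sum_mono]) (rule abs_summand_le_C[OF assms])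
    also have "\<dots> = C\<^sup>2 * sum lam (J \<inter> {Suc m..<n})"
      by (simp add: sum_distrib_left[symmetric] sum.If_cases Int_commute)
    also have "\<dots> \<le> C\<^sup>2 * ?S"
    proof (intro mult_left_mono finite_sum_le_infsum)
      show "lam summable_on {j \<in> J. j > m}" by (rule summable_on_subset_banach[OF lam_summable]) auto
    qed (use lam_pos less_imp_le in auto)
    finally show ?thesis .
  qed
  then have "\<bar>H (?v, ?w) - (\<Sum>j<Suc m. summand j ?v ?w)\<bar> \<le> C\<^sup>2 * ?S"
    by (intro LIMSEQ_le_const2[OF tendsto_rabs[OF tendsto_diff[OF lim tendsto_const]]]) blast
  then show ?thesis unfolding H fin .
qed

text \<open>Points of the closure are limits of sequences in \<Theta>, along which all the
  derivatives involved converge by uniform continuity; the right-hand side does not depend on the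
  points.\<close>

lemma expansion_bound_closure:
  assumes "mi_order \<alpha> \<le> s" "mi_order \<beta> \<le> s" and x: "x \<in> closure \<Theta>" and y: "y \<in> closure \<Theta>"
  shows "\<bar>closure_ext (\<Theta> \<times> \<Theta>) (mixed_deriv \<alpha> \<beta> h) (x, y) - (\<Sum>j | j \<in> J \<and> j \<le> m.
      lam j * closure_ext \<Theta> (classical_deriv \<alpha> (e j)) x * closure_ext \<Theta> (classical_deriv \<beta> (e j)) y)\<bar>
    \<le> C\<^sup>2 * (\<Sum>\<^sub>\<infinity>j\<in>{j \<in> J. j > m}. lam j)"
proof -
  obtain X where X: "\<And>n. X n \<in> \<Theta>" "X \<longlonglongrightarrow> x" using x closure_sequential by blast
  obtain Y where Y: "\<And>n. Y n \<in> \<Theta>" "Y \<longlonglongrightarrow> y" using y closure_sequential by blast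
  have adm: "admissible k (map Inl (mi_dirs \<alpha>) @ map Inr (mi_dirs \<beta>))"
    using low_order_A assms by (simp add: admissible_Inl_Inr len_A)
  have "(\<lambda>n. mixed_deriv \<alpha> \<beta> h (X n, Y n)) \<longlonglongrightarrow> closure_ext (\<Theta> \<times> \<Theta>) (mixed_deriv \<alpha> \<beta> h) (x, y)"
    by (rule closure_ext_tendsto[OF _ _ tendsto_Pair[OF X(2) Y(2)]])
       (use kd_regular(2)[OF adm] X(1) Y(1) in \<open>auto simp: mixed_deriv_eq_kd simp del: map_append\<close>)
  moreover have cl: "(\<lambda>n. classical_deriv \<gamma> (e j) (Z n)) \<longlonglongrightarrow> closure_ext \<Theta> (classical_deriv \<gamma> (e j)) z"
    if "j \<in> J" "mi_order \<gamma> \<le> s" "\<And>n. Z n \<in> \<Theta>" "Z \<longlonglongrightarrow> z" for j \<gamma> Z z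
    using that s by (intro closure_ext_tendsto C_k_closure_properties(2)[OF e_closure]) auto
  have "(\<lambda>n. \<Sum>j | j \<in> J \<and> j \<le> m. lam j * classical_deriv \<alpha> (e j) (X n) * classical_deriv \<beta> (e j) (Y n)) \<longlonglongrightarrow>
      (\<Sum>j | j \<in> J \<and> j \<le> m. lam j * closure_ext \<Theta> (classical_deriv \<alpha> (e j)) x * closure_ext \<Theta>
          (classical_deriv \<beta> (e j)) y)"
    by (intro tendsto_sum tendsto_mult tendsto_const cl X Y assms) auto
  ultimately show ?thesis
    by (intro LIMSEQ_le_const2[OF tendsto_rabs[OF tendsto_diff]]) (use expansion_bound[OF assms(1,2)
        X(1) Y(1)] in auto)
qed

end

end

section \<open>The uniform bound and the expansion for an arbitrary eigensystem\<close>

theorem corollary3p8: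
  fixes \<Theta> :: "(real ^ 'd) set" and k :: nat
  assumes "open \<Theta>" and "bounded \<Theta>" and "cone_property \<Theta>"
  shows
    "(\<exists>C>0. \<forall>s h J lam e.
        real k - real CARD('d) / 2 > real s \<and>
        h \<in> C_kk_closure k \<Theta> \<and> pos_def_kernel \<Theta> h \<and> eigensystem \<Theta> k h J lam e \<longrightarrow>
        (\<forall>j\<in>J. \<forall>\<alpha>. mi_order \<alpha> \<le> s \<longrightarrow> (\<forall>x\<in>\<Theta>. \<bar>classical_deriv \<alpha> (e j) x\<bar> \<le> C)))
     \<and>
     (\<forall>s h J lam e C.
        real k - real CARD('d) / 2 > real s \<and>
        h \<in> C_kk_closure k \<Theta> \<and> pos_def_kernel \<Theta> h \<and> eigensystem \<Theta> k h J lam e \<and>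
        C > 0 \<and>
        (\<forall>j\<in>J. \<forall>\<alpha>. mi_order \<alpha> \<le> s \<longrightarrow> (\<forall>x\<in>\<Theta>. \<bar>classical_deriv \<alpha> (e j) x\<bar> \<le> C)) \<longrightarrow>
        lam summable_on J \<and>
        (\<forall>m\<ge>1. \<forall>\<alpha> \<beta>. mi_order \<alpha> \<le> s \<and> mi_order \<beta> \<le> s \<longrightarrow>
          (\<forall>x\<in>closure \<Theta>. \<forall>y\<in>closure \<Theta>.
            \<bar>closure_ext (\<Theta> \<times> \<Theta>) (mixed_deriv \<alpha> \<beta> h) (x, y)
              - (\<Sum>j | j \<in> J \<and> j \<le> m.
                   lam j * closure_ext \<Theta> (classical_deriv \<alpha> (e j)) x
                         * closure_ext \<Theta> (classical_deriv \<beta> (e j)) y)\<bar>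
            \<le> C\<^sup>2 * (\<Sum>\<^sub>\<infinity>j\<in>{j \<in> J. j > m}. lam j))))"
proof -
  \<comment> \<open>The least integer greater than d / 2, fixed before \<open>s\<close> and the
    kernel so that the constant depends on neither.\<close>
  define m where "m = CARD('d) div 2 + 1"
  have m: "2 * m > CARD('d)" unfolding m_def by presburger
  obtain C where C: "C > 0" "\<And>g x. g \<in> C_k m \<Theta> \<Longrightarrow> x \<in> \<Theta> \<Longrightarrow>
    (\<And>w. length w \<le> m \<Longrightarrow>
      (\<integral>\<^sup>+ y. ennreal (indicator \<Theta> y * (iter_partial (map coord_dir w) g y)\<^sup>2) \<partial>lborel) \<le> 1) \<Longrightarrow> \<bar>g x\<bar> \<le> C"
    using sobolev_embedding[OF assms m] by blast
  have es: "kernel_eigensystem \<Theta> k h J lam e"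
    if "h \<in> C_kk_closure k \<Theta>" "pos_def_kernel \<Theta> h" "eigensystem \<Theta> k h J lam e" for h J lam e
    by unfold_locales (use assms that in auto)
  show ?thesis
  proof (intro conjI exI[of _ C] C(1) allI impI ballI; (elim conjE)?)
    fix s h J lam e j and \<alpha> :: "nat ^ 'd" and x
    assume sk: "real k - real CARD('d) / 2 > real s" and j: "j \<in> J" and \<alpha>: "mi_order \<alpha> \<le> s" and x: "x \<in> \<Theta>"
      and "h \<in> C_kk_closure k \<Theta>" "pos_def_kernel \<Theta> h" "eigensystem \<Theta> k h J lam e"
    then interpret kernel_eigensystem \<Theta> k h J lam e by (intro es)
    have "real (2 * s + CARD('d)) < real (2 * k)" using sk by simp
    then have "2 * s + CARD('d) < 2 * k" by (simp only: of_nat_less_iff)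
    \<comment> \<open>As 2 k > 2 s + d, the integer k - s exceeds d / 2 and hence is at least
      \<open>m\<close>.\<close>
    then have "s + m \<le> k" unfolding m_def by presburger
    then have len: "length w + length (mi_dirs \<alpha>) \<le> k" if "length w \<le> m" for w :: "'d list"
      using \<alpha> that by (simp add: length_mi_dirs)
    have eq: "iter_partial (map coord_dir w) (classical_deriv \<alpha> (e j)) = iter_partial (map coord_dir
        (w @ mi_dirs \<alpha>)) (e j)" for w
      by (simp add: classical_deriv_def iter_partial_append)
    \<comment> \<open>The embedding acts on the derivative of order \<alpha>; its derivatives of
      order up to \<open>m\<close> are derivatives of \<open>e j\<close> of order up to
      \<open>k\<close>, with square integrals at most 1.\<close>
    show "\<bar>classical_deriv \<alpha> (e j) x\<bar> \<le> C"
    proof (rule C(2)[OF _ x])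
      have "iter_partial_exists \<Theta> (map coord_dir (w @ mi_dirs \<alpha>)) (e j) \<and>
          continuous_on \<Theta> (iter_partial (map coord_dir (w @ mi_dirs \<alpha>)) (e j))" if "length w \<le> m" for w
        using e_C_k[OF j] len[OF that] unfolding C_k_def mem_Collect_eq by (elim allE[of _ "w @
            mi_dirs \<alpha>"]) simp
      then show "classical_deriv \<alpha> (e j) \<in> C_k m \<Theta>"
        by (auto simp: C_k_def classical_deriv_def iter_partial_append iter_partial_exists_append)
      fix w :: "'d list" assume "length w \<le> m"
      then show "(\<integral>\<^sup>+ y. ennreal (indicator \<Theta> y * (iter_partial (map coord_dir w) (classical_deriv \<alpha>
          (e j)) y)\<^sup>2) \<partial>lborel) \<le> 1"
        unfolding eq by (intro iter_partial_L2_le_1[OF j]) (simp add: len)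
    qed
  next
    fix s h J lam e
    assume "h \<in> C_kk_closure k \<Theta>" "pos_def_kernel \<Theta> h" "eigensystem \<Theta> k h J lam e"
    then show "lam summable_on J" by (rule kernel_eigensystem.lam_summable[OF es])
  next
    fix s h J lam e C m and \<alpha> \<beta> :: "nat ^ 'd" and x y
    assume "real k - real CARD('d) / 2 > real s"
    then have s: "s \<le> k" by linarith
    assume eig: "h \<in> C_kk_closure k \<Theta>" "pos_def_kernel \<Theta> h" "eigensystem \<Theta> k h J lam e"
      and "C > 0" "\<forall>j\<in>J. \<forall>\<alpha>. mi_order \<alpha> \<le> s \<longrightarrow> (\<forall>x\<in>\<Theta>. \<bar>classical_deriv \<alpha> (e j) x\<bar> \<le> C)"
      and "mi_order \<alpha> \<le> s" "mi_order \<beta> \<le> s" "x \<in> closure \<Theta>" "y \<in> closure \<Theta>"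
    then show "\<bar>closure_ext (\<Theta> \<times> \<Theta>) (mixed_deriv \<alpha> \<beta> h) (x, y) - (\<Sum>j | j \<in> J \<and> j \<le> m.
        lam j * closure_ext \<Theta> (classical_deriv \<alpha> (e j)) x * closure_ext \<Theta> (classical_deriv \<beta> (e j)) y)\<bar>
      \<le> C\<^sup>2 * (\<Sum>\<^sub>\<infinity>j\<in>{j \<in> J. j > m}. lam j)"
      by (intro kernel_eigensystem.expansion_bound_closure[OF es[OF eig] s]) auto
  qed
qed

end
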